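(* Let $g>0$ and, for even $n$, let $m_n=g/\sqrt n$. Let the field $\varphi=(\varphi_0,\dots,\varphi_{n+1})$ be distributed either according to $P_{m_n}$ (the "grand canonical" setting) or according to $P_{m_n}(\,\cdot\mid X=0)$ with $X=\sum_{i=1}^n\varphi_i$ (the "canonical" setting). In both cases, as $n\to\infty$ along even integers, the process $(W^n_t)_{t\in\mathbb{R}}$ converges weakly to the stationary Ornstein--Uhlenbeck process on $\mathbb{R}$ that is the centered continuous Gaussian process with covariance $$\mathrm{Cov}(Y_s,Y_t)=\frac{1}{\sqrt2\,g}\,e^{-\sqrt2\,g\,|t-s|},\qquad s,t\in\mathbb{R}.$$
   Context: For $m\ge0$ and $n\ge1$, $P_m$ is the probability law of the Gaussian vector $(\varphi_0,\dots,\varphi_{n+1})$ with $\varphi_0=\varphi_{n+1}=0$ and $(\varphi_1,\dots,\varphi_n)$ having density on $\mathbb{R}^n$ proportional to $$\exp\Bigl(-\tfrac14\sum_{i=1}^{n+1}(\varphi_i-\varphi_{i-1})^2-\tfrac{m^2}{2}\sum_{i=1}^{n+1}\varphi_i^2\Bigr).$$ (The dependence on $n$ is implicit.) $P_m(\cdot\mid X=0)$ is the Gaussian law obtained by conditioning on the linear functional $X=\sum_{i=1}^n\varphi_i$ being $0$. For even $n$ and $t\in\mathbb{R}$, with $\{x\}=x-\lfloor x\rfloor$, $$W_t^n=\frac{1}{n^{1/4}}\Bigl[(1-\{tn^{1/2}\})\,\varphi_{n/2+\lfloor tn^{1/2}\rfloor}+\{tn^{1/2}\}\,\varphi_{n/2+\lceil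 tn^{1/2}\rceil}\Bigr],$$ with the convention $\varphi_k=0$ for $k\notin\{0,\dots,n+1\}$ (irrelevant for $t$ in a compact set and $n$ large). Weak convergence is as random continuous functions, in $C([-M,M])$ with the uniform topology for every $M>0$. *)

theory Defs
  imports "HOL-Probability.Probability"
begin

section \<open>Weak convergence\<close>

text \<open>Convergence of integrals of bounded continuous functions. The demand that all measures
  involved be probability measures matters when they are image measures: \<^const>\<open>distr\<close> of a
  non-measurable map is the null measure.\<close>

definition weak_converges ::
    "'s topology \<Rightarrow> ('i \<Rightarrow> 's measure) \<Rightarrow> 's measure \<Rightarrow> 'i filter \<Rightarrow> bool" where
  "weak_converges T \<mu> \<nu> F \<longleftrightarrow>
     (\<forall>\<^sub>F i in F. prob_space (\<mu> i)) \<and> prob_space \<nu> \<and>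
     (\<forall>f. continuous_map T euclideanreal f \<and> bounded (f ` topspace T) \<longrightarrow>
        ((\<lambda>i. integral\<^sup>L (\<mu> i) f) \<longlongrightarrow> integral\<^sup>L \<nu> f) F)"

definition borel_of :: "'s topology \<Rightarrow> 's measure" where
  "borel_of T = sigma (topspace T) {U. openin T U}"

definition C_space :: "real \<Rightarrow> (real \<Rightarrow> real) topology" where
  "C_space M = mtopology_of (cfunspace (top_of_set {-M..M}) euclidean_metric)"

definition path_law :: "'w measure \<Rightarrow> (real \<Rightarrow> 'w \<Rightarrow> real) \<Rightarrow> real \<Rightarrow> (real \<Rightarrow> real) measure" where
  "path_law \<Omega> Z M = distr \<Omega> (borel_of (C_space M)) (\<lambda>\<omega>. restrict (\<lambda>t. Z t \<omega>) {-M..M})"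

definition process_converges_weakly ::
    "('i \<Rightarrow> 'v measure) \<Rightarrow> ('i \<Rightarrow> real \<Rightarrow> 'v \<Rightarrow> real) \<Rightarrow>
     'w measure \<Rightarrow> (real \<Rightarrow> 'w \<Rightarrow> real) \<Rightarrow> 'i filter \<Rightarrow> bool" where
  "process_converges_weakly P Z \<Omega> Y F \<longleftrightarrow>
     (\<forall>M>0. weak_converges (C_space M) (\<lambda>i. path_law (P i) (Z i) M) (path_law \<Omega> Y M) F)"

section \<open>Conditioning on the value of a real random variable\<close>

definition regular_cond_law :: "'a measure \<Rightarrow> ('a \<Rightarrow> real) \<Rightarrow> (real \<Rightarrow> 'a measure) \<Rightarrow> bool" where
  "regular_cond_law P X \<kappa> \<longleftrightarrow>
     \<kappa> \<in> borel \<rightarrow>\<^sub>M prob_algebra P \<and>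
     (\<forall>A\<in>sets P. \<forall>B\<in>sets borel.
        emeasure P (A \<inter> X -` B) = (\<integral>\<^sup>+x\<in>B. emeasure (\<kappa> x) A \<partial>(distr P borel X)))"

text \<open>The event \<open>X = x\<close> may be a null event, so the value at \<open>x\<close> of a regular conditional law is
  only pinned down by choosing the weakly continuous version; that version is unique when the
  law of \<open>X\<close> has full support.\<close>

definition cond_law :: "'a topology \<Rightarrow> 'a measure \<Rightarrow> ('a \<Rightarrow> real) \<Rightarrow> real \<Rightarrow> 'a measure" where
  "cond_law T P X x =
     (THE Q. \<exists>\<kappa>. regular_cond_law P X \<kappa> \<and> (\<forall>y. weak_converges T \<kappa> (\<kappa> y) (at y)) \<and> Q = \<kappa> x)"

section \<open>The Gaussian field\<close>

definition field_weight :: "real \<Rightarrow> nat \<Rightarrow> (nat \<Rightarrow> real) \<Rightarrow> real" where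
  "field_weight m n \<phi> =
     exp (- (1/4) * (\<Sum>i=1..n+1. (\<phi> i - \<phi> (i - 1))\<^sup>2) - m\<^sup>2 / 2 * (\<Sum>i=1..n+1. (\<phi> i)\<^sup>2))"

definition pin :: "nat \<Rightarrow> (nat \<Rightarrow> real) \<Rightarrow> nat \<Rightarrow> real" where
  "pin n \<phi> = (\<lambda>i\<in>{0..n+1}. if i \<in> {1..n} then \<phi> i else 0)"

definition field_space :: "nat \<Rightarrow> (nat \<Rightarrow> real) measure" where
  "field_space n = (\<Pi>\<^sub>M i\<in>{0..n+1}. borel)"

definition field_topology :: "nat \<Rightarrow> (nat \<Rightarrow> real) topology" where
  "field_topology n = product_topology (\<lambda>i. euclideanreal) {0..n+1}"

definition grand_canonical :: "real \<Rightarrow> nat \<Rightarrow> (nat \<Rightarrow> real) measure" where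
  "grand_canonical m n =
     (let L = (\<Pi>\<^sub>M i\<in>{1..n}. lborel);
          Z = (\<integral>\<phi>. field_weight m n (pin n \<phi>) \<partial>L)
      in distr (density L (\<lambda>\<phi>. ennreal (field_weight m n (pin n \<phi>) / Z))) (field_space n) (pin n))"

definition canonical :: "real \<Rightarrow> nat \<Rightarrow> (nat \<Rightarrow> real) measure" where
  "canonical m n =
     cond_law (field_topology n) (grand_canonical m n) (\<lambda>\<phi>. \<Sum>i=1..n. \<phi> i) 0"

section \<open>The rescaled process\<close>

definition field_at :: "nat \<Rightarrow> (nat \<Rightarrow> real) \<Rightarrow> int \<Rightarrow> real" where
  "field_at n \<phi> k = (if k \<in> {0..int n + 1} then \<phi> (nat k) else 0)"

definition W :: "nat \<Rightarrow> real \<Rightarrow> (nat \<Rightarrow> real) \<Rightarrow> real" where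
  "W n t \<phi> = 1 / real n powr (1/4) *
     ((1 - frac (t * sqrt (real n))) * field_at n \<phi> (int (n div 2) + \<lfloor>t * sqrt (real n)\<rfloor>)
      + frac (t * sqrt (real n)) * field_at n \<phi> (int (n div 2) + \<lceil>t * sqrt (real n)\<rceil>))"

section \<open>The stationary Ornstein--Uhlenbeck process\<close>

text \<open>Point masses count as Gaussian.\<close>

definition gaussian_rv :: "'w measure \<Rightarrow> ('w \<Rightarrow> real) \<Rightarrow> bool" where
  "gaussian_rv \<Omega> X \<longleftrightarrow> X \<in> borel_measurable \<Omega> \<and>
     ((\<exists>c. AE \<omega> in \<Omega>. X \<omega> = c) \<or>
      (\<exists>\<mu>. \<exists>\<sigma>>0. distributed \<Omega> lborel X (normal_density \<mu> \<sigma>)))"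

definition gaussian_process :: "'w measure \<Rightarrow> ('t \<Rightarrow> 'w \<Rightarrow> real) \<Rightarrow> bool" where
  "gaussian_process \<Omega> Y \<longleftrightarrow> prob_space \<Omega> \<and>
     (\<forall>S c. finite S \<longrightarrow> gaussian_rv \<Omega> (\<lambda>\<omega>. \<Sum>t\<in>S. c t * Y t \<omega>))"

definition covariance :: "'w measure \<Rightarrow> ('w \<Rightarrow> real) \<Rightarrow> ('w \<Rightarrow> real) \<Rightarrow> real" where
  "covariance \<Omega> X X' =
     (\<integral>\<omega>. (X \<omega> - integral\<^sup>L \<Omega> X) * (X' \<omega> - integral\<^sup>L \<Omega> X') \<partial>\<Omega>)"

definition stationary_OU :: "real \<Rightarrow> 'w measure \<Rightarrow> (real \<Rightarrow> 'w \<Rightarrow> real) \<Rightarrow> bool" where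
  "stationary_OU g \<Omega> Y \<longleftrightarrow>
     gaussian_process \<Omega> Y \<and>
     (\<forall>t. integral\<^sup>L \<Omega> (Y t) = 0) \<and>
     (\<forall>s t. covariance \<Omega> (Y s) (Y t) = 1 / (sqrt 2 * g) * exp (- sqrt 2 * g * \<bar>t - s\<bar>)) \<and>
     (\<forall>\<omega>\<in>space \<Omega>. continuous_on UNIV (\<lambda>t. Y t \<omega>))"

definition even_sequentially :: "nat filter" where
  "even_sequentially = inf sequentially (principal {n. even n})"

end

theory Submission
  imports Defs
begin

text \<open>
  Why the theorem holds. The pinned massive field is a Gaussian vector whose covariance is the Green
  function of the lattice operator \<open>(1 + m\<^sup>2) v i - (v (i - 1) + v (i + 1)) / 2\<close> with zero boundary values.
  With \<open>cosh \<theta> = 1 + m\<^sup>2\<close> and \<open>N = n + 1\<close> that function is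
  \<open>(cosh (\<theta> (N - \<bar>i - j\<bar>)) - cosh (\<theta> (N - i - j))) / (sinh \<theta> * sinh (\<theta> N))\<close>, and for \<open>m = g / sqrt n\<close>
  one has \<open>\<theta> sqrt n \<longlonglongrightarrow> sqrt 2 * g\<close>. Around the middle of the lattice, at distances of order
  \<open>sqrt n\<close>, the Green function divided by \<open>sqrt n\<close> tends to the Ornstein--Uhlenbeck covariance
  (\<open>lattice_covariance_lim\<close>). Fixing the sum of the field at 0 subtracts from the covariance a rank-one
  term of size \<open>O(1)\<close>, which vanishes after division by \<open>sqrt n\<close>. So both fields have the same limit, and
  they are treated together through the predicate \<open>pinned_field_law\<close>.

  From covariances to path laws. For centred Gaussian processes with continuous paths, convergence
  of the covariances and a bound \<open>E (Z s - Z t)\<^sup>2 \<le> C * \<bar>s - t\<bar>\<close> uniform in the index imply weak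
  convergence on every compact interval (\<open>gaussian_process_path_convergence\<close>). A path is replaced by
  its dyadic polygon; by chaining, with fourth moments of the increments, the error is small
  uniformly in the index. The polygon depends on finitely many values of the path, and their
  joint law converges by \<open>vector_weak_convergence\<close>, where test functions are approximated by
  trigonometric polynomials.

  The Gaussian law of the field. Translation invariance of Lebesgue measure and completing the
  square give the Cameron--Martin formula (\<open>cameron_martin\<close>). Averaging it over the size of the
  translation yields \<open>disintegration\<close>: for every linear functional \<open>X\<close>, the field law is a normal
  mixture over \<open>y\<close> of the laws of the field moved along a fixed direction until \<open>X = y\<close>. From this one
  reads off that linear functionals are normal, and also an explicit regular conditional
  law given \<open>X\<close>. That conditional law is weakly continuous in \<open>y\<close>, and a weakly continuous version is
  unique because the law of \<open>X\<close> has a positive density; this identifies the canonical law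
  (\<open>canonical_eq\<close>).
\<close>

section \<open>Testing weak convergence with Lipschitz functions\<close>

lemma integrable_comp_bounded:
  fixes f :: "'a::topological_space \<Rightarrow> real"
  assumes "prob_space M" and X: "X \<in> M \<rightarrow>\<^sub>M borel"
    and f: "continuous_on UNIV f" and B: "\<And>x. \<bar>f x\<bar> \<le> B"
  shows "integrable M (\<lambda>\<omega>. f (X \<omega>))"
proof -
  interpret prob_space M by fact
  have "f \<in> borel_measurable borel" using f by (rule borel_measurable_continuous_onI)
  then have "(\<lambda>\<omega>. f (X \<omega>)) \<in> borel_measurable M" using X by measurable
  then show ?thesis
    by (intro integrable_const_bound[where B=B]) (auto simp: B)
qed

text \<open>
  The Pasch--Hausdorff envelope: the largest \<open>L\<close>-Lipschitz function below \<open>f\<close>.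
\<close>

definition inf_convolution :: "('a::metric_space \<Rightarrow> real) \<Rightarrow> real \<Rightarrow> 'a \<Rightarrow> real" where
  "inf_convolution f L x = (INF y. f y + L * dist x y)"

context
  fixes f :: "'a::metric_space \<Rightarrow> real" and B L :: real
  assumes B: "\<And>x. \<bar>f x\<bar> \<le> B" and L: "0 \<le> L"
begin

lemma inf_convolution_bdd_below: "bdd_below (range (\<lambda>y. f y + L * dist x y))"
proof (rule bdd_belowI2[where m="-B"])
  fix y show "- B \<le> f y + L * dist x y"
    using B[of y] L by (smt (verit) mult_nonneg_nonneg zero_le_dist)
qed

lemma inf_convolution_le: "inf_convolution f L x \<le> f y + L * dist x y"
  unfolding inf_convolution_def by (rule cINF_lower[OF inf_convolution_bdd_below]) simp

lemma inf_convolution_ge: "- B \<le> inf_convolution f L x"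
  unfolding inf_convolution_def
proof (rule cINF_greatest)
  fix y show "- B \<le> f y + L * dist x y"
    using B[of y] L by (smt (verit) mult_nonneg_nonneg zero_le_dist)
qed simp

lemma inf_convolution_abs_le: "\<bar>inf_convolution f L x\<bar> \<le> B"
  using inf_convolution_le[of x x] inf_convolution_ge[of x] B[of x] by simp

lemma inf_convolution_lipschitz:
  "\<bar>inf_convolution f L x - inf_convolution f L y\<bar> \<le> L * dist x y"
proof -
  have "inf_convolution f L x \<le> inf_convolution f L y + L * dist x y" for x y
  proof -
    have "inf_convolution f L x - L * dist x y \<le> f z + L * dist y z" for z
    proof -
      have "L * dist x z \<le> L * dist x y + L * dist y z"
        using mult_left_mono[OF dist_triangle[of x z y] L] by (simp add: algebra_simps)
      then show ?thesis using inf_convolution_le[of x z] by linarith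
    qed
    then have "inf_convolution f L x - L * dist x y \<le> inf_convolution f L y"
      unfolding inf_convolution_def[of f L y] by (intro cINF_greatest) auto
    then show ?thesis by simp
  qed
  from this[of x y] this[of y x] show ?thesis by (simp add: dist_commute abs_le_iff)
qed

end

lemma inf_convolution_tendsto:
  fixes f :: "'a::metric_space \<Rightarrow> real"
  assumes B: "\<And>x. \<bar>f x\<bar> \<le> B" and f: "continuous_on UNIV f"
  shows "(\<lambda>k. inf_convolution f (real k) x) \<longlonglongrightarrow> f x"
proof (rule LIMSEQ_I)
  fix e :: real assume "0 < e"
  from f have "isCont f x" by (simp add: continuous_on_eq_continuous_at)
  then obtain d where d: "d > 0" "\<And>y. dist x y < d \<Longrightarrow> \<bar>f y - f x\<bar> < e / 2"
    using \<open>0 < e\<close> unfolding continuous_at_eps_delta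
    by (metis dist_commute dist_real_def half_gt_zero)
  obtain k0 :: nat where k0: "real k0 > 2 * B / d" using reals_Archimedean2 by blast
  show "\<exists>no. \<forall>n\<ge>no. norm (inf_convolution f (real n) x - f x) < e"
  proof (intro exI allI impI)
    fix k assume "k0 \<le> k"
    have "f x - e / 2 \<le> f y + real k * dist x y" for y
    proof (cases "dist x y < d")
      case True
      then show ?thesis using d(2)[of y] by (smt (verit) mult_nonneg_nonneg of_nat_0_le_iff zero_le_dist)
    next
      case False
      have "2 * B = (2 * B / d) * d" using d(1) by simp
      also have "\<dots> \<le> real k * dist x y"
        using k0 \<open>k0 \<le> k\<close> False d(1) by (intro mult_mono) auto
      finally show ?thesis using B[of x] B[of y] \<open>0 < e\<close> by linarith
    qed
    then have "f x - e / 2 \<le> inf_convolution f (real k) x"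
      unfolding inf_convolution_def by (intro cINF_greatest) auto
    moreover have "inf_convolution f (real k) x \<le> f x"
      using inf_convolution_le[OF B, where L="real k" and x=x and y=x] by simp
    ultimately show "norm (inf_convolution f (real k) x - f x) < e"
      using \<open>0 < e\<close> by auto
  qed
qed

lemma lipschitz_imp_continuous_on:
  fixes f :: "'a::metric_space \<Rightarrow> real"
  assumes "\<And>x y. \<bar>f x - f y\<bar> \<le> L * dist x y"
  shows "continuous_on UNIV f"
proof -
  have "0 \<le> L \<or> (\<forall>x y::'a. x = y)"
    by (metis assms abs_ge_zero dist_pos_lt dual_order.trans zero_le_mult_iff linorder_not_le)
  then show ?thesis
  proof
    assume "0 \<le> L"
    have "L-lipschitz_on UNIV f"
      using assms \<open>0 \<le> L\<close> by (intro lipschitz_onI) (auto simp: dist_real_def)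
    then show ?thesis by (rule lipschitz_on_continuous_on)
  next
    assume "\<forall>x y::'a. x = y"
    then have "f = (\<lambda>_. f undefined)" by metis
    then show ?thesis by (metis continuous_on_const)
  qed
qed

text \<open>
  The envelopes \<open>inf_convolution f k\<close> are Lipschitz minorants of \<open>f\<close> that tend to \<open>f\<close> pointwise.
  Hence convergence for Lipschitz tests bounds the lower limit of the expectations of \<open>f\<close> from below by the
  expectation at the limit; the same bound for \<open>- f\<close> controls the upper limit.
\<close>

theorem weak_limit_of_lipschitz_tests:
  fixes X :: "nat \<Rightarrow> 'v \<Rightarrow> 'a::metric_space" and X' :: "'w \<Rightarrow> 'a"
  assumes P: "\<And>n. prob_space (P n)" and Q: "prob_space Q"
    and X: "\<And>n. X n \<in> P n \<rightarrow>\<^sub>M borel" and X': "X' \<in> Q \<rightarrow>\<^sub>M borel"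
    and lip: "\<And>h L B. \<lbrakk>\<And>x y. \<bar>h x - h y\<bar> \<le> L * dist x y; \<And>x. \<bar>h x\<bar> \<le> B\<rbrakk> \<Longrightarrow>
        (\<lambda>n. \<integral>\<omega>. h (X n \<omega>) \<partial>P n) \<longlonglongrightarrow> (\<integral>\<omega>. h (X' \<omega>) \<partial>Q)"
    and f: "continuous_on UNIV f" and B: "\<And>x. \<bar>f x :: real\<bar> \<le> B"
  shows "(\<lambda>n. \<integral>\<omega>. f (X n \<omega>) \<partial>P n) \<longlonglongrightarrow> (\<integral>\<omega>. f (X' \<omega>) \<partial>Q)"
proof -
  have lower: "\<forall>\<^sub>F n in sequentially. a < (\<integral>\<omega>. f (X n \<omega>) \<partial>P n)"
    if f: "continuous_on UNIV f" and B: "\<And>x. \<bar>f x\<bar> \<le> B" and a: "a < (\<integral>\<omega>. f (X' \<omega>) \<partial>Q)" for f a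
  proof -
    define F where "F k = inf_convolution f (real k)" for k
    have F_lip: "\<bar>F k x - F k y\<bar> \<le> real k * dist x y" for k x y
      unfolding F_def by (rule inf_convolution_lipschitz[OF B]) simp
    have F_bd: "\<bar>F k x\<bar> \<le> B" for k x
      unfolding F_def by (rule inf_convolution_abs_le[OF B]) simp
    have F_cont: "continuous_on UNIV (F k)" for k
      by (rule lipschitz_imp_continuous_on[OF F_lip])
    have F_le: "F k x \<le> f x" for k x
      unfolding F_def using inf_convolution_le[OF B, where L="real k" and x=x and y=x] by simp
    interpret Q: prob_space Q by fact
    have "(\<lambda>k. \<integral>\<omega>. F k (X' \<omega>) \<partial>Q) \<longlonglongrightarrow> (\<integral>\<omega>. f (X' \<omega>) \<partial>Q)"
    proof (rule integral_dominated_convergence[where w="\<lambda>_. B"])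
      show "AE \<omega> in Q. (\<lambda>k. F k (X' \<omega>)) \<longlonglongrightarrow> f (X' \<omega>)"
        unfolding F_def using inf_convolution_tendsto[OF B f] by auto
    qed (use integrable_comp_bounded[OF Q X' F_cont F_bd] integrable_comp_bounded[OF Q X' f B] F_bd
          in \<open>auto dest: borel_measurable_integrable\<close>)
    from order_tendstoD(1)[OF this a] obtain k where "a < (\<integral>\<omega>. F k (X' \<omega>) \<partial>Q)"
      unfolding eventually_sequentially by blast
    then have "\<forall>\<^sub>F n in sequentially. a < (\<integral>\<omega>. F k (X n \<omega>) \<partial>P n)"
      by (intro order_tendstoD(1)[OF lip[OF F_lip F_bd]])
    moreover have "(\<integral>\<omega>. F k (X n \<omega>) \<partial>P n) \<le> (\<integral>\<omega>. f (X n \<omega>) \<partial>P n)" for n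
      by (intro integral_mono integrable_comp_bounded[OF P X F_cont F_bd]
          integrable_comp_bounded[OF P X f B] F_le)
    ultimately show ?thesis
      by (auto elim!: eventually_mono intro: less_le_trans)
  qed
  show ?thesis
  proof (rule order_tendstoI)
    fix a assume "a < (\<integral>\<omega>. f (X' \<omega>) \<partial>Q)"
    then show "\<forall>\<^sub>F n in sequentially. a < (\<integral>\<omega>. f (X n \<omega>) \<partial>P n)" by (rule lower[OF f B])
  next
    fix a assume "(\<integral>\<omega>. f (X' \<omega>) \<partial>Q) < a"
    then have "\<forall>\<^sub>F n in sequentially. - a < (\<integral>\<omega>. - f (X n \<omega>) \<partial>P n)"
      by (intro lower) (auto intro: continuous_intros f simp: B)
    then show "\<forall>\<^sub>F n in sequentially. (\<integral>\<omega>. f (X n \<omega>) \<partial>P n) < a"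
      by simp
  qed
qed

section \<open>Weak convergence of random vectors\<close>

text \<open>
  Finite sums of plane waves in the first \<open>K + 1\<close> coordinates. With the phase \<open>b\<close>, one kind of wave covers
  constants, sines and cosines, and sums of waves are closed under products.
\<close>

inductive trig_poly :: "nat \<Rightarrow> ((nat \<Rightarrow> real) \<Rightarrow> real) \<Rightarrow> bool" for K where
  wave: "trig_poly K (\<lambda>x. a * cos ((\<Sum>j\<le>K. c j * x j) + b))"
| add: "trig_poly K f \<Longrightarrow> trig_poly K g \<Longrightarrow> trig_poly K (\<lambda>x. f x + g x)"

lemma trig_poly_const: "trig_poly K (\<lambda>_. a)"
  using trig_poly.wave[of K a "\<lambda>_. 0" 0] by simp

lemma trig_poly_sin:
  assumes "j \<le> K" shows "trig_poly K (\<lambda>x. sin (x j / R))"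
proof -
  have "(\<Sum>i\<le>K. (if i = j then 1 / R else 0) * x i) = x j / R" for x :: "nat \<Rightarrow> real"
  proof -
    have "(\<Sum>i\<le>K. (if i = j then 1 / R else 0) * x i) = (\<Sum>i\<le>K. if i = j then x i / R else 0)"
      by (intro sum.cong) auto
    then show ?thesis using assms by simp
  qed
  then show ?thesis
    using trig_poly.wave[of K 1 "\<lambda>i. if i = j then 1 / R else 0" "- (pi / 2)"]
    by (simp add: cos_diff)
qed

lemma trig_poly_mult:
  assumes "trig_poly K f" "trig_poly K g" shows "trig_poly K (\<lambda>x. f x * g x)"
  using assms(1)
proof induction
  case (wave a c b)
  from assms(2) show ?case
  proof induction
    case (wave a' c' b')
    have eq: "a * cos ((\<Sum>j\<le>K. c j * x j) + b) * (a' * cos ((\<Sum>j\<le>K. c' j * x j) + b')) =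
        a * a' / 2 * cos ((\<Sum>j\<le>K. (c j - c' j) * x j) + (b - b')) +
        a * a' / 2 * cos ((\<Sum>j\<le>K. (c j + c' j) * x j) + (b + b'))" for x
    proof -
      have prod: "a * cos u * (a' * cos v) = a * a' / 2 * cos (u - v) + a * a' / 2 * cos (u + v)" for u v
        by (simp add: cos_add cos_diff field_simps)
      have "(\<Sum>j\<le>K. (c j - c' j) * x j) + (b - b') = ((\<Sum>j\<le>K. c j * x j) + b) - ((\<Sum>j\<le>K. c' j * x j) + b')"
        "(\<Sum>j\<le>K. (c j + c' j) * x j) + (b + b') = ((\<Sum>j\<le>K. c j * x j) + b) + ((\<Sum>j\<le>K. c' j * x j) + b')"
        by (simp_all add: algebra_simps sum.distrib sum_subtractf)
      then show ?thesis by (simp only: prod)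
    qed
    show ?case unfolding eq by (intro trig_poly.intros)
  next
    case (add f' g')
    then show ?case by (simp add: distrib_left trig_poly.add)
  qed
next
  case (add f' g')
  then show ?case by (simp add: distrib_right trig_poly.add)
qed

lemma trig_poly_continuous: "trig_poly K f \<Longrightarrow> continuous_on UNIV f"
  by (induction rule: trig_poly.induct) (auto intro!: continuous_intros)

lemma trig_poly_bounded: "trig_poly K f \<Longrightarrow> \<exists>B. \<forall>x. \<bar>f x\<bar> \<le> B"
proof (induction rule: trig_poly.induct)
  case (wave a c b)
  show ?case
    by (rule exI[of _ "\<bar>a\<bar>"]) (auto simp: abs_mult intro!: mult_left_le)
next
  case (add f g)
  then show ?case by (meson abs_triangle_ineq add_mono order_trans)
qed

lemma measurable_into_sequences:
  assumes "\<And>j. (\<lambda>\<omega>. V \<omega> j) \<in> borel_measurable M"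
  shows "(V :: 'a \<Rightarrow> nat \<Rightarrow> real) \<in> M \<rightarrow>\<^sub>M borel"
  using assms by (intro measurable_coordinatewise_then_product)

text \<open>
  On the cube \<open>\<bar>x j\<bar> \<le> R\<close> the vector \<open>x\<close> can be recovered from \<open>sin (x j / R)\<close> by \<open>arcsin\<close>; so there \<open>F\<close> equals a
  bounded continuous function \<open>H\<close> of these sines. By Stone--Weierstrass \<open>H\<close> is, on the compact cube
  of all values of the sines, uniformly close to a polynomial, and a polynomial in sines is a trigonometric
  polynomial. The approximation holds for all \<open>x\<close>, because sines never leave that
  cube; where \<open>x\<close> is outside the original cube, the quadratic term is at least the crude bound \<open>2 * B\<close>.
\<close>

lemma trig_poly_approximation:
  fixes F :: "(nat \<Rightarrow> real) \<Rightarrow> real"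
  assumes F: "continuous_on UNIV F" and B: "\<And>x. \<bar>F x\<bar> \<le> B" and R: "0 < R" and e: "0 < e"
  obtains T where "trig_poly K T"
    "\<And>x. (\<And>j. K < j \<Longrightarrow> x j = 0) \<Longrightarrow> \<bar>F x - T x\<bar> \<le> 2 * B / R\<^sup>2 * (\<Sum>j\<le>K. (x j)\<^sup>2) + e"
proof -
  define H where "H y = F (\<lambda>j. R * arcsin (max (-1) (min 1 (y j))))" for y
  have H: "continuous_on UNIV H"
    unfolding H_def
    by (intro continuous_on_compose2[OF F] continuous_on_coordinatewise_then_product continuous_intros)
       (auto)
  define S where "S = (PiE UNIV (\<lambda>j. if j \<le> K then {-1..1} else {0}) :: (nat \<Rightarrow> real) set)"
  define y where "y x j = (if j \<le> K then sin (x j / R) else 0)" for x :: "nat \<Rightarrow> real" and j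
  have yS: "y x \<in> S" for x by (auto simp: S_def y_def PiE_def)
  have "\<exists>g. (continuous_on S g \<and> trig_poly K (\<lambda>x. g (y x))) \<and> (\<forall>z\<in>S. \<bar>H z - g z\<bar> < e)"
  proof (rule Stone_Weierstrass_HOL)
    have "compactin (product_topology (\<lambda>_. euclidean) UNIV) S"
      unfolding S_def by (subst compactin_PiE) auto
    then show "compact S" by (simp add: euclidean_product_topology)
    show "\<exists>f. (continuous_on S f \<and> trig_poly K (\<lambda>x. f (y x))) \<and> f u \<noteq> f v"
      if "u \<in> S \<and> v \<in> S \<and> u \<noteq> v" for u v
    proof -
      from that obtain j where j: "u j \<noteq> v j" by auto
      have "j \<le> K"
      proof (rule ccontr)
        assume "\<not> j \<le> K"
        then have "u j \<in> {0}" "v j \<in> {0}" using that PiE_mem[of _ UNIV _ j] unfolding S_def by force+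
        with j show False by simp
      qed
      then show ?thesis
        using j continuous_on_subset[OF continuous_on_product_coordinates, of S j]
        by (intro exI[of _ "\<lambda>z. z j"]) (auto simp: y_def trig_poly_sin)
    qed
  qed (use H e in \<open>auto simp: trig_poly_const trig_poly.add trig_poly_mult intro!: continuous_intros
        intro: continuous_on_subset\<close>)
  then obtain g where g: "trig_poly K (\<lambda>x. g (y x))" "\<And>z. z \<in> S \<Longrightarrow> \<bar>H z - g z\<bar> < e" by blast
  show thesis
  proof (rule that[OF g(1)])
    fix x :: "nat \<Rightarrow> real" assume x: "\<And>j. K < j \<Longrightarrow> x j = 0"
    have "\<bar>F x - H (y x)\<bar> \<le> 2 * B / R\<^sup>2 * (\<Sum>j\<le>K. (x j)\<^sup>2)"
    proof (cases "\<forall>j\<le>K. \<bar>x j\<bar> \<le> R")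
      case True
      have "R * arcsin (max (-1) (min 1 (y x j))) = x j" for j
      proof (cases "j \<le> K")
        case True
        with \<open>\<forall>j\<le>K. \<bar>x j\<bar> \<le> R\<close> R have "\<bar>x j / R\<bar> \<le> 1" by simp
        then have "arcsin (sin (x j / R)) = x j / R"
          using pi_gt3 by (intro arcsin_sin) (simp_all only: abs_le_iff, linarith+)
        with True R show ?thesis by (simp add: y_def)
      qed (simp add: y_def x)
      then have "H (y x) = F x" by (simp add: H_def)
      moreover have "0 \<le> B" using B[of x] by linarith
      ultimately show ?thesis by (simp add: sum_nonneg)
    next
      case False
      then obtain j where j: "j \<le> K" "R < \<bar>x j\<bar>" by auto
      have "R\<^sup>2 \<le> (x j)\<^sup>2" using j(2) R by (simp add: abs_le_square_iff[symmetric])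
      also have "\<dots> \<le> (\<Sum>j\<le>K. (x j)\<^sup>2)" using j(1) by (intro member_le_sum) auto
      finally have "1 \<le> (\<Sum>j\<le>K. (x j)\<^sup>2) / R\<^sup>2" using R by simp
      moreover have "0 \<le> 2 * B" using B[of x] by linarith
      ultimately have "2 * B * 1 \<le> 2 * B * ((\<Sum>j\<le>K. (x j)\<^sup>2) / R\<^sup>2)" by (rule mult_left_mono)
      moreover have "\<bar>F x - H (y x)\<bar> \<le> 2 * B"
        using B[of x] B[of "\<lambda>j. R * arcsin (max (-1) (min 1 (y x j)))"] by (simp add: H_def)
      ultimately show ?thesis by simp
    qed
    with g(2)[OF yS, of x] show "\<bar>F x - g (y x)\<bar> \<le> 2 * B / R\<^sup>2 * (\<Sum>j\<le>K. (x j)\<^sup>2) + e"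
      by linarith
  qed
qed

lemma trig_poly_expectation_error:
  fixes F T :: "(nat \<Rightarrow> real) \<Rightarrow> real"
  assumes M: "prob_space M" and V: "\<And>j. (\<lambda>\<omega>. V \<omega> j) \<in> borel_measurable M"
    and V0: "\<And>\<omega> j. K < j \<Longrightarrow> V \<omega> j = 0"
    and int: "\<And>j. j \<le> K \<Longrightarrow> integrable M (\<lambda>\<omega>. (V \<omega> j)\<^sup>2)"
    and C: "\<And>j. j \<le> K \<Longrightarrow> (\<integral>\<omega>. (V \<omega> j)\<^sup>2 \<partial>M) \<le> C"
    and F: "continuous_on UNIV F" "\<And>x. \<bar>F x\<bar> \<le> B" and T: "trig_poly K T" and a: "0 \<le> a"
    and FT: "\<And>x. (\<And>j. K < j \<Longrightarrow> x j = 0) \<Longrightarrow> \<bar>F x - T x\<bar> \<le> a * (\<Sum>j\<le>K. (x j)\<^sup>2) + e"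
  shows "\<bar>(\<integral>\<omega>. F (V \<omega>) \<partial>M) - (\<integral>\<omega>. T (V \<omega>) \<partial>M)\<bar> \<le> a * (real (Suc K) * C) + e"
proof -
  interpret prob_space M by fact
  have Vm: "V \<in> M \<rightarrow>\<^sub>M borel" by (rule measurable_into_sequences[OF V])
  obtain B' where B': "\<And>x. \<bar>T x\<bar> \<le> B'" using trig_poly_bounded[OF T] by blast
  have iF: "integrable M (\<lambda>\<omega>. F (V \<omega>))" by (rule integrable_comp_bounded[OF M Vm F])
  have iT: "integrable M (\<lambda>\<omega>. T (V \<omega>))"
    by (rule integrable_comp_bounded[OF M Vm trig_poly_continuous[OF T] B'])
  have iS: "integrable M (\<lambda>\<omega>. a * (\<Sum>j\<le>K. (V \<omega> j)\<^sup>2) + e)"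
    using int by (intro Bochner_Integration.integrable_add integrable_mult_right
        Bochner_Integration.integrable_sum integrable_const) auto
  have "\<bar>(\<integral>\<omega>. F (V \<omega>) \<partial>M) - (\<integral>\<omega>. T (V \<omega>) \<partial>M)\<bar> = \<bar>\<integral>\<omega>. F (V \<omega>) - T (V \<omega>) \<partial>M\<bar>"
    using iF iT by simp
  also have "\<dots> \<le> (\<integral>\<omega>. \<bar>F (V \<omega>) - T (V \<omega>)\<bar> \<partial>M)" by (rule integral_abs_bound)
  also have "\<dots> \<le> (\<integral>\<omega>. a * (\<Sum>j\<le>K. (V \<omega> j)\<^sup>2) + e \<partial>M)"
    using iF iT iS FT V0 by (intro integral_mono) auto
  also have "\<dots> = a * (\<Sum>j\<le>K. \<integral>\<omega>. (V \<omega> j)\<^sup>2 \<partial>M) + e"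
  proof -
    have "integrable M (\<lambda>\<omega>. a * (\<Sum>j\<le>K. (V \<omega> j)\<^sup>2))"
      using int by (intro integrable_mult_right Bochner_Integration.integrable_sum) auto
    then have "(\<integral>\<omega>. a * (\<Sum>j\<le>K. (V \<omega> j)\<^sup>2) + e \<partial>M) = (\<integral>\<omega>. a * (\<Sum>j\<le>K. (V \<omega> j)\<^sup>2) \<partial>M) + e"
      by (subst Bochner_Integration.integral_add) (auto simp: prob_space)
    then show ?thesis using int by simp
  qed
  also have "\<dots> \<le> a * (\<Sum>j\<le>K. C) + e"
    using C a by (intro add_mono mult_left_mono sum_mono) auto
  finally show ?thesis by simp
qed

text \<open>
  A multivariate continuity theorem in the form that suits Gaussian vectors: expectations of plane
  waves converge, and second moments are bounded. The latter make the quadratic error of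
  \<open>trig_poly_approximation\<close> small uniformly in \<open>n\<close>. Vectors are encoded as sequences that vanish
  beyond the index \<open>K\<close>, so that their length can be a variable.
\<close>

theorem vector_weak_convergence:
  fixes V :: "nat \<Rightarrow> 'v \<Rightarrow> nat \<Rightarrow> real" and V' :: "'w \<Rightarrow> nat \<Rightarrow> real"
    and F :: "(nat \<Rightarrow> real) \<Rightarrow> real"
  assumes P: "\<And>n. prob_space (P n)" and Q: "prob_space Q"
    and V: "\<And>n j. (\<lambda>\<omega>. V n \<omega> j) \<in> borel_measurable (P n)" "\<And>j. (\<lambda>\<omega>. V' \<omega> j) \<in> borel_measurable Q"
    and V0: "\<And>n \<omega> j. K < j \<Longrightarrow> V n \<omega> j = 0" "\<And>\<omega> j. K < j \<Longrightarrow> V' \<omega> j = 0"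
    and int: "\<And>n j. j \<le> K \<Longrightarrow> integrable (P n) (\<lambda>\<omega>. (V n \<omega> j)\<^sup>2)"
      "\<And>j. j \<le> K \<Longrightarrow> integrable Q (\<lambda>\<omega>. (V' \<omega> j)\<^sup>2)"
    and C: "\<And>n j. j \<le> K \<Longrightarrow> (\<integral>\<omega>. (V n \<omega> j)\<^sup>2 \<partial>P n) \<le> C"
      "\<And>j. j \<le> K \<Longrightarrow> (\<integral>\<omega>. (V' \<omega> j)\<^sup>2 \<partial>Q) \<le> C"
    and cos: "\<And>c b. (\<lambda>n. \<integral>\<omega>. cos ((\<Sum>j\<le>K. c j * V n \<omega> j) + b) \<partial>P n)
        \<longlonglongrightarrow> (\<integral>\<omega>. cos ((\<Sum>j\<le>K. c j * V' \<omega> j) + b) \<partial>Q)"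
    and F: "continuous_on UNIV F" "\<And>x. \<bar>F x\<bar> \<le> B"
  shows "(\<lambda>n. \<integral>\<omega>. F (V n \<omega>) \<partial>P n) \<longlonglongrightarrow> (\<integral>\<omega>. F (V' \<omega>) \<partial>Q)"
proof -
  have Vm: "V n \<in> P n \<rightarrow>\<^sub>M borel" "V' \<in> Q \<rightarrow>\<^sub>M borel" for n
    by (auto intro: measurable_into_sequences V)
  have trig: "(\<lambda>n. \<integral>\<omega>. T (V n \<omega>) \<partial>P n) \<longlonglongrightarrow> (\<integral>\<omega>. T (V' \<omega>) \<partial>Q)"
    if "trig_poly K T" for T
    using that
  proof induction
    case (wave a c b)
    then show ?case using tendsto_mult_left[OF cos, of a] by simp
  next
    case (add f g)
    obtain Bf Bg where Bf: "\<And>x. \<bar>f x\<bar> \<le> Bf" and Bg: "\<And>x. \<bar>g x\<bar> \<le> Bg"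
      using trig_poly_bounded add.hyps by metis
    have "integrable (P n) (\<lambda>\<omega>. f (V n \<omega>))" "integrable Q (\<lambda>\<omega>. f (V' \<omega>))"
      "integrable (P n) (\<lambda>\<omega>. g (V n \<omega>))" "integrable Q (\<lambda>\<omega>. g (V' \<omega>))" for n
      using integrable_comp_bounded[OF P Vm(1) trig_poly_continuous[OF add.hyps(1)] Bf]
        integrable_comp_bounded[OF Q Vm(2) trig_poly_continuous[OF add.hyps(1)] Bf]
        integrable_comp_bounded[OF P Vm(1) trig_poly_continuous[OF add.hyps(2)] Bg]
        integrable_comp_bounded[OF Q Vm(2) trig_poly_continuous[OF add.hyps(2)] Bg] by auto
    then show ?case using tendsto_add[OF add.IH] by simp
  qed
  show ?thesis
  proof (rule LIMSEQ_I)
    fix r :: real assume r: "0 < r"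
    define A where "A = 2 * B * (real (Suc K) * C)"
    \<comment> \<open>chosen so that the quadratic error term has expectation at most \<open>r / 8\<close>\<close>
    define R where "R = sqrt (8 * \<bar>A\<bar> / r + 1)"
    have R: "0 < R" "R\<^sup>2 = 8 * \<bar>A\<bar> / r + 1"
      using r by (auto simp: R_def intro!: real_sqrt_gt_zero add_nonneg_pos)
    have "0 \<le> B" using F(2)[of undefined] by linarith
    obtain T where T: "trig_poly K T"
      "\<And>x. (\<And>j. K < j \<Longrightarrow> x j = 0) \<Longrightarrow> \<bar>F x - T x\<bar> \<le> 2 * B / R\<^sup>2 * (\<Sum>j\<le>K. (x j)\<^sup>2) + r / 8"
      using trig_poly_approximation[OF F R(1), of "r / 8" K] r by auto
    have "r * R\<^sup>2 \<ge> 8 * A" using R(2) r by (simp add: field_simps)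
    then have "A / R\<^sup>2 \<le> r / 8" using R(1) by (simp add: field_simps)
    then have small: "2 * B / R\<^sup>2 * (real (Suc K) * C) + r / 8 \<le> r / 4" by (simp add: A_def)
    have a: "0 \<le> 2 * B / R\<^sup>2" using \<open>0 \<le> B\<close> by simp
    have e1: "\<bar>(\<integral>\<omega>. F (V n \<omega>) \<partial>P n) - (\<integral>\<omega>. T (V n \<omega>) \<partial>P n)\<bar> \<le> r / 4" for n
      by (rule order_trans[OF trig_poly_expectation_error[where V="V n", OF P V(1) V0(1) int(1) C(1) F T(1) a T(2)] small])
    have e2: "\<bar>(\<integral>\<omega>. F (V' \<omega>) \<partial>Q) - (\<integral>\<omega>. T (V' \<omega>) \<partial>Q)\<bar> \<le> r / 4"
      by (rule order_trans[OF trig_poly_expectation_error[where V=V', OF Q V(2) V0(2) int(2) C(2) F T(1) a T(2)] small])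
    obtain n0 where n0: "\<And>n. n \<ge> n0 \<Longrightarrow> \<bar>(\<integral>\<omega>. T (V n \<omega>) \<partial>P n) - (\<integral>\<omega>. T (V' \<omega>) \<partial>Q)\<bar> < r / 4"
      using LIMSEQ_D[OF trig[OF T(1)], of "r / 4"] r by auto
    show "\<exists>no. \<forall>n\<ge>no. norm ((\<integral>\<omega>. F (V n \<omega>) \<partial>P n) - (\<integral>\<omega>. F (V' \<omega>) \<partial>Q)) < r"
    proof (intro exI allI impI)
      fix n assume "n0 \<le> n"
      then show "norm ((\<integral>\<omega>. F (V n \<omega>) \<partial>P n) - (\<integral>\<omega>. F (V' \<omega>) \<partial>Q)) < r"
        using e1[of n] e2 n0[of n] unfolding real_norm_def by linarith
    qed
  qed
qed

section \<open>Moments of centred normal variables\<close>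

lemma gaussian_rv_centered_cases:
  assumes M: "prob_space M" and X: "gaussian_rv M X" and mean: "integral\<^sup>L M X = 0"
  obtains "AE \<omega> in M. X \<omega> = 0"
  | \<sigma> where "0 < \<sigma>" "distributed M lborel X (normal_density 0 \<sigma>)"
proof -
  interpret prob_space M by fact
  have Xm: "X \<in> borel_measurable M" using X by (simp add: gaussian_rv_def)
  from X consider c where "AE \<omega> in M. X \<omega> = c"
    | \<mu> \<sigma> where "0 < \<sigma>" "distributed M lborel X (normal_density \<mu> \<sigma>)"
    unfolding gaussian_rv_def by blast
  then show thesis
  proof cases
    case (1 c)
    then have "integral\<^sup>L M X = (\<integral>\<omega>. c \<partial>M)" using Xm by (intro integral_cong_AE) auto
    with 1 mean that(1) show thesis by (simp add: prob_space)
  next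
    case (2 \<mu> \<sigma>)
    from normal_distributed_expectation[OF 2] mean have "\<mu> = 0" by simp
    with 2 that(2) show thesis by blast
  qed
qed

lemma cos_expectation_normal:
  assumes M: "prob_space M" and \<sigma>: "0 < \<sigma>" and X: "distributed M lborel X (normal_density 0 \<sigma>)"
  shows "(\<integral>\<omega>. cos (X \<omega> + b) \<partial>M) = exp (- \<sigma>\<^sup>2 / 2) * cos b"
proof -
  interpret prob_space M by fact
  define Z where "Z = (\<lambda>\<omega>. X \<omega> / \<sigma>)"
  have Z: "distributed M lborel Z std_normal_density"
    using normal_standard_normal_convert[OF \<sigma>, of X 0] X by (simp add: Z_def)
  have Zm: "Z \<in> borel_measurable M" using Z by (auto simp: distributed_def)
  have Zd: "distr M borel Z = std_normal_distribution"
    using distributed_distr_eq_density[OF Z] by (metis distr_cong sets_lborel)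
  have "iexp b * char (distr M borel Z) \<sigma> = (\<integral>\<omega>. iexp b * iexp (\<sigma> * Z \<omega>) \<partial>M)"
    unfolding char_def using Zm by (subst integral_distr) auto
  also have "\<dots> = (\<integral>\<omega>. iexp (X \<omega> + b) \<partial>M)"
    using \<sigma> by (intro Bochner_Integration.integral_cong)
      (auto simp: Z_def exp_add[symmetric] algebra_simps)
  finally have "(\<integral>\<omega>. iexp (X \<omega> + b) \<partial>M) = cis b * complex_of_real (exp (- \<sigma>\<^sup>2 / 2))"
    unfolding Zd char_std_normal_distribution by (simp only: cis_conv_exp)
  then have "Re (\<integral>\<omega>. iexp (X \<omega> + b) \<partial>M) = exp (- \<sigma>\<^sup>2 / 2) * cos b"
    by (simp only:) simp
  moreover have "integrable M (\<lambda>\<omega>. iexp (X \<omega> + b))"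
    using X by (intro integrable_const_bound[where B=1]) (auto simp: distributed_def)
  then have "Re (\<integral>\<omega>. iexp (X \<omega> + b) \<partial>M) = (\<integral>\<omega>. Re (iexp (X \<omega> + b)) \<partial>M)"
    by (rule integral_Re[symmetric])
  ultimately show ?thesis by (simp add: cis_conv_exp[symmetric] del: of_real_add)
qed

text \<open>
  A variable that is constant almost everywhere is the case of variance 0, and all three claims
  remain true for it.
\<close>

lemma
  assumes M: "prob_space M" and X: "gaussian_rv M X" and mean: "integral\<^sup>L M X = 0"
  shows gaussian_rv_integrable_power: "integrable M (\<lambda>\<omega>. X \<omega> ^ k)"
    and gaussian_rv_fourth_moment: "(\<integral>\<omega>. X \<omega> ^ 4 \<partial>M) = 3 * (\<integral>\<omega>. (X \<omega>)\<^sup>2 \<partial>M)\<^sup>2"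
    and gaussian_rv_cos: "(\<integral>\<omega>. cos (X \<omega> + b) \<partial>M) = exp (- (\<integral>\<omega>. (X \<omega>)\<^sup>2 \<partial>M) / 2) * cos b"
proof -
  interpret prob_space M by fact
  have Xm[measurable]: "X \<in> borel_measurable M" using X by (simp add: gaussian_rv_def)
  from gaussian_rv_centered_cases[OF M X mean]
  have "integrable M (\<lambda>\<omega>. X \<omega> ^ k) \<and> (\<integral>\<omega>. X \<omega> ^ 4 \<partial>M) = 3 * (\<integral>\<omega>. (X \<omega>)\<^sup>2 \<partial>M)\<^sup>2
    \<and> (\<integral>\<omega>. cos (X \<omega> + b) \<partial>M) = exp (- (\<integral>\<omega>. (X \<omega>)\<^sup>2 \<partial>M) / 2) * cos b"
  proof cases
    case 1
    have "integrable M (\<lambda>\<omega>. X \<omega> ^ k) \<longleftrightarrow> integrable M (\<lambda>\<omega>. 0 ^ k :: real)"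
      using 1 by (intro integrable_cong_AE) auto
    moreover have "(\<integral>\<omega>. h (X \<omega>) \<partial>M) = h 0" if "h \<in> borel_measurable borel" for h :: "real \<Rightarrow> real"
    proof -
      have "(\<integral>\<omega>. h (X \<omega>) \<partial>M) = (\<integral>\<omega>. h 0 \<partial>M)"
        using 1 that by (intro integral_cong_AE) auto
      then show ?thesis by (simp add: prob_space)
    qed
    from this[of "\<lambda>x. x ^ 4"] this[of "\<lambda>x. x\<^sup>2"] this[of "\<lambda>x. cos (x + b)"]
    have "(\<integral>\<omega>. X \<omega> ^ 4 \<partial>M) = 0" "(\<integral>\<omega>. (X \<omega>)\<^sup>2 \<partial>M) = 0"
      "(\<integral>\<omega>. cos (X \<omega> + b) \<partial>M) = cos b" by simp_all
    ultimately show ?thesis by (simp add: prob_space)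
  next
    case (2 \<sigma>)
    have "integrable lborel (\<lambda>x. normal_density 0 \<sigma> x * x ^ k)"
      using integrable_normal_moment[OF 2(1), of 0 k] by simp
    then have "integrable M (\<lambda>\<omega>. X \<omega> ^ k)"
      by (subst (asm) distributed_integrable[OF 2(2)]) auto
    moreover have "(\<integral>\<omega>. X \<omega> ^ 4 \<partial>M) = 3 * \<sigma> ^ 4"
    proof -
      have "(\<integral>\<omega>. X \<omega> ^ 4 \<partial>M) = (\<integral>x. normal_density 0 \<sigma> x * x ^ 4 \<partial>lborel)"
        by (subst distributed_integral[OF 2(2)]) auto
      also have "\<dots> = 3 * \<sigma> ^ 4"
        using integral_normal_moment_even[OF 2(1), of 0 2] 2(1)
        by (simp add: fact_numeral power_divide power_mult[symmetric] field_simps power2_eq_square power4_eq_xxxx)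
      finally show ?thesis .
    qed
    moreover have "(\<integral>\<omega>. (X \<omega>)\<^sup>2 \<partial>M) = \<sigma>\<^sup>2"
      using normal_distributed_variance[OF 2] mean by simp
    ultimately show ?thesis
      using cos_expectation_normal[OF M 2, of b] by (simp add: power_mult[symmetric])
  qed
  then show "integrable M (\<lambda>\<omega>. X \<omega> ^ k)" "(\<integral>\<omega>. X \<omega> ^ 4 \<partial>M) = 3 * (\<integral>\<omega>. (X \<omega>)\<^sup>2 \<partial>M)\<^sup>2"
    "(\<integral>\<omega>. cos (X \<omega> + b) \<partial>M) = exp (- (\<integral>\<omega>. (X \<omega>)\<^sup>2 \<partial>M) / 2) * cos b" by blast+
qed

section \<open>Centred Gaussian processes\<close>

definition centered_gaussian :: "'w measure \<Rightarrow> ('t \<Rightarrow> 'w \<Rightarrow> real) \<Rightarrow> bool" where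
  "centered_gaussian M Z \<longleftrightarrow> gaussian_process M Z \<and> (\<forall>t. integral\<^sup>L M (Z t) = 0)"

lemma gaussian_process_combination:
  assumes "gaussian_process M Z" "finite S"
  shows "gaussian_rv M (\<lambda>\<omega>. \<Sum>t\<in>S. c t * Z t \<omega>)"
  using assms(1)[unfolded gaussian_process_def, THEN conjunct2, rule_format, OF assms(2)] .

text \<open>
  A finite combination of finite combinations of \<open>Z\<close> is again one: collect the coefficients over the
  union of the index sets.
\<close>

lemma gaussian_process_linear_image:
  fixes Z :: "'t \<Rightarrow> 'w \<Rightarrow> real" and Z' :: "'s \<Rightarrow> 'w \<Rightarrow> real"
  assumes Z: "gaussian_process M Z" and fin: "\<And>j. finite (I j)"
    and Z': "\<And>j \<omega>. Z' j \<omega> = (\<Sum>i\<in>I j. w j i * Z i \<omega>)"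
  shows "gaussian_process M Z'"
  unfolding gaussian_process_def
proof (intro conjI allI impI)
  show "prob_space M" using Z by (simp add: gaussian_process_def)
next
  fix S :: "'s set" and c :: "'s \<Rightarrow> real" assume S: "finite S"
  define U where "U = (\<Union>j\<in>S. I j)"
  have U: "finite U" using S fin by (simp add: U_def)
  have "(\<Sum>j\<in>S. c j * Z' j \<omega>) = (\<Sum>i\<in>U. (\<Sum>j\<in>S. c j * (if i \<in> I j then w j i else 0)) * Z i \<omega>)" for \<omega>
  proof -
    have "Z' j \<omega> = (\<Sum>i\<in>U. (if i \<in> I j then w j i else 0) * Z i \<omega>)" if "j \<in> S" for j
      unfolding Z' using U that by (intro sum.mono_neutral_cong_left) (auto simp: U_def)
    then have "(\<Sum>j\<in>S. c j * Z' j \<omega>) = (\<Sum>j\<in>S. \<Sum>i\<in>U. c j * (if i \<in> I j then w j i else 0) * Z i \<omega>)"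
      by (intro sum.cong) (simp_all only: sum_distrib_left mult.assoc)
    also have "\<dots> = (\<Sum>i\<in>U. \<Sum>j\<in>S. c j * (if i \<in> I j then w j i else 0) * Z i \<omega>)" by (rule sum.swap)
    finally show ?thesis by (simp only: sum_distrib_right)
  qed
  then have "(\<lambda>\<omega>. \<Sum>j\<in>S. c j * Z' j \<omega>) =
      (\<lambda>\<omega>. \<Sum>i\<in>U. (\<Sum>j\<in>S. c j * (if i \<in> I j then w j i else 0)) * Z i \<omega>)" by (rule ext)
  moreover have "gaussian_rv M (\<lambda>\<omega>. \<Sum>i\<in>U. d i * Z i \<omega>)" for d
    by (rule gaussian_process_combination[OF Z U])
  ultimately show "gaussian_rv M (\<lambda>\<omega>. \<Sum>j\<in>S. c j * Z' j \<omega>)" by (simp only:)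
qed

context
  fixes M :: "'w measure" and Z :: "'t \<Rightarrow> 'w \<Rightarrow> real"
  assumes Z: "centered_gaussian M Z"
begin

lemma centered_gaussian_prob_space: "prob_space M"
  using Z[unfolded centered_gaussian_def gaussian_process_def, THEN conjunct1, THEN conjunct1] .

lemma centered_gaussian_component: "gaussian_rv M (Z t)"
  using gaussian_process_combination[OF Z[unfolded centered_gaussian_def, THEN conjunct1],
      of "{t}" "\<lambda>_. 1"] by simp

lemma centered_gaussian_measurable: "Z t \<in> borel_measurable M"
  using centered_gaussian_component by (simp add: gaussian_rv_def)

lemma centered_gaussian_mean: "integral\<^sup>L M (Z t) = 0"
  using Z[unfolded centered_gaussian_def, THEN conjunct2, rule_format] .

lemma centered_gaussian_integrable_power: "integrable M (\<lambda>\<omega>. Z t \<omega> ^ k)"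
  by (rule gaussian_rv_integrable_power[OF centered_gaussian_prob_space centered_gaussian_component
        centered_gaussian_mean])

lemma centered_gaussian_integrable: "integrable M (Z t)"
  using centered_gaussian_integrable_power[of t 1] by simp

lemma centered_gaussian_integrable_mult: "integrable M (\<lambda>\<omega>. Z s \<omega> * Z t \<omega>)"
proof (rule Bochner_Integration.integrable_bound)
  show "integrable M (\<lambda>\<omega>. (Z s \<omega>)\<^sup>2 + (Z t \<omega>)\<^sup>2)"
    by (intro Bochner_Integration.integrable_add centered_gaussian_integrable_power)
  show "(\<lambda>\<omega>. Z s \<omega> * Z t \<omega>) \<in> borel_measurable M"
    by (intro borel_measurable_times centered_gaussian_measurable)
  show "AE \<omega> in M. norm (Z s \<omega> * Z t \<omega>) \<le> norm ((Z s \<omega>)\<^sup>2 + (Z t \<omega>)\<^sup>2)"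
  proof (rule AE_I2)
    fix \<omega>
    have "2 * \<bar>Z s \<omega> * Z t \<omega>\<bar> \<le> (Z s \<omega>)\<^sup>2 + (Z t \<omega>)\<^sup>2"
      using sum_squares_bound[of "\<bar>Z s \<omega>\<bar>" "\<bar>Z t \<omega>\<bar>"] by (simp add: abs_mult)
    then show "norm (Z s \<omega> * Z t \<omega>) \<le> norm ((Z s \<omega>)\<^sup>2 + (Z t \<omega>)\<^sup>2)" by simp
  qed
qed

lemma centered_gaussian_combination:
  assumes "finite S"
  shows "gaussian_rv M (\<lambda>\<omega>. \<Sum>t\<in>S. c t * Z t \<omega>)"
    and "integral\<^sup>L M (\<lambda>\<omega>. \<Sum>t\<in>S. c t * Z t \<omega>) = 0"
proof -
  show "gaussian_rv M (\<lambda>\<omega>. \<Sum>t\<in>S. c t * Z t \<omega>)"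
    by (rule gaussian_process_combination[OF Z[unfolded centered_gaussian_def, THEN conjunct1] assms])
  show "integral\<^sup>L M (\<lambda>\<omega>. \<Sum>t\<in>S. c t * Z t \<omega>) = 0"
    using centered_gaussian_integrable by (simp add: centered_gaussian_mean)
qed

lemma second_moment_combination:
  "(\<integral>\<omega>. (\<Sum>t\<in>S. c t * Z t \<omega>)\<^sup>2 \<partial>M) = (\<Sum>s\<in>S. \<Sum>t\<in>S. c s * c t * (\<integral>\<omega>. Z s \<omega> * Z t \<omega> \<partial>M))"
proof -
  have "(\<Sum>t\<in>S. c t * Z t \<omega>)\<^sup>2 = (\<Sum>s\<in>S. \<Sum>t\<in>S. c s * c t * (Z s \<omega> * Z t \<omega>))" for \<omega>
    by (simp add: power2_eq_square sum_product mult_ac)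
  then show ?thesis
    using centered_gaussian_integrable_mult
    by (simp add: Bochner_Integration.integral_sum Bochner_Integration.integrable_sum)
qed

lemma integrable_increment_sq: "integrable M (\<lambda>\<omega>. (Z s \<omega> - Z t \<omega>)\<^sup>2)"
proof -
  have "(Z s \<omega> - Z t \<omega>)\<^sup>2 = (Z s \<omega>)\<^sup>2 + (Z t \<omega>)\<^sup>2 - 2 * (Z s \<omega> * Z t \<omega>)" for \<omega>
    by (simp add: power2_diff)
  then show ?thesis
    using centered_gaussian_integrable_mult[of s t] centered_gaussian_integrable_power[of s 2]
      centered_gaussian_integrable_power[of t 2]
    by simp
qed

lemma centered_gaussian_increment:
  shows "integrable M (\<lambda>\<omega>. (Z s \<omega> - Z t \<omega>) ^ 4)"
    and "(\<integral>\<omega>. (Z s \<omega> - Z t \<omega>) ^ 4 \<partial>M) = 3 * (\<integral>\<omega>. (Z s \<omega> - Z t \<omega>)\<^sup>2 \<partial>M)\<^sup>2"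
proof -
  have rv: "gaussian_rv M (\<lambda>\<omega>. Z s \<omega> - Z t \<omega>)"
  proof (cases "s = t")
    case True
    then show ?thesis by (auto simp: gaussian_rv_def)
  next
    case False
    then show ?thesis
      using centered_gaussian_combination(1)[of "{s, t}" "\<lambda>u. if u = s then 1 else -1"] by simp
  qed
  have mean: "integral\<^sup>L M (\<lambda>\<omega>. Z s \<omega> - Z t \<omega>) = 0"
    using centered_gaussian_integrable centered_gaussian_mean by simp
  show "integrable M (\<lambda>\<omega>. (Z s \<omega> - Z t \<omega>) ^ 4)"
    "(\<integral>\<omega>. (Z s \<omega> - Z t \<omega>) ^ 4 \<partial>M) = 3 * (\<integral>\<omega>. (Z s \<omega> - Z t \<omega>)\<^sup>2 \<partial>M)\<^sup>2"
    using gaussian_rv_integrable_power[OF centered_gaussian_prob_space rv mean]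
      gaussian_rv_fourth_moment[OF centered_gaussian_prob_space rv mean] by blast+
qed

lemma centered_gaussian_cos:
  assumes "finite S"
  shows "(\<integral>\<omega>. cos ((\<Sum>t\<in>S. c t * Z t \<omega>) + b) \<partial>M) =
    exp (- (\<Sum>s\<in>S. \<Sum>t\<in>S. c s * c t * (\<integral>\<omega>. Z s \<omega> * Z t \<omega> \<partial>M)) / 2) * cos b"
  using gaussian_rv_cos[OF centered_gaussian_prob_space centered_gaussian_combination[OF assms]]
  by (simp add: second_moment_combination)

end

lemma centered_gaussian_linear_image:
  assumes Z: "centered_gaussian M Z" and fin: "\<And>j. finite (I j)"
    and Z': "\<And>j \<omega>. Z' j \<omega> = (\<Sum>i\<in>I j. w j i * Z i \<omega>)"
  shows "centered_gaussian M Z'"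
  unfolding centered_gaussian_def
proof (intro conjI allI)
  show "gaussian_process M Z'"
    by (rule gaussian_process_linear_image[OF Z[unfolded centered_gaussian_def, THEN conjunct1] fin Z'])
  fix j
  have "Z' j = (\<lambda>\<omega>. \<Sum>i\<in>I j. w j i * Z i \<omega>)" using Z' by auto
  then show "integral\<^sup>L M (Z' j) = 0"
    using centered_gaussian_integrable[OF Z] centered_gaussian_mean[OF Z]
    by (simp add: Bochner_Integration.integral_sum)
qed

lemma centered_gaussian_reindex:
  "centered_gaussian M Z \<Longrightarrow> centered_gaussian M (\<lambda>j. Z (\<tau> j))"
  by (rule centered_gaussian_linear_image[where I="\<lambda>j. {\<tau> j}" and w="\<lambda>_ _. 1"]) auto

section \<open>Dyadic polygons\<close>

definition lin_interp :: "(int \<Rightarrow> real) \<Rightarrow> real \<Rightarrow> real" where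
  "lin_interp f s = (1 - frac s) * f \<lfloor>s\<rfloor> + frac s * f \<lceil>s\<rceil>"

text \<open>
  On a closed cell the interpolation is affine; the right end point is included although floor and
  ceiling jump there, since both then equal \<open>k + 1\<close>.
\<close>

lemma lin_interp_cell:
  assumes "of_int k \<le> s" "s \<le> of_int k + 1"
  shows "lin_interp f s = (of_int k + 1 - s) * f k + (s - of_int k) * f (k + 1)"
proof (cases "s = of_int k + 1")
  case True
  then have "s = of_int (k + 1)" by simp
  then show ?thesis unfolding lin_interp_def by (simp add: frac_def)
next
  case False
  with assms have fl: "\<lfloor>s\<rfloor> = k" by linarith
  show ?thesis
  proof (cases "s = of_int k")
    case True
    then show ?thesis by (simp add: lin_interp_def frac_def)
  next
    case False
    with assms \<open>s \<noteq> of_int k + 1\<close> have "\<lceil>s\<rceil> = k + 1" by linarith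
    with fl show ?thesis by (simp add: lin_interp_def frac_def algebra_simps)
  qed
qed

lemma continuous_on_lin_interp: "continuous_on A (lin_interp f)"
proof -
  have cell: "continuous_on {of_int k..of_int k + 1} (lin_interp f)" for k
  proof -
    have "continuous_on {of_int k..of_int k + 1}
        (\<lambda>s. (of_int k + 1 - s) * f k + (s - of_int k) * f (k + 1))"
      by (intro continuous_intros)
    then show ?thesis by (subst continuous_on_cong[OF refl lin_interp_cell]) auto
  qed
  have block: "continuous_on {- real m..real m} (lin_interp f)" for m
  proof (induction m)
    case (Suc m)
    have "{- real (Suc m)..real (Suc m)} =
        ({of_int (- int m - 1)..of_int (- int m - 1) + 1} \<union> {- real m..real m}) \<union> {of_int (int m)..of_int (int m) + 1}"
      by auto
    then show ?case
      by (simp only:) (intro continuous_on_closed_Un cell Suc.IH closed_Un closed_atLeastAtMost)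
  qed simp
  have "isCont (lin_interp f) s" for s
  proof -
    obtain m :: nat where "\<bar>s\<bar> < real m" using reals_Archimedean2 by blast
    then have "s \<in> interior {- real m..real m}" by (simp add: interior_atLeastAtMost_real abs_less_iff)
    then show ?thesis by (rule continuous_on_interior[OF block])
  qed
  then show ?thesis by (simp add: continuous_at_imp_continuous_on)
qed

text \<open>
  Interpolation is a convex combination of two values, so it does not increase distances.
\<close>

lemma lin_interp_diff_le:
  assumes "\<bar>f \<lfloor>s\<rfloor> - g \<lfloor>s\<rfloor>\<bar> \<le> e" "\<bar>f \<lceil>s\<rceil> - g \<lceil>s\<rceil>\<bar> \<le> e"
  shows "\<bar>lin_interp f s - lin_interp g s\<bar> \<le> e"
proof -
  have fr: "0 \<le> frac s" "frac s \<le> 1" using frac_lt_1[of s] by auto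
  have "lin_interp f s - lin_interp g s =
      (1 - frac s) * (f \<lfloor>s\<rfloor> - g \<lfloor>s\<rfloor>) + frac s * (f \<lceil>s\<rceil> - g \<lceil>s\<rceil>)"
    by (simp add: lin_interp_def algebra_simps)
  also have "\<bar>\<dots>\<bar> \<le> (1 - frac s) * \<bar>f \<lfloor>s\<rfloor> - g \<lfloor>s\<rfloor>\<bar> + frac s * \<bar>f \<lceil>s\<rceil> - g \<lceil>s\<rceil>\<bar>"
    using fr by (intro abs_triangle_ineq[THEN order_trans]) (simp add: abs_mult)
  also have "\<dots> \<le> (1 - frac s) * e + frac s * e"
    using fr assms by (intro add_mono mult_left_mono) auto
  finally show ?thesis by (simp add: algebra_simps)
qed

lemma lin_interp_const: "lin_interp (\<lambda>_. c) s = c"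
  by (simp add: lin_interp_def algebra_simps)

definition clip :: "real \<Rightarrow> real \<Rightarrow> real \<Rightarrow> real" where
  "clip a b t = max a (min b t)"

text \<open>
  Paths on \<open>[a, b]\<close> are continued by constants; they become points of the metric space of
  bounded continuous functions on the line.
\<close>

definition extend_path :: "real \<Rightarrow> real \<Rightarrow> (real \<Rightarrow> real) \<Rightarrow> (real \<Rightarrow>\<^sub>C real)" where
  "extend_path a b x = Bcontfun (\<lambda>t. x (clip a b t))"

definition dyadic :: "real \<Rightarrow> real \<Rightarrow> nat \<Rightarrow> nat \<Rightarrow> real" where
  "dyadic a b l j = a + (b - a) * (real j / 2 ^ l)"

definition samples :: "real \<Rightarrow> real \<Rightarrow> nat \<Rightarrow> (real \<Rightarrow> real) \<Rightarrow> nat \<Rightarrow> real" where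
  "samples a b l x j = (if j \<le> 2 ^ l then x (dyadic a b l j) else 0)"

definition polygon :: "real \<Rightarrow> real \<Rightarrow> nat \<Rightarrow> (nat \<Rightarrow> real) \<Rightarrow> (real \<Rightarrow>\<^sub>C real)" where
  "polygon a b l v = Bcontfun (\<lambda>t. lin_interp (\<lambda>i. v (nat i)) (2 ^ l * ((clip a b t - a) / (b - a))))"

context
  fixes a b :: real
  assumes ab: "a < b"
begin

lemma clip_range: "clip a b t \<in> {a..b}"
  using ab by (simp add: clip_def)

lemma continuous_clip: "continuous_on A (clip a b)"
  unfolding clip_def by (intro continuous_intros)

lemma bcontfun_clip:
  assumes "continuous_on {a..b} x"
  shows "(\<lambda>t. x (clip a b t)) \<in> bcontfun"
proof -
  have "range (\<lambda>t. x (clip a b t)) \<subseteq> x ` {a..b}" using clip_range by auto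
  moreover have "bounded (x ` {a..b})"
    by (intro compact_imp_bounded compact_continuous_image assms compact_Icc)
  moreover have "continuous_on UNIV (\<lambda>t. x (clip a b t))"
    by (rule continuous_on_compose2[OF assms continuous_clip]) (use clip_range in auto)
  ultimately show ?thesis by (auto simp: bcontfun_def intro: bounded_subset)
qed

lemma apply_extend_path: "continuous_on {a..b} x \<Longrightarrow> apply_bcontfun (extend_path a b x) t = x (clip a b t)"
  by (simp add: extend_path_def Bcontfun_inverse bcontfun_clip)

definition grid_pos :: "nat \<Rightarrow> real \<Rightarrow> real" where
  "grid_pos l t = 2 ^ l * ((clip a b t - a) / (b - a))"

lemma grid_pos_range: "0 \<le> grid_pos l t" "grid_pos l t \<le> 2 ^ l"
  using clip_range[of t] ab by (auto simp: grid_pos_def divide_simps)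

lemma grid_index_range:
  "0 \<le> \<lfloor>grid_pos l t\<rfloor>" "nat \<lfloor>grid_pos l t\<rfloor> \<le> 2 ^ l" "0 \<le> \<lceil>grid_pos l t\<rceil>" "nat \<lceil>grid_pos l t\<rceil> \<le> 2 ^ l"
proof -
  show "0 \<le> \<lfloor>grid_pos l t\<rfloor>" "0 \<le> \<lceil>grid_pos l t\<rceil>" using grid_pos_range(1)[of l t] by (auto simp: le_floor_iff)
  have "\<lceil>grid_pos l t\<rceil> \<le> 2 ^ l" using grid_pos_range(2)[of l t] by (simp add: ceiling_le_iff)
  then show c: "nat \<lceil>grid_pos l t\<rceil> \<le> 2 ^ l" by (simp add: nat_le_iff)
  have "\<lfloor>grid_pos l t\<rfloor> \<le> \<lceil>grid_pos l t\<rceil>" by linarith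
  with c show "nat \<lfloor>grid_pos l t\<rfloor> \<le> 2 ^ l" by linarith
qed

lemma apply_polygon: "apply_bcontfun (polygon a b l v) t = lin_interp (\<lambda>i. v (nat i)) (grid_pos l t)"
proof -
  have "continuous_on {a..b} (\<lambda>u. lin_interp (\<lambda>i. v (nat i)) (2 ^ l * ((u - a) / (b - a))))"
    by (rule continuous_on_compose2[OF continuous_on_lin_interp]) (use ab in \<open>auto intro!: continuous_intros\<close>)
  from bcontfun_clip[OF this] show ?thesis by (simp add: polygon_def Bcontfun_inverse grid_pos_def)
qed

lemma dist_polygon_le: "dist (polygon a b l v) (polygon a b l w) \<le> (\<Sum>j\<le>2 ^ l. \<bar>v j - w j\<bar>)"
proof (rule dist_bound)
  fix t
  have "\<bar>v j - w j\<bar> \<le> (\<Sum>j\<le>2 ^ l. \<bar>v j - w j\<bar>)" if "j \<le> 2 ^ l" for j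
    using that by (intro member_le_sum) auto
  then show "dist (apply_bcontfun (polygon a b l v) t) (apply_bcontfun (polygon a b l w) t)
      \<le> (\<Sum>j\<le>2 ^ l. \<bar>v j - w j\<bar>)"
    unfolding apply_polygon dist_real_def by (intro lin_interp_diff_le) (use grid_index_range in auto)
qed

lemma continuous_polygon: "continuous_on UNIV (polygon a b l)"
proof -
  have "(polygon a b l \<longlongrightarrow> polygon a b l v) (at v)" for v
  proof (rule metric_tendsto_imp_tendsto)
    have "((\<lambda>w. \<Sum>j\<le>2 ^ l. \<bar>w j - v j\<bar>) \<longlongrightarrow> (\<Sum>j\<le>2 ^ l. \<bar>v j - v j\<bar>)) (at v)"
      by (intro tendsto_sum tendsto_rabs tendsto_diff tendsto_const)
        (metis continuous_on_product_coordinates UNIV_I continuous_on_def)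
    then show "((\<lambda>w. \<Sum>j\<le>2 ^ l. \<bar>w j - v j\<bar>) \<longlongrightarrow> 0) (at v)" by simp
    show "\<forall>\<^sub>F w in at v. dist (polygon a b l w) (polygon a b l v) \<le> dist (\<Sum>j\<le>2 ^ l. \<bar>w j - v j\<bar>) 0"
      using dist_polygon_le by (simp add: sum_nonneg)
  qed
  then show ?thesis by (simp add: continuous_on_def)
qed

lemma dyadic_floor_dist:
  assumes "\<bar>real j - grid_pos l t\<bar> \<le> 1"
  shows "\<bar>dyadic a b l j - clip a b t\<bar> \<le> (b - a) / 2 ^ l"
proof -
  have "dyadic a b l j - clip a b t = (b - a) / 2 ^ l * (real j - grid_pos l t)"
    using ab by (simp add: dyadic_def grid_pos_def field_simps)
  also have "\<bar>\<dots>\<bar> \<le> (b - a) / 2 ^ l * 1"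
    unfolding abs_mult using ab assms by (intro mult_mono) auto
  finally show ?thesis by simp
qed

lemma dyadic_range: "j \<le> 2 ^ l \<Longrightarrow> dyadic a b l j \<in> {a..b}"
proof -
  assume "j \<le> 2 ^ l"
  then have "real j \<le> 2 ^ l" by (metis of_nat_le_iff of_nat_numeral of_nat_power)
  then have "0 \<le> real j / 2 ^ l" "real j / 2 ^ l \<le> 1" by auto
  then have "0 \<le> (b - a) * (real j / 2 ^ l)" "(b - a) * (real j / 2 ^ l) \<le> (b - a) * 1"
    using ab mult_left_mono[of "real j / 2 ^ l" 1 "b - a"] by simp_all
  then show ?thesis by (simp add: dyadic_def)
qed

lemma polygon_samples_tendsto:
  assumes x: "continuous_on {a..b} x"
  shows "(\<lambda>l. polygon a b l (samples a b l x)) \<longlonglongrightarrow> extend_path a b x"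
proof (rule metric_LIMSEQ_I)
  fix e :: real assume "0 < e"
  have "uniformly_continuous_on {a..b} x" by (intro compact_uniformly_continuous x compact_Icc)
  then obtain d where d: "0 < d"
    "\<And>s t. s \<in> {a..b} \<Longrightarrow> t \<in> {a..b} \<Longrightarrow> dist s t < d \<Longrightarrow> dist (x s) (x t) < e / 2"
    using \<open>0 < e\<close> unfolding uniformly_continuous_on_def by (metis half_gt_zero)
  obtain k where k: "(1 / 2) ^ k < d / (b - a)"
    using real_arch_pow_inv[of "d / (b - a)" "1 / 2"] d ab by auto
  show "\<exists>no. \<forall>n\<ge>no. dist (polygon a b n (samples a b n x)) (extend_path a b x) < e"
  proof (intro exI allI impI)
    fix l assume "k \<le> l"
    then have "(1 / 2 :: real) ^ l \<le> (1 / 2) ^ k" by (intro power_decreasing) auto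
    with k have "(1 / 2) ^ l < d / (b - a)" by linarith
    then have small: "(b - a) / 2 ^ l < d" using ab by (simp add: field_simps power_one_over)
    have "dist (apply_bcontfun (polygon a b l (samples a b l x)) t)
        (apply_bcontfun (extend_path a b x) t) \<le> e / 2" for t
    proof -
      have approx: "\<bar>samples a b l x (nat i) - x (clip a b t)\<bar> \<le> e / 2"
        if "0 \<le> i" "nat i \<le> 2 ^ l" "\<bar>of_int i - grid_pos l t\<bar> \<le> 1" for i
        using dyadic_floor_dist[of "nat i" l t] d(2)[OF dyadic_range[OF that(2)] clip_range[of t]] that small
        by (simp add: samples_def dist_real_def)
      have "\<bar>lin_interp (\<lambda>i. samples a b l x (nat i)) (grid_pos l t) - lin_interp (\<lambda>_. x (clip a b t)) (grid_pos l t)\<bar> \<le> e / 2"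
      proof (rule lin_interp_diff_le)
        show "\<bar>samples a b l x (nat \<lfloor>grid_pos l t\<rfloor>) - x (clip a b t)\<bar> \<le> e / 2"
          by (rule approx[OF grid_index_range(1,2)]) linarith
        show "\<bar>samples a b l x (nat \<lceil>grid_pos l t\<rceil>) - x (clip a b t)\<bar> \<le> e / 2"
          by (rule approx[OF grid_index_range(3,4)]) linarith
      qed
      then show ?thesis by (simp add: apply_polygon apply_extend_path[OF x] lin_interp_const dist_real_def)
    qed
    then have "dist (polygon a b l (samples a b l x)) (extend_path a b x) \<le> e / 2" by (rule dist_bound)
    then show "dist (polygon a b l (samples a b l x)) (extend_path a b x) < e" using \<open>0 < e\<close> by simp
  qed
qed

text \<open>
  Follow the left dyadic neighbour of \<open>t\<close> from level \<open>k\<close> to level \<open>m\<close>. From one level to the next it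
  stays where it is or moves by one step of the finer level \<open>l\<close>, at cost \<open>D l\<close>; and each polygon
  differs by at most one step of its own level from the value at that neighbour.
\<close>

lemma polygon_chaining:
  assumes D: "\<And>l j. j < 2 ^ l \<Longrightarrow> \<bar>x (dyadic a b l (Suc j)) - x (dyadic a b l j)\<bar> \<le> D l"
    and "k \<le> m"
  shows "dist (polygon a b m (samples a b m x)) (polygon a b k (samples a b k x)) \<le> 2 * (\<Sum>l=k..m. D l)"
proof (rule dist_bound)
  fix t
  have D0: "0 \<le> D l" for l using D[of 0 l] by simp
  define s where "s l = x (dyadic a b l (nat \<lfloor>grid_pos l t\<rfloor>))" for l
  have near: "\<bar>lin_interp (\<lambda>i. samples a b l x (nat i)) (grid_pos l t) - s l\<bar> \<le> D l" for l
  proof -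
    have ind: "\<lceil>grid_pos l t\<rceil> = \<lfloor>grid_pos l t\<rfloor> \<or> \<lceil>grid_pos l t\<rceil> = \<lfloor>grid_pos l t\<rfloor> + 1" by linarith
    have "\<bar>samples a b l x (nat \<lceil>grid_pos l t\<rceil>) - s l\<bar> \<le> D l"
    proof (cases "\<lceil>grid_pos l t\<rceil> = \<lfloor>grid_pos l t\<rfloor>")
      case True
      then show ?thesis using grid_index_range[of l t] D0 by (simp add: samples_def s_def)
    next
      case False
      with ind have "nat \<lceil>grid_pos l t\<rceil> = Suc (nat \<lfloor>grid_pos l t\<rfloor>)" using grid_index_range[of l t] by linarith
      moreover from this have "nat \<lfloor>grid_pos l t\<rfloor> < 2 ^ l" using grid_index_range(4)[of l t] by linarith
      ultimately show ?thesis using D[of "nat \<lfloor>grid_pos l t\<rfloor>" l] grid_index_range(4)[of l t]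
        unfolding samples_def s_def by simp
    qed
    moreover have "\<bar>samples a b l x (nat \<lfloor>grid_pos l t\<rfloor>) - s l\<bar> \<le> D l"
      using grid_index_range[of l t] D0 by (simp add: samples_def s_def)
    ultimately have "\<bar>lin_interp (\<lambda>i. samples a b l x (nat i)) (grid_pos l t) - lin_interp (\<lambda>_. s l) (grid_pos l t)\<bar> \<le> D l"
      by (intro lin_interp_diff_le)
    then show ?thesis by (simp add: lin_interp_const)
  qed
  have step: "\<bar>s (Suc l) - s l\<bar> \<le> D (Suc l)" for l
  proof -
    define i where "i = nat \<lfloor>grid_pos l t\<rfloor>"
    have i: "of_nat i \<le> grid_pos l t" "grid_pos l t < of_nat i + 1"
      using grid_index_range(1)[of l t] unfolding i_def by (auto simp: nat_0_le)
    have "grid_pos (Suc l) t = 2 * grid_pos l t" by (simp add: grid_pos_def)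
    with i have "\<lfloor>grid_pos (Suc l) t\<rfloor> = 2 * int i \<or> \<lfloor>grid_pos (Suc l) t\<rfloor> = 2 * int i + 1" by linarith
    then have "nat \<lfloor>grid_pos (Suc l) t\<rfloor> = 2 * i \<or> nat \<lfloor>grid_pos (Suc l) t\<rfloor> = Suc (2 * i)" by auto
    moreover have same: "dyadic a b (Suc l) (2 * i) = dyadic a b l i" by (simp add: dyadic_def)
    ultimately show ?thesis
      using D[of "2 * i" "Suc l"] grid_index_range(2)[of "Suc l" t] D0[of "Suc l"]
      by (auto simp: s_def i_def[symmetric])
  qed
  have tele: "\<bar>s m - s k\<bar> \<le> (\<Sum>l=Suc k..m. D l)"
    using \<open>k \<le> m\<close>
  proof (induction rule: dec_induct)
    case (step n)
    then show ?case using \<open>\<And>l. \<bar>s (Suc l) - s l\<bar> \<le> D (Suc l)\<close>[of n] by simp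
  qed simp
  have "(\<Sum>l=k..m. D l) = D k + (\<Sum>l=Suc k..m. D l)" using \<open>k \<le> m\<close> by (rule sum.atLeast_Suc_atMost)
  moreover have "D m \<le> (\<Sum>l=k..m. D l)" using \<open>k \<le> m\<close> D0 by (intro member_le_sum) auto
  moreover have "dist (apply_bcontfun (polygon a b m (samples a b m x)) t)
      (apply_bcontfun (polygon a b k (samples a b k x)) t) \<le> D m + \<bar>s m - s k\<bar> + D k"
    using near[of m] near[of k] unfolding apply_polygon dist_real_def by linarith
  ultimately show "dist (apply_bcontfun (polygon a b m (samples a b m x)) t)
      (apply_bcontfun (polygon a b k (samples a b k x)) t) \<le> 2 * (\<Sum>l=k..m. D l)"
    using tele by linarith
qed

end

section \<open>Chaining and convergence of path laws\<close>

lemma measurable_extend_path: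
  assumes ab: "a < b" and Z: "\<And>t. Z t \<in> borel_measurable M"
    and cont: "\<And>\<omega>. \<omega> \<in> space M \<Longrightarrow> continuous_on {a..b} (\<lambda>t. Z t \<omega>)"
  shows "(\<lambda>\<omega>. extend_path a b (\<lambda>t. Z t \<omega>)) \<in> M \<rightarrow>\<^sub>M borel"
    and "(\<lambda>\<omega>. samples a b l (\<lambda>t. Z t \<omega>) j) \<in> borel_measurable M"
    and "(\<lambda>\<omega>. polygon a b l (samples a b l (\<lambda>t. Z t \<omega>))) \<in> M \<rightarrow>\<^sub>M borel"
proof -
  have s: "(\<lambda>\<omega>. samples a b l (\<lambda>t. Z t \<omega>) j) \<in> borel_measurable M" for l j
    using Z by (cases "j \<le> 2 ^ l") (simp_all add: samples_def)
  have p: "(\<lambda>\<omega>. polygon a b l (samples a b l (\<lambda>t. Z t \<omega>))) \<in> M \<rightarrow>\<^sub>M borel" for l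
    by (rule measurable_compose[OF measurable_into_sequences[OF s]
          borel_measurable_continuous_onI[OF continuous_polygon[OF ab]]])
  show "(\<lambda>\<omega>. samples a b l (\<lambda>t. Z t \<omega>) j) \<in> borel_measurable M" by (rule s)
  show "(\<lambda>\<omega>. polygon a b l (samples a b l (\<lambda>t. Z t \<omega>))) \<in> M \<rightarrow>\<^sub>M borel" by (rule p)
  show "(\<lambda>\<omega>. extend_path a b (\<lambda>t. Z t \<omega>)) \<in> M \<rightarrow>\<^sub>M borel"
    by (rule borel_measurable_LIMSEQ_metric[OF p]) (rule polygon_samples_tendsto[OF ab cont])
qed

lemma polygon_expectation_tendsto:
  assumes ab: "a < b" and M: "prob_space M" and Z: "\<And>t. Z t \<in> borel_measurable M"
    and cont: "\<And>\<omega>. \<omega> \<in> space M \<Longrightarrow> continuous_on {a..b} (\<lambda>t. Z t \<omega>)"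
    and f: "continuous_on UNIV f" "\<And>x. \<bar>f x :: real\<bar> \<le> B"
  shows "(\<lambda>l. \<integral>\<omega>. f (polygon a b l (samples a b l (\<lambda>t. Z t \<omega>))) \<partial>M)
      \<longlonglongrightarrow> (\<integral>\<omega>. f (extend_path a b (\<lambda>t. Z t \<omega>)) \<partial>M)"
proof -
  interpret prob_space M by fact
  note meas = measurable_extend_path[OF ab Z cont]
  show ?thesis
  proof (rule integral_dominated_convergence[where w="\<lambda>_. B"])
    show "AE \<omega> in M. (\<lambda>l. f (polygon a b l (samples a b l (\<lambda>t. Z t \<omega>))))
        \<longlonglongrightarrow> f (extend_path a b (\<lambda>t. Z t \<omega>))"
    proof (rule AE_I2)
      fix \<omega> assume "\<omega> \<in> space M"
      then show "(\<lambda>l. f (polygon a b l (samples a b l (\<lambda>t. Z t \<omega>))))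
          \<longlonglongrightarrow> f (extend_path a b (\<lambda>t. Z t \<omega>))"
        using f(1) polygon_samples_tendsto[OF ab cont]
        by (intro continuous_on_tendsto_compose[OF f(1)]) auto
    qed
  qed (use integrable_comp_bounded[OF M meas(1) f] integrable_comp_bounded[OF M meas(3) f] f(2)
        in \<open>auto dest: borel_measurable_integrable\<close>)
qed

text \<open>
  The \<open>2 ^ l\<close> increments of level \<open>l\<close> have fourth moments of order \<open>4 ^ - l\<close>, in total \<open>2 ^ - l\<close>, that is \<open>q ^ (8 * l)\<close>
  for \<open>q ^ 8 = 1/2\<close>. At the threshold \<open>q ^ l\<close> the bound below divides this by \<open>q ^ (3 * l)\<close>; what is left is smaller
  than \<open>q ^ l\<close>, which is summable.
\<close>

definition chain_ratio :: real where "chain_ratio = root 8 (1 / 2)"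

lemma chain_ratio: "0 < chain_ratio" "chain_ratio < 1" "chain_ratio ^ 8 = 1 / 2"
  by (auto simp: chain_ratio_def)

text \<open>
  Takes the place of an inequality between moments: the right-hand side is linear in the fourth
  power, so it passes through sums and expectations.
\<close>

lemma abs_le_plus_fourth_power:
  fixes x \<delta> :: real
  assumes "0 < \<delta>" shows "\<bar>x\<bar> \<le> \<delta> + x ^ 4 / \<delta> ^ 3"
proof (cases "\<bar>x\<bar> \<le> \<delta>")
  case True
  have "0 \<le> x ^ 4 / \<delta> ^ 3" using assms by simp
  with True show ?thesis by linarith
next
  case False
  then have "\<delta> ^ 3 \<le> \<bar>x\<bar> ^ 3" using assms by (intro power_mono) auto
  then have "\<bar>x\<bar> * \<delta> ^ 3 \<le> \<bar>x\<bar> * \<bar>x\<bar> ^ 3" by (intro mult_left_mono) auto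
  also have "\<bar>x\<bar> * \<bar>x\<bar> ^ 3 = x ^ 4" by (simp add: power4_eq_xxxx power3_eq_cube)
  finally have "\<bar>x\<bar> \<le> x ^ 4 / \<delta> ^ 3" using assms by (simp add: field_simps)
  with assms show ?thesis by linarith
qed

text \<open>
  Bounds all increments of level \<open>l\<close> at once. The sum of fourth powers replaces their maximum, and its expectation
  is computable.
\<close>

definition level_bound :: "real \<Rightarrow> real \<Rightarrow> nat \<Rightarrow> (real \<Rightarrow> real) \<Rightarrow> real" where
  "level_bound a b l x = chain_ratio ^ l +
     (\<Sum>j<2 ^ l. (x (dyadic a b l (Suc j)) - x (dyadic a b l j)) ^ 4) / chain_ratio ^ (3 * l)"

lemma level_bound:
  assumes "j < 2 ^ l"
  shows "\<bar>x (dyadic a b l (Suc j)) - x (dyadic a b l j)\<bar> \<le> level_bound a b l x"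
proof -
  let ?d = "\<lambda>j. x (dyadic a b l (Suc j)) - x (dyadic a b l j)"
  have "\<bar>?d j\<bar> \<le> chain_ratio ^ l + ?d j ^ 4 / (chain_ratio ^ l) ^ 3"
    using chain_ratio by (intro abs_le_plus_fourth_power) simp
  also have "?d j ^ 4 \<le> (\<Sum>j<2 ^ l. ?d j ^ 4)" using assms by (intro member_le_sum) auto
  finally show ?thesis
    using chain_ratio by (simp add: level_bound_def power_mult[symmetric] mult.commute divide_right_mono)
qed

lemma level_bound_expectation:
  assumes ab: "a < b" and Z: "centered_gaussian M Z"
    and incr: "\<And>s t. s \<in> {a..b} \<Longrightarrow> t \<in> {a..b} \<Longrightarrow> (\<integral>\<omega>. (Z s \<omega> - Z t \<omega>)\<^sup>2 \<partial>M) \<le> C * \<bar>s - t\<bar>"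
  shows "integrable M (\<lambda>\<omega>. level_bound a b l (\<lambda>t. Z t \<omega>))"
    and "(\<integral>\<omega>. level_bound a b l (\<lambda>t. Z t \<omega>) \<partial>M) \<le> (1 + 3 * (C * (b - a))\<^sup>2) * chain_ratio ^ l"
proof -
  interpret prob_space M by (rule centered_gaussian_prob_space[OF Z])
  let ?q = chain_ratio
  let ?d = "\<lambda>j \<omega>. Z (dyadic a b l (Suc j)) \<omega> - Z (dyadic a b l j) \<omega>"
  have int: "integrable M (\<lambda>\<omega>. ?d j \<omega> ^ 4)" for j by (rule centered_gaussian_increment(1)[OF Z])
  then show "integrable M (\<lambda>\<omega>. level_bound a b l (\<lambda>t. Z t \<omega>))" by (simp add: level_bound_def)
  have le: "(\<integral>\<omega>. ?d j \<omega> ^ 4 \<partial>M) \<le> 3 * (C * (b - a) / 2 ^ l)\<^sup>2" if "j < 2 ^ l" for j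
  proof -
    have "\<bar>dyadic a b l (Suc j) - dyadic a b l j\<bar> = (b - a) / 2 ^ l"
      using ab by (simp add: dyadic_def field_simps)
    then have "(\<integral>\<omega>. (?d j \<omega>)\<^sup>2 \<partial>M) \<le> C * (b - a) / 2 ^ l"
      using incr[OF dyadic_range[OF ab] dyadic_range[OF ab], of "Suc j" l j l] that by simp
    then have "(\<integral>\<omega>. (?d j \<omega>)\<^sup>2 \<partial>M)\<^sup>2 \<le> (C * (b - a) / 2 ^ l)\<^sup>2"
      by (intro power_mono) auto
    then show ?thesis by (simp add: centered_gaussian_increment(2)[OF Z])
  qed
  have "(\<integral>\<omega>. level_bound a b l (\<lambda>t. Z t \<omega>) \<partial>M) = ?q ^ l + (\<Sum>j<2 ^ l. \<integral>\<omega>. ?d j \<omega> ^ 4 \<partial>M) / ?q ^ (3 * l)"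
    using int by (simp add: level_bound_def prob_space)
  also have "\<dots> \<le> ?q ^ l + (\<Sum>j<(2::nat) ^ l. 3 * (C * (b - a) / 2 ^ l)\<^sup>2) / ?q ^ (3 * l)"
    using le chain_ratio by (intro add_left_mono divide_right_mono sum_mono) auto
  also have "(\<Sum>j<(2::nat) ^ l. 3 * (C * (b - a) / 2 ^ l)\<^sup>2) / ?q ^ (3 * l) =
      3 * (C * (b - a))\<^sup>2 * ((1 / 2) ^ l / ?q ^ (3 * l))"
  proof -
    have "2 ^ l * (3 * (e / 2 ^ l)\<^sup>2) = 3 * e\<^sup>2 * (1 / 2) ^ l" for e :: real
      by (simp add: power_divide power2_eq_square field_simps)
    then show ?thesis by simp
  qed
  also have "(1 / 2 :: real) ^ l / ?q ^ (3 * l) = ?q ^ (5 * l)"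
  proof -
    have "(1 / 2 :: real) ^ l = ?q ^ (8 * l)" by (simp add: power_mult chain_ratio(3))
    also have "\<dots> = ?q ^ (5 * l) * ?q ^ (3 * l)" by (simp add: power_add[symmetric])
    finally show ?thesis using chain_ratio(1) by simp
  qed
  also have "3 * (C * (b - a))\<^sup>2 * ?q ^ (5 * l) \<le> 3 * (C * (b - a))\<^sup>2 * ?q ^ l"
    using chain_ratio by (intro mult_left_mono power_decreasing) auto
  finally show "(\<integral>\<omega>. level_bound a b l (\<lambda>t. Z t \<omega>) \<partial>M) \<le> (1 + 3 * (C * (b - a))\<^sup>2) * ?q ^ l"
    by (simp add: algebra_simps)
qed

text \<open>
  The process enters the bound only through \<open>C\<close>. The estimate is made between polygons of levels \<open>k\<close> and
  \<open>m\<close>, where finitely many levels contribute, and then \<open>m\<close> tends to infinity by continuity of the paths.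
\<close>

lemma polygon_approximation_uniform:
  assumes ab: "a < b" and Z: "centered_gaussian M Z"
    and cont: "\<And>\<omega>. \<omega> \<in> space M \<Longrightarrow> continuous_on {a..b} (\<lambda>t. Z t \<omega>)"
    and incr: "\<And>s t. s \<in> {a..b} \<Longrightarrow> t \<in> {a..b} \<Longrightarrow> (\<integral>\<omega>. (Z s \<omega> - Z t \<omega>)\<^sup>2 \<partial>M) \<le> C * \<bar>s - t\<bar>"
    and lip: "\<And>x y. \<bar>f x - f y\<bar> \<le> L * dist x y" and L: "0 \<le> L" and B: "\<And>x. \<bar>f x :: real\<bar> \<le> B"
  shows "\<bar>(\<integral>\<omega>. f (extend_path a b (\<lambda>t. Z t \<omega>)) \<partial>M)
      - (\<integral>\<omega>. f (polygon a b k (samples a b k (\<lambda>t. Z t \<omega>))) \<partial>M)\<bar>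
    \<le> 2 * L * (1 + 3 * (C * (b - a))\<^sup>2) / (1 - chain_ratio) * chain_ratio ^ k"
proof -
  note M = centered_gaussian_prob_space[OF Z]
  interpret prob_space M by (rule M)
  note Zm = centered_gaussian_measurable[OF Z]
  note fc = lipschitz_imp_continuous_on[OF lip]
  let ?p = "\<lambda>l \<omega>. polygon a b l (samples a b l (\<lambda>t. Z t \<omega>))"
  let ?K = "1 + 3 * (C * (b - a))\<^sup>2"
  let ?bound = "2 * L * ?K / (1 - chain_ratio) * chain_ratio ^ k"
  have int: "integrable M (\<lambda>\<omega>. f (?p l \<omega>))" for l
    by (rule integrable_comp_bounded[OF M measurable_extend_path(3)[OF ab Zm cont] fc B])
  note lev = level_bound_expectation[OF ab Z incr]
  have step: "\<bar>(\<integral>\<omega>. f (?p m \<omega>) \<partial>M) - (\<integral>\<omega>. f (?p k \<omega>) \<partial>M)\<bar> \<le> ?bound" if "k \<le> m" for m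
  proof -
    have pt: "\<bar>f (?p m \<omega>) - f (?p k \<omega>)\<bar> \<le> L * (2 * (\<Sum>l=k..m. level_bound a b l (\<lambda>t. Z t \<omega>)))" for \<omega>
      using lip[of "?p m \<omega>" "?p k \<omega>"] L
        polygon_chaining[OF ab level_bound that, where x="\<lambda>t. Z t \<omega>"]
      by (meson mult_left_mono order_trans)
    have "\<bar>(\<integral>\<omega>. f (?p m \<omega>) \<partial>M) - (\<integral>\<omega>. f (?p k \<omega>) \<partial>M)\<bar> = \<bar>\<integral>\<omega>. f (?p m \<omega>) - f (?p k \<omega>) \<partial>M\<bar>"
      using int by simp
    also have "\<dots> \<le> (\<integral>\<omega>. \<bar>f (?p m \<omega>) - f (?p k \<omega>)\<bar> \<partial>M)" by (rule integral_abs_bound)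
    also have "\<dots> \<le> (\<integral>\<omega>. L * (2 * (\<Sum>l=k..m. level_bound a b l (\<lambda>t. Z t \<omega>))) \<partial>M)"
      using int lev(1) pt by (intro integral_mono) auto
    also have "\<dots> = L * (2 * (\<Sum>l=k..m. \<integral>\<omega>. level_bound a b l (\<lambda>t. Z t \<omega>) \<partial>M))"
      using lev(1) by simp
    also have "\<dots> \<le> L * (2 * (\<Sum>l=k..m. ?K * chain_ratio ^ l))"
      using lev(2) L by (intro mult_left_mono sum_mono) auto
    also have "(\<Sum>l=k..m. ?K * chain_ratio ^ l) = ?K * (\<Sum>l=k..m. chain_ratio ^ l)"
      by (simp only: sum_distrib_left)
    also have "(\<Sum>l=k..m. chain_ratio ^ l) \<le> chain_ratio ^ k / (1 - chain_ratio)"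
    proof -
      have "(\<Sum>l=k..m. chain_ratio ^ l) = (chain_ratio ^ k - chain_ratio ^ Suc m) / (1 - chain_ratio)"
        using chain_ratio that by (simp add: sum_gp)
      also have "\<dots> \<le> chain_ratio ^ k / (1 - chain_ratio)"
        using chain_ratio by (intro divide_right_mono) auto
      finally show ?thesis .
    qed
    then have "L * (2 * (?K * (\<Sum>l=k..m. chain_ratio ^ l))) \<le> L * (2 * (?K * (chain_ratio ^ k / (1 - chain_ratio))))"
      using L by (intro mult_left_mono) auto
    also have "L * (2 * (?K * (chain_ratio ^ k / (1 - chain_ratio)))) = ?bound"
      by (simp only: times_divide_eq_left times_divide_eq_right mult_ac)
    finally show ?thesis .
  qed
  have "(\<lambda>m. \<bar>(\<integral>\<omega>. f (?p m \<omega>) \<partial>M) - (\<integral>\<omega>. f (?p k \<omega>) \<partial>M)\<bar>) \<longlonglongrightarrow>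
      \<bar>(\<integral>\<omega>. f (extend_path a b (\<lambda>t. Z t \<omega>)) \<partial>M) - (\<integral>\<omega>. f (?p k \<omega>) \<partial>M)\<bar>"
    by (intro tendsto_rabs tendsto_diff tendsto_const polygon_expectation_tendsto[OF ab M Zm cont fc B])
  then show ?thesis
    by (rule LIMSEQ_le_const2) (use step in blast)
qed

text \<open>
  For a Lipschitz test, replacing the paths by polygons of level \<open>k\<close> costs little uniformly in \<open>n\<close> for
  the processes \<open>Z n\<close> by chaining, and little for the limit by continuity of its paths. For fixed \<open>k\<close> only
  finitely many coordinates occur; their plane-wave expectations are functions of the
  covariances.
\<close>

theorem gaussian_process_path_convergence:
  fixes Z :: "nat \<Rightarrow> real \<Rightarrow> 'v \<Rightarrow> real" and Y :: "real \<Rightarrow> 'w \<Rightarrow> real"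
    and f :: "(real \<Rightarrow>\<^sub>C real) \<Rightarrow> real"
  assumes ab: "a < b"
    and Z: "\<And>n. centered_gaussian (P n) (Z n)" and Y: "centered_gaussian Q Y"
    and Zc: "\<And>n \<omega>. \<omega> \<in> space (P n) \<Longrightarrow> continuous_on {a..b} (\<lambda>t. Z n t \<omega>)"
    and Yc: "\<And>\<omega>. \<omega> \<in> space Q \<Longrightarrow> continuous_on {a..b} (\<lambda>t. Y t \<omega>)"
    and cov: "\<And>s t. s \<in> {a..b} \<Longrightarrow> t \<in> {a..b} \<Longrightarrow>
        (\<lambda>n. \<integral>\<omega>. Z n s \<omega> * Z n t \<omega> \<partial>P n) \<longlonglongrightarrow> (\<integral>\<omega>. Y s \<omega> * Y t \<omega> \<partial>Q)"
    and incr: "\<And>n s t. s \<in> {a..b} \<Longrightarrow> t \<in> {a..b} \<Longrightarrow>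
        (\<integral>\<omega>. (Z n s \<omega> - Z n t \<omega>)\<^sup>2 \<partial>P n) \<le> C * \<bar>s - t\<bar>"
    and f: "continuous_on UNIV f" "\<And>x. \<bar>f x\<bar> \<le> B"
  shows "(\<lambda>n. \<integral>\<omega>. f (extend_path a b (\<lambda>t. Z n t \<omega>)) \<partial>P n)
      \<longlonglongrightarrow> (\<integral>\<omega>. f (extend_path a b (\<lambda>t. Y t \<omega>)) \<partial>Q)"
proof (rule weak_limit_of_lipschitz_tests[OF _ _ _ _ _ f])
  note P = centered_gaussian_prob_space[OF Z] and Q = centered_gaussian_prob_space[OF Y]
  note Zm = centered_gaussian_measurable[OF Z] and Ym = centered_gaussian_measurable[OF Y]
  show "prob_space (P n)" for n by (rule P)
  show "prob_space Q" by (rule Q)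
  show "(\<lambda>\<omega>. extend_path a b (\<lambda>t. Z n t \<omega>)) \<in> P n \<rightarrow>\<^sub>M borel" for n
    by (rule measurable_extend_path(1)[OF ab Zm Zc])
  show "(\<lambda>\<omega>. extend_path a b (\<lambda>t. Y t \<omega>)) \<in> Q \<rightarrow>\<^sub>M borel"
    by (rule measurable_extend_path(1)[OF ab Ym Yc])
  fix h :: "(real \<Rightarrow>\<^sub>C real) \<Rightarrow> real" and L B
  assume lip0: "\<And>x y. \<bar>h x - h y\<bar> \<le> L * dist x y" and B: "\<And>x. \<bar>h x\<bar> \<le> B"
  define L' where "L' = max L 0"
  have lip: "\<bar>h x - h y\<bar> \<le> L' * dist x y" for x y
    using lip0[of x y] mult_right_mono[of L L' "dist x y"] by (simp add: L'_def)
  have L': "0 \<le> L'" by (simp add: L'_def)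
  note hc = lipschitz_imp_continuous_on[OF lip]
  let ?pZ = "\<lambda>k n \<omega>. polygon a b k (samples a b k (\<lambda>t. Z n t \<omega>))"
  let ?pY = "\<lambda>k \<omega>. polygon a b k (samples a b k (\<lambda>t. Y t \<omega>))"
  have finite_dim: "(\<lambda>n. \<integral>\<omega>. h (?pZ k n \<omega>) \<partial>P n) \<longlonglongrightarrow> (\<integral>\<omega>. h (?pY k \<omega>) \<partial>Q)" for k
  proof -
    let ?t = "dyadic a b k"
    have t: "?t j \<in> {a..b}" if "j \<le> 2 ^ k" for j by (rule dyadic_range[OF ab that])
    have ZG: "centered_gaussian (P n) (\<lambda>j. Z n (?t j))" for n by (rule centered_gaussian_reindex[OF Z])
    have YG: "centered_gaussian Q (\<lambda>j. Y (?t j))" by (rule centered_gaussian_reindex[OF Y])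
    have "\<exists>C. \<forall>n. (\<integral>\<omega>. (Z n (?t j) \<omega>)\<^sup>2 \<partial>P n) \<le> C \<and> (\<integral>\<omega>. (Y (?t j) \<omega>)\<^sup>2 \<partial>Q) \<le> C" if "j \<le> 2 ^ k" for j
    proof -
      have "Bseq (\<lambda>n. \<integral>\<omega>. (Z n (?t j) \<omega>)\<^sup>2 \<partial>P n)"
        unfolding power2_eq_square by (rule convergent_imp_Bseq[OF convergentI[OF cov[OF t[OF that] t[OF that]]]])
      then obtain K where "\<And>n. \<bar>\<integral>\<omega>. (Z n (?t j) \<omega>)\<^sup>2 \<partial>P n\<bar> \<le> K" by (auto simp: Bseq_def)
      then show ?thesis
        by (intro exI[of _ "max K (\<integral>\<omega>. (Y (?t j) \<omega>)\<^sup>2 \<partial>Q)"]) (auto simp: abs_le_iff le_max_iff_disj)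
    qed
    then obtain C where C: "\<And>j n. j \<le> 2 ^ k \<Longrightarrow> (\<integral>\<omega>. (Z n (?t j) \<omega>)\<^sup>2 \<partial>P n) \<le> C j"
      "\<And>j. j \<le> 2 ^ k \<Longrightarrow> (\<integral>\<omega>. (Y (?t j) \<omega>)\<^sup>2 \<partial>Q) \<le> C j" by metis
    have Cmax: "C j \<le> Max (C ` {..2 ^ k})" if "j \<le> 2 ^ k" for j using that by (intro Max_ge) auto
    have comb: "(\<Sum>j\<le>2 ^ k. c j * samples a b k x j) = (\<Sum>j\<le>2 ^ k. c j * x (?t j))" for c x
      by (intro sum.cong) (auto simp: samples_def)
    show ?thesis
    proof (rule vector_weak_convergence[where K="2 ^ k" and C="Max (C ` {..2 ^ k})"
          and F="\<lambda>v. h (polygon a b k v)" and B=B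
          and V="\<lambda>n \<omega>. samples a b k (\<lambda>t. Z n t \<omega>)" and V'="\<lambda>\<omega>. samples a b k (\<lambda>t. Y t \<omega>)"])
      show "continuous_on UNIV (\<lambda>v. h (polygon a b k v))"
        by (rule continuous_on_compose2[OF hc continuous_polygon[OF ab]]) auto
      show "(\<lambda>n. \<integral>\<omega>. cos ((\<Sum>j\<le>2 ^ k. c j * samples a b k (\<lambda>t. Z n t \<omega>) j) + b') \<partial>P n)
          \<longlonglongrightarrow> (\<integral>\<omega>. cos ((\<Sum>j\<le>2 ^ k. c j * samples a b k (\<lambda>t. Y t \<omega>) j) + b') \<partial>Q)" for c b'
        unfolding comb
        unfolding centered_gaussian_cos[OF ZG finite_atMost] centered_gaussian_cos[OF YG finite_atMost]
        using t by (intro tendsto_intros cov) auto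
      show "(\<integral>\<omega>. (samples a b k (\<lambda>t. Z n t \<omega>) j)\<^sup>2 \<partial>P n) \<le> Max (C ` {..2 ^ k})" if "j \<le> 2 ^ k" for n j
        using order_trans[OF C(1)[OF that] Cmax[OF that]] that by (simp add: samples_def)
      show "(\<integral>\<omega>. (samples a b k (\<lambda>t. Y t \<omega>) j)\<^sup>2 \<partial>Q) \<le> Max (C ` {..2 ^ k})" if "j \<le> 2 ^ k" for j
        using order_trans[OF C(2)[OF that] Cmax[OF that]] that by (simp add: samples_def)
    qed (use P Q B measurable_extend_path(2)[OF ab Zm Zc] measurable_extend_path(2)[OF ab Ym Yc]
        centered_gaussian_integrable_power[OF Z] centered_gaussian_integrable_power[OF Y]
        in \<open>auto simp: samples_def\<close>)
  qed
  show "(\<lambda>n. \<integral>\<omega>. h (extend_path a b (\<lambda>t. Z n t \<omega>)) \<partial>P n)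
      \<longlonglongrightarrow> (\<integral>\<omega>. h (extend_path a b (\<lambda>t. Y t \<omega>)) \<partial>Q)"
  proof (rule LIMSEQ_I)
    fix r :: real assume r: "0 < r"
    define A where "A = 2 * L' * (1 + 3 * (C * (b - a))\<^sup>2) / (1 - chain_ratio)"
    have "(\<lambda>k. A * chain_ratio ^ k) \<longlonglongrightarrow> A * 0"
      using chain_ratio by (intro tendsto_mult_left LIMSEQ_realpow_zero) auto
    then have "\<forall>\<^sub>F k in sequentially. A * chain_ratio ^ k < r / 3"
      using r by (intro order_tendstoD(2)) auto
    moreover have "\<forall>\<^sub>F k in sequentially. dist (\<integral>\<omega>. h (?pY k \<omega>) \<partial>Q)
        (\<integral>\<omega>. h (extend_path a b (\<lambda>t. Y t \<omega>)) \<partial>Q) < r / 3"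
      using r by (intro tendstoD[OF polygon_expectation_tendsto[OF ab Q Ym Yc hc B]]) auto
    ultimately have "\<forall>\<^sub>F k in sequentially. A * chain_ratio ^ k < r / 3 \<and> dist (\<integral>\<omega>. h (?pY k \<omega>) \<partial>Q)
        (\<integral>\<omega>. h (extend_path a b (\<lambda>t. Y t \<omega>)) \<partial>Q) < r / 3" by (rule eventually_conj)
    then obtain k where k: "A * chain_ratio ^ k < r / 3"
      "dist (\<integral>\<omega>. h (?pY k \<omega>) \<partial>Q) (\<integral>\<omega>. h (extend_path a b (\<lambda>t. Y t \<omega>)) \<partial>Q) < r / 3"
      unfolding eventually_sequentially by blast
    have "\<forall>\<^sub>F n in sequentially. dist (\<integral>\<omega>. h (?pZ k n \<omega>) \<partial>P n) (\<integral>\<omega>. h (?pY k \<omega>) \<partial>Q) < r / 3"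
      using r by (intro tendstoD[OF finite_dim]) auto
    then obtain n0 where n0: "\<And>n. n0 \<le> n \<Longrightarrow>
        dist (\<integral>\<omega>. h (?pZ k n \<omega>) \<partial>P n) (\<integral>\<omega>. h (?pY k \<omega>) \<partial>Q) < r / 3"
      unfolding eventually_sequentially by blast
    show "\<exists>no. \<forall>n\<ge>no. norm ((\<integral>\<omega>. h (extend_path a b (\<lambda>t. Z n t \<omega>)) \<partial>P n)
        - (\<integral>\<omega>. h (extend_path a b (\<lambda>t. Y t \<omega>)) \<partial>Q)) < r"
    proof (intro exI allI impI)
      fix n assume "n0 \<le> n"
      have "\<bar>(\<integral>\<omega>. h (extend_path a b (\<lambda>t. Z n t \<omega>)) \<partial>P n) - (\<integral>\<omega>. h (?pZ k n \<omega>) \<partial>P n)\<bar> < r / 3"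
        using polygon_approximation_uniform[OF ab Z Zc incr lip L' B, of n k] k(1)
        unfolding A_def by linarith
      with n0[OF \<open>n0 \<le> n\<close>] k(2)
      show "norm ((\<integral>\<omega>. h (extend_path a b (\<lambda>t. Z n t \<omega>)) \<partial>P n)
          - (\<integral>\<omega>. h (extend_path a b (\<lambda>t. Y t \<omega>)) \<partial>Q)) < r"
        unfolding real_norm_def dist_real_def by linarith
    qed
  qed
qed

section \<open>Laws on continuous functions over a compact interval\<close>

lemma restrict_bcontfun_in_C_space:
  fixes x :: "real \<Rightarrow>\<^sub>C real"
  shows "restrict (apply_bcontfun x) {-M..M} \<in> mspace (cfunspace (top_of_set {-M..M}) euclidean_metric)"
proof -
  have "bounded (range (apply_bcontfun x))" using apply_bcontfun[of x] by (simp add: bcontfun_def)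
  then have "bounded (restrict (apply_bcontfun x) {-M..M} ` {-M..M})" by (rule bounded_subset) auto
  moreover have "continuous_on {-M..M} (restrict (apply_bcontfun x) {-M..M})"
    by (subst continuous_on_cong[OF refl restrict_apply']) auto
  ultimately show ?thesis by auto
qed

text \<open>
  Restriction to \<open>[- M, M]\<close> is 1-Lipschitz. So test functions on the interval pull back to
  test functions on \<open>real \<Rightarrow>\<^sub>C real\<close>, and random elements push forward.
\<close>

lemma continuous_restrict_bcontfun:
  assumes "0 < M"
  shows "continuous_map euclidean (C_space M) (\<lambda>x :: real \<Rightarrow>\<^sub>C real. restrict (apply_bcontfun x) {-M..M})"
proof -
  let ?m = "cfunspace (top_of_set {-M..M}) euclidean_metric :: (real \<Rightarrow> real) metric"
  have "Lipschitz_continuous_map euclidean_metric ?m (\<lambda>x :: real \<Rightarrow>\<^sub>C real. restrict (apply_bcontfun x) {-M..M})"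
    unfolding Lipschitz_continuous_map_def
  proof (intro conjI exI[of _ 1] ballI)
    fix x y :: "real \<Rightarrow>\<^sub>C real"
    show "mdist ?m (restrict (apply_bcontfun x) {-M..M}) (restrict (apply_bcontfun y) {-M..M})
        \<le> 1 * mdist euclidean_metric x y"
      by (rule mdist_cfunspace_le) (auto simp: dist_bounded)
  qed (use restrict_bcontfun_in_C_space in blast)
  from Lipschitz_continuous_imp_continuous_map[OF this] show ?thesis
    by (simp add: C_space_def mtopology_of_euclidean)
qed

lemma space_borel_of [simp]: "space (borel_of T) = topspace T"
  by (simp add: borel_of_def space_measure_of_conv)

lemma sets_borel_of_open: "openin T U \<Longrightarrow> U \<in> sets (borel_of T)"
  unfolding borel_of_def by (subst sets_measure_of) (auto dest: openin_subset)

lemma measurable_borel_of: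
  assumes f: "continuous_map euclidean T f" shows "f \<in> borel \<rightarrow>\<^sub>M borel_of T"
  unfolding borel_of_def
proof (rule measurable_measure_of)
  fix U assume "U \<in> {U. openin T U}"
  then have "open {x. f x \<in> U}" using openin_continuous_map_preimage[OF f] by (auto simp: Collect_conj_eq)
  then show "f -` U \<inter> space borel \<in> sets borel" by (simp add: vimage_def)
qed (use continuous_map_image_subset_topspace[OF f] in \<open>auto dest: openin_subset\<close>)

lemma borel_measurable_borel_of:
  assumes f: "continuous_map T euclideanreal f" shows "f \<in> borel_measurable (borel_of T)"
proof (rule borel_measurableI)
  fix U :: "real set" assume "open U"
  then have "openin T {x \<in> topspace T. f x \<in> U}" using openin_continuous_map_preimage[OF f] by auto
  moreover have "f -` U \<inter> space (borel_of T) = {x \<in> topspace T. f x \<in> U}" by auto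
  ultimately show "f -` U \<inter> space (borel_of T) \<in> sets (borel_of T)" by (simp add: sets_borel_of_open)
qed

lemma
  assumes M: "0 < M" and Z: "\<And>t. Z t \<in> borel_measurable \<Omega>"
    and cont: "\<And>\<omega>. \<omega> \<in> space \<Omega> \<Longrightarrow> continuous_on {-M..M} (\<lambda>t. Z t \<omega>)"
  shows path_measurable: "(\<lambda>\<omega>. restrict (\<lambda>t. Z t \<omega>) {-M..M}) \<in> \<Omega> \<rightarrow>\<^sub>M borel_of (C_space M)"
    and path_law_integral: "continuous_map (C_space M) euclideanreal f \<Longrightarrow> integral\<^sup>L (path_law \<Omega> Z M) f =
      (\<integral>\<omega>. f (restrict (apply_bcontfun (extend_path (-M) M (\<lambda>t. Z t \<omega>))) {-M..M}) \<partial>\<Omega>)"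
proof -
  have M': "-M < M" using M by simp
  have eq: "restrict (\<lambda>t. Z t \<omega>) {-M..M} = restrict (apply_bcontfun (extend_path (-M) M (\<lambda>t. Z t \<omega>))) {-M..M}"
    if "\<omega> \<in> space \<Omega>" for \<omega>
    using apply_extend_path[OF M' cont[OF that]] by (auto simp: clip_def restrict_def)
  show m: "(\<lambda>\<omega>. restrict (\<lambda>t. Z t \<omega>) {-M..M}) \<in> \<Omega> \<rightarrow>\<^sub>M borel_of (C_space M)"
    by (subst measurable_cong[OF eq], assumption)
      (rule measurable_compose[OF measurable_extend_path(1)[OF M' Z cont]
          measurable_borel_of[OF continuous_restrict_bcontfun[OF M]]])
  assume f: "continuous_map (C_space M) euclideanreal f"
  show "integral\<^sup>L (path_law \<Omega> Z M) f =
      (\<integral>\<omega>. f (restrict (apply_bcontfun (extend_path (-M) M (\<lambda>t. Z t \<omega>))) {-M..M}) \<partial>\<Omega>)"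
    unfolding path_law_def integral_distr[OF m borel_measurable_borel_of[OF f]]
    by (rule Bochner_Integration.integral_cong) (simp_all only: eq)
qed

lemma even_sequentially_eq: "even_sequentially = filtermap (\<lambda>k. 2 * Suc k) sequentially"
  unfolding filter_eq_iff
proof
  fix Q
  show "eventually Q even_sequentially \<longleftrightarrow> eventually Q (filtermap (\<lambda>k. 2 * Suc k) sequentially)"
  proof
    assume "eventually Q even_sequentially"
    then obtain N where N: "\<And>n. N \<le> n \<Longrightarrow> even n \<Longrightarrow> Q n"
      by (auto simp: even_sequentially_def eventually_inf_principal eventually_sequentially)
    then have "Q (2 * Suc k)" if "N \<le> k" for k using that by (intro N) auto
    then show "eventually Q (filtermap (\<lambda>k. 2 * Suc k) sequentially)"
      unfolding eventually_filtermap eventually_sequentially by blast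
  next
    assume "eventually Q (filtermap (\<lambda>k. 2 * Suc k) sequentially)"
    then obtain N where N: "\<And>k. N \<le> k \<Longrightarrow> Q (2 * Suc k)"
      unfolding eventually_filtermap eventually_sequentially by blast
    have "Q n" if "2 * Suc N \<le> n" "even n" for n
    proof -
      from that obtain j where "n = 2 * j" by blast
      with that(1) have "n = 2 * Suc (j - 1)" "N \<le> j - 1" by auto
      with N show ?thesis by metis
    qed
    then show "eventually Q even_sequentially"
      unfolding even_sequentially_def eventually_inf_principal eventually_sequentially by blast
  qed
qed

text \<open>
  The filter is given as the image of a sequence of indices, so that indices at which the processes are
  degenerate can be left out.
\<close>

theorem gaussian_process_converges_weakly:
  fixes P :: "nat \<Rightarrow> 'v measure" and Z :: "nat \<Rightarrow> real \<Rightarrow> 'v \<Rightarrow> real"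
    and Y :: "real \<Rightarrow> 'w \<Rightarrow> real" and idx :: "nat \<Rightarrow> nat"
  assumes F: "F = filtermap idx sequentially"
    and Z: "\<And>k. centered_gaussian (P (idx k)) (Z (idx k))" and Y: "centered_gaussian \<Omega> Y"
    and Zc: "\<And>k \<omega>. \<omega> \<in> space (P (idx k)) \<Longrightarrow> continuous_on UNIV (\<lambda>t. Z (idx k) t \<omega>)"
    and Yc: "\<And>\<omega>. \<omega> \<in> space \<Omega> \<Longrightarrow> continuous_on UNIV (\<lambda>t. Y t \<omega>)"
    and cov: "\<And>s t. (\<lambda>k. \<integral>\<omega>. Z (idx k) s \<omega> * Z (idx k) t \<omega> \<partial>P (idx k))
        \<longlonglongrightarrow> (\<integral>\<omega>. Y s \<omega> * Y t \<omega> \<partial>\<Omega>)"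
    and incr: "\<And>k s t. (\<integral>\<omega>. (Z (idx k) s \<omega> - Z (idx k) t \<omega>)\<^sup>2 \<partial>P (idx k)) \<le> C * \<bar>s - t\<bar>"
  shows "process_converges_weakly P Z \<Omega> Y F"
  unfolding process_converges_weakly_def weak_converges_def
proof (intro allI impI conjI)
  fix M :: real assume M: "0 < M"
  then have M': "-M < M" by simp
  have Zc': "continuous_on {-M..M} (\<lambda>t. Z (idx k) t \<omega>)" if "\<omega> \<in> space (P (idx k))" for k \<omega>
    using Zc[OF that] by (rule continuous_on_subset) simp
  have Yc': "continuous_on {-M..M} (\<lambda>t. Y t \<omega>)" if "\<omega> \<in> space \<Omega>" for \<omega>
    using Yc[OF that] by (rule continuous_on_subset) simp
  note Zm = centered_gaussian_measurable[OF Z] and Ym = centered_gaussian_measurable[OF Y]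
  have "prob_space (path_law (P (idx k)) (Z (idx k)) M)" for k
    unfolding path_law_def
    by (rule prob_space.prob_space_distr[OF centered_gaussian_prob_space[OF Z] path_measurable[OF M Zm Zc']])
  then show "\<forall>\<^sub>F i in F. prob_space (path_law (P i) (Z i) M)"
    by (simp add: F eventually_filtermap)
  show "prob_space (path_law \<Omega> Y M)"
    unfolding path_law_def
    by (rule prob_space.prob_space_distr[OF centered_gaussian_prob_space[OF Y] path_measurable[OF M Ym Yc']])
  fix f assume "continuous_map (C_space M) euclideanreal f \<and> bounded (f ` topspace (C_space M))"
  then have f: "continuous_map (C_space M) euclideanreal f" and "bounded (f ` topspace (C_space M))" by auto
  then obtain B where B: "\<And>x. x \<in> topspace (C_space M) \<Longrightarrow> \<bar>f x\<bar> \<le> B"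
    unfolding bounded_iff by auto
  define h where "h x = f (restrict (apply_bcontfun x) {-M..M})" for x
  have hc: "continuous_on UNIV h"
    using continuous_map_compose[OF continuous_restrict_bcontfun[OF M] f] by (simp add: h_def[abs_def] comp_def)
  have "restrict (apply_bcontfun x) {-M..M} \<in> topspace (C_space M)" for x
    using continuous_map_image_subset_topspace[OF continuous_restrict_bcontfun[OF M]] by auto
  then have hB: "\<bar>h x\<bar> \<le> B" for x unfolding h_def by (intro B)
  have "(\<lambda>k. \<integral>\<omega>. h (extend_path (-M) M (\<lambda>t. Z (idx k) t \<omega>)) \<partial>P (idx k))
      \<longlonglongrightarrow> (\<integral>\<omega>. h (extend_path (-M) M (\<lambda>t. Y t \<omega>)) \<partial>\<Omega>)"
    by (rule gaussian_process_path_convergence[OF M' Z Y Zc' Yc' cov incr hc hB])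
  then have "(\<lambda>k. integral\<^sup>L (path_law (P (idx k)) (Z (idx k)) M) f) \<longlonglongrightarrow> integral\<^sup>L (path_law \<Omega> Y M) f"
    by (simp only: path_law_integral[OF M Zm Zc' f] path_law_integral[OF M Ym Yc' f] h_def)
  then show "((\<lambda>i. integral\<^sup>L (path_law (P i) (Z i) M) f) \<longlongrightarrow> integral\<^sup>L (path_law \<Omega> Y M) f) F"
    by (simp add: F filterlim_filtermap)
qed

section \<open>The Green function of the massive lattice Laplacian\<close>

definition massive_laplacian :: "real \<Rightarrow> (nat \<Rightarrow> real) \<Rightarrow> nat \<Rightarrow> real" where
  "massive_laplacian m v i = (1 + m\<^sup>2) * v i - (v (i - 1) + v (i + 1)) / 2"

lemma summation_by_parts:
  fixes \<phi> v :: "nat \<Rightarrow> real"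
  assumes "\<phi> 0 = 0" "\<phi> (n + 1) = 0"
  shows "(\<Sum>i=1..n+1. (\<phi> i - \<phi> (i - 1)) * (v i - v (i - 1))) =
    (\<Sum>i=1..n. \<phi> i * (2 * v i - v (i - 1) - v (i + 1)))"
proof -
  have "(\<Sum>i=1..k+1. (\<phi> i - \<phi> (i - 1)) * (v i - v (i - 1))) =
      (\<Sum>i=1..k. \<phi> i * (2 * v i - v (i - 1) - v (i + 1))) + \<phi> (k + 1) * (v (k + 1) - v k)" for k
  proof (induction k)
    case 0
    then show ?case using assms(1) by simp
  next
    case (Suc k)
    then show ?case by (simp add: algebra_simps)
  qed
  from this[of n] assms(2) show ?thesis by simp
qed

text \<open>
  The left-hand side is the bilinear form that belongs to the quadratic form in the exponent of the field weight,
  up to the factor \<open>- 1/2\<close>.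
\<close>

lemma dirichlet_form_eq:
  fixes \<phi> v :: "nat \<Rightarrow> real"
  assumes "\<phi> 0 = 0" "\<phi> (n + 1) = 0"
  shows "(\<Sum>i=1..n+1. (\<phi> i - \<phi> (i - 1)) * (v i - v (i - 1))) / 2 + m\<^sup>2 * (\<Sum>i=1..n+1. \<phi> i * v i) =
    (\<Sum>i=1..n. \<phi> i * massive_laplacian m v i)"
proof -
  have "(\<Sum>i=1..n+1. \<phi> i * v i) = (\<Sum>i=1..n. \<phi> i * v i)" using assms by simp
  moreover have "\<phi> i * massive_laplacian m v i =
      \<phi> i * (2 * v i - v (i - 1) - v (i + 1)) / 2 + m\<^sup>2 * (\<phi> i * v i)" for i
    by (simp add: massive_laplacian_def field_simps)
  ultimately show ?thesis
    unfolding summation_by_parts[OF assms]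
    by (simp only: sum.distrib sum_distrib_left sum_divide_distrib)
qed

text \<open>
  The inverse correlation length of the lattice field.
\<close>

definition rate :: "real \<Rightarrow> real" where "rate m = arcosh (1 + m\<^sup>2)"

lemma cosh_rate: "cosh (rate m) = 1 + m\<^sup>2"
  by (simp add: rate_def cosh_arcosh_real)

lemma rate_pos: "m \<noteq> 0 \<Longrightarrow> 0 < rate m"
proof -
  assume "m \<noteq> 0"
  then have "cosh (rate m) \<noteq> 1" by (simp add: cosh_rate)
  moreover have "0 \<le> rate m" by (simp add: rate_def arcosh_nonneg_real)
  ultimately show ?thesis by (cases "rate m = 0") auto
qed

text \<open>
  The inverse of \<open>massive_laplacian\<close> on \<open>{1..n}\<close> with zero values at \<open>0\<close> and \<open>n + 1\<close>. By an addition theorem the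
  numerator is \<open>2 * sinh (\<theta> * i) * sinh (\<theta> * (n + 1 - j))\<close> for \<open>i \<le> j\<close>; the difference of two \<open>cosh\<close> shows
  the symmetry and the dependence on \<open>i - j\<close>.
\<close>

definition green :: "real \<Rightarrow> nat \<Rightarrow> nat \<Rightarrow> nat \<Rightarrow> real" where
  "green m n i j =
    (cosh (rate m * (real (n + 1) - \<bar>real i - real j\<bar>)) - cosh (rate m * (real (n + 1) - real i - real j)))
    / (sinh (rate m) * sinh (rate m * real (n + 1)))"

lemma green_sym: "green m n i j = green m n j i"
  by (simp add: green_def abs_minus_commute algebra_simps)

lemma green_boundary: "j \<le> n + 1 \<Longrightarrow> green m n 0 j = 0" "j \<le> n + 1 \<Longrightarrow> green m n (n + 1) j = 0"
proof -
  assume j: "j \<le> n + 1"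
  show "green m n 0 j = 0" by (simp add: green_def)
  have "real (n + 1) - \<bar>real (n + 1) - real j\<bar> = real j" using j by simp
  moreover have "real (n + 1) - real (n + 1) - real j = - real j" by simp
  ultimately show "green m n (n + 1) j = 0" unfolding green_def by (simp only: mult_minus_right cosh_minus) simp
qed

lemma cosh_neighbours: "cosh (t * (x + 1)) + cosh (t * (x - 1)) = 2 * cosh t * cosh (t * x)"
  for t x :: real
  by (simp add: distrib_left right_diff_distrib cosh_add cosh_diff)

text \<open>
  By \<open>cosh_neighbours\<close> the operator annihilates both terms, except for the first one at \<open>i = j\<close>: there
  \<open>\<bar>i - j\<bar>\<close> has a kink, whose contribution is the denominator.
\<close>

lemma green_fundamental:
  assumes m: "m \<noteq> 0" and i: "i \<in> {1..n}" and j: "j \<le> n + 1"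
  shows "massive_laplacian m (\<lambda>i. green m n i j) i = (if i = j then 1 else 0)"
proof -
  define \<theta> where "\<theta> = rate m"
  define N where "N = real (n + 1)"
  define D where "D = sinh \<theta> * sinh (\<theta> * N)"
  define p q where "p k = cosh (\<theta> * (N - \<bar>real k - real j\<bar>))" and "q k = cosh (\<theta> * (N - real k - real j))" for k
  have \<theta>: "0 < \<theta>" "cosh \<theta> = 1 + m\<^sup>2" using rate_pos[OF m] cosh_rate by (auto simp: \<theta>_def)
  have D: "D \<noteq> 0" using \<theta>(1) by (simp add: D_def N_def)
  have g: "green m n k j = (p k - q k) / D" for k
    by (simp add: green_def p_def q_def D_def \<theta>_def N_def)
  have i1: "real (i - 1) = real i - 1" using i by (simp add: of_nat_diff)
  have q: "q (i - 1) + q (i + 1) = 2 * cosh \<theta> * q i"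
  proof -
    have "N - real (i - 1) - real j = (N - real i - real j) + 1" "N - real (i + 1) - real j = (N - real i - real j) - 1"
      unfolding i1 by simp_all
    then show ?thesis
      unfolding q_def using cosh_neighbours[of \<theta> "N - real i - real j"] by (simp only:)
  qed
  have p: "2 * cosh \<theta> * p i - (p (i - 1) + p (i + 1)) = (if i = j then 2 * D else 0)"
  proof (cases "i = j")
    case True
    have d: "real (i - 1) - real j = -1" "real (i + 1) - real j = 1" "real i - real j = 0"
      unfolding i1 using True by simp_all
    have c: "cosh (\<theta> * (N - 1)) = cosh (\<theta> * N) * cosh \<theta> - sinh (\<theta> * N) * sinh \<theta>"
      by (simp add: right_diff_distrib cosh_diff)
    have "p (i - 1) = cosh (\<theta> * (N - 1))" "p (i + 1) = cosh (\<theta> * (N - 1))" "p i = cosh (\<theta> * N)"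
      unfolding p_def d by simp_all
    moreover have "2 * C * E - ((E * C - F * S) + (E * C - F * S)) = 2 * (S * F)" for C E F S :: real
      by (simp add: algebra_simps)
    ultimately show ?thesis using True by (simp only: c D_def refl if_True)
  next
    case False
    then consider "i < j" | "j < i" by linarith
    then have "p (i - 1) + p (i + 1) = 2 * cosh \<theta> * p i"
    proof cases
      case 1
      then have "N - \<bar>real (i - 1) - real j\<bar> = (N - (real j - real i)) - 1"
        "N - \<bar>real (i + 1) - real j\<bar> = (N - (real j - real i)) + 1"
        "N - \<bar>real i - real j\<bar> = N - (real j - real i)" unfolding i1 by simp_all
      then show ?thesis
        using cosh_neighbours[of \<theta> "N - (real j - real i)"] unfolding p_def by (simp only: add.commute)
    next
      case 2
      then have "N - \<bar>real (i - 1) - real j\<bar> = (N - (real i - real j)) + 1"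
        "N - \<bar>real (i + 1) - real j\<bar> = (N - (real i - real j)) - 1"
        "N - \<bar>real i - real j\<bar> = N - (real i - real j)" unfolding i1 by simp_all
      then show ?thesis
        using cosh_neighbours[of \<theta> "N - (real i - real j)"] unfolding p_def by (simp only:)
    qed
    then show ?thesis using False by simp
  qed
  have "massive_laplacian m (\<lambda>i. green m n i j) i =
      ((2 * cosh \<theta> * p i - (p (i - 1) + p (i + 1))) - (2 * cosh \<theta> * q i - (q (i - 1) + q (i + 1)))) / (2 * D)"
  proof -
    have "C * ((pi - qi) / D) - ((pm - qm) / D + (pp - qp) / D) / 2 =
        ((2 * C * pi - (pm + pp)) - (2 * C * qi - (qm + qp))) / (2 * D)" for C pi qi pm qm pp qp :: real
      using D by (simp add: field_simps)
    then show ?thesis unfolding massive_laplacian_def g \<theta>(2) .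
  qed
  also have "\<dots> = (if i = j then 1 else 0)" unfolding p q using D by simp
  finally show ?thesis .
qed

text \<open>
  Up to the denominator the left-hand side is \<open>2 * (cosh (\<theta> N) - cosh (\<theta> (N - d)))\<close>, where \<open>d = \<bar>i - j\<bar>\<close>, minus a term that is nonnegative by
  convexity of \<open>cosh\<close>. Each unit step from \<open>\<theta> N\<close> downwards decreases \<open>cosh\<close> by at most the denominator
  \<open>sinh \<theta> * sinh (\<theta> N)\<close>, so the bound is uniform in the mass and in \<open>n\<close>.
\<close>

lemma green_increment:
  assumes m: "m \<noteq> 0" and i: "i \<le> n + 1" and j: "j \<le> n + 1"
  shows "green m n i i + green m n j j - 2 * green m n i j \<le> 2 * \<bar>real i - real j\<bar>"
proof -
  define \<theta> where "\<theta> = rate m"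
  define N where "N = real (n + 1)"
  define D where "D = sinh \<theta> * sinh (\<theta> * N)"
  have \<theta>: "0 < \<theta>" using rate_pos[OF m] by (auto simp: \<theta>_def)
  have D: "0 < D" using \<theta> by (simp add: D_def N_def)
  have lip: "cosh (\<theta> * N) - cosh (\<theta> * (N - real d)) \<le> real d * D" if "d \<le> n + 1" for d
    using that
  proof (induction d)
    case (Suc d)
    define y where "y = \<theta> * (N - real d)"
    have y: "0 \<le> y" "y \<le> \<theta> * N" using Suc.prems \<theta> by (auto simp: y_def N_def)
    have "\<theta> * (N - real (Suc d)) = y - \<theta>" by (simp add: y_def algebra_simps)
    then have "cosh (\<theta> * (N - real (Suc d))) = cosh y * cosh \<theta> - sinh y * sinh \<theta>"
      by (simp add: cosh_diff)
    moreover have "cosh y * 1 \<le> cosh y * cosh \<theta>"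
      using cosh_real_ge_1[of \<theta>] by (intro mult_left_mono) auto
    moreover have "sinh y * sinh \<theta> \<le> D"
      using y \<theta> by (simp add: D_def mult.commute)
    ultimately have "cosh y - cosh (\<theta> * (N - real (Suc d))) \<le> D" by linarith
    with Suc show ?case by (simp add: y_def algebra_simps)
  qed simp
  define d where "d = (if i \<le> j then j - i else i - j)"
  have d: "real d = \<bar>real i - real j\<bar>" "d \<le> n + 1" using i j by (auto simp: d_def)
  have conv: "2 * cosh (\<theta> * (N - real i - real j)) \<le> cosh (\<theta> * (N - real i - real i)) + cosh (\<theta> * (N - real j - real j))"
  proof -
    define A B where "A = \<theta> * (N - real i - real j)" and "B = \<theta> * (real i - real j)"
    have "cosh (\<theta> * (N - real i - real i)) + cosh (\<theta> * (N - real j - real j)) = cosh (A - B) + cosh (A + B)"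
      by (simp add: A_def B_def algebra_simps)
    also have "\<dots> = 2 * (cosh A * cosh B)" by (simp add: cosh_add cosh_diff)
    also have "\<dots> \<ge> 2 * (cosh A * 1)"
      using cosh_real_ge_1[of B] by (intro mult_left_mono) auto
    finally show ?thesis by (simp add: A_def)
  qed
  have "green m n i i + green m n j j - 2 * green m n i j =
      (2 * cosh (\<theta> * N) - 2 * cosh (\<theta> * (N - real d))
        - (cosh (\<theta> * (N - real i - real i)) + cosh (\<theta> * (N - real j - real j)) - 2 * cosh (\<theta> * (N - real i - real j)))) / D"
    unfolding green_def d(1) \<theta>_def[symmetric] N_def[symmetric] D_def[symmetric] using D
    by (simp add: field_simps)
  also have "\<dots> \<le> (2 * (real d * D)) / D"
    using lip[OF d(2)] conv D by (intro divide_right_mono) auto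
  also have "\<dots> = 2 * \<bar>real i - real j\<bar>" using D by (simp add: d(1))
  finally show ?thesis .
qed

definition potential :: "real \<Rightarrow> nat \<Rightarrow> (nat \<Rightarrow> real) \<Rightarrow> nat \<Rightarrow> real" where
  "potential m n u i = (\<Sum>j=1..n. green m n i j * u j)"

lemma potential_boundary: "potential m n u 0 = 0" "potential m n u (n + 1) = 0"
  using green_boundary by (auto simp: potential_def intro!: sum.neutral)

lemma potential_solves:
  assumes m: "m \<noteq> 0" and i: "i \<in> {1..n}"
  shows "massive_laplacian m (potential m n u) i = u i"
proof -
  have "massive_laplacian m (potential m n u) i = (\<Sum>j=1..n. massive_laplacian m (\<lambda>i. green m n i j) i * u j)"
    unfolding massive_laplacian_def potential_def
    by (simp add: sum_distrib_left sum_divide_distrib sum.distrib[symmetric] sum_subtractf[symmetric] algebra_simps add_divide_distrib)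
  also have "\<dots> = (\<Sum>j=1..n. (if i = j then u j else 0))"
    using green_fundamental[OF m i] by (intro sum.cong) auto
  finally show ?thesis using i by simp
qed

lemma potential_energy:
  fixes u :: "nat \<Rightarrow> real" and n :: nat
  assumes m: "m \<noteq> 0"
  defines "v \<equiv> potential m n u"
  shows "(\<Sum>i=1..n. u i * v i) = (\<Sum>i=1..n+1. (v i - v (i - 1))\<^sup>2) / 2 + m\<^sup>2 * (\<Sum>i=1..n. (v i)\<^sup>2)"
proof -
  have v0: "v 0 = 0" "v (n + 1) = 0" unfolding v_def by (rule potential_boundary)+
  have "(\<Sum>i=1..n. u i * v i) = (\<Sum>i=1..n. v i * massive_laplacian m v i)"
    unfolding v_def using potential_solves[OF m] by (intro sum.cong) auto
  also have "\<dots> = (\<Sum>i=1..n+1. (v i - v (i - 1)) * (v i - v (i - 1))) / 2 + m\<^sup>2 * (\<Sum>i=1..n+1. v i * v i)"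
    by (rule dirichlet_form_eq[symmetric, OF v0])
  finally show ?thesis using v0(2) by (simp add: power2_eq_square)
qed

text \<open>
  The covariance of the field with its sum.
\<close>

definition response :: "real \<Rightarrow> nat \<Rightarrow> nat \<Rightarrow> real" where
  "response m n = potential m n (\<lambda>_. 1)"

definition total_variance :: "real \<Rightarrow> nat \<Rightarrow> real" where
  "total_variance m n = (\<Sum>i=1..n. response m n i)"

text \<open>
  The maximum principle: at an interior extremum the neighbours are not more extreme, so the
  equation with source 1 bounds the extreme value.
\<close>

lemma response_abs_le:
  assumes m: "m \<noteq> 0" and i: "i \<le> n + 1"
  shows "\<bar>response m n i\<bar> \<le> 1 / m\<^sup>2"
proof -
  let ?s = "response m n"
  have bd: "?s 0 = 0" "?s (n + 1) = 0" unfolding response_def by (rule potential_boundary)+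
  have eq: "(1 + m\<^sup>2) * ?s k = 1 + (?s (k - 1) + ?s (k + 1)) / 2" if "k \<in> {1..n}" for k
    using potential_solves[OF m that, of "\<lambda>_. 1"] by (simp add: massive_laplacian_def response_def)
  have "finite (?s ` {0..n+1})" "?s ` {0..n+1} \<noteq> {}" by auto
  from Max_in[OF this] obtain k where k2: "Max (?s ` {0..n+1}) = ?s k" and "k \<in> {0..n+1}"
    by (rule imageE)
  then have k: "k \<le> n + 1" "?s k = Max (?s ` {0..n+1})" by simp_all
  have k': "?s l \<le> ?s k" if "l \<le> n + 1" for l using that unfolding k(2) by (intro Max_ge) auto
  have up: "?s k \<le> 1 / m\<^sup>2"
  proof (cases "k \<in> {1..n}")
    case True
    then have "?s (k - 1) \<le> ?s k" "?s (k + 1) \<le> ?s k" by (auto intro!: k')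
    moreover have "?s k + m\<^sup>2 * ?s k = 1 + (?s (k - 1) + ?s (k + 1)) / 2"
      using eq[OF True] by (simp only: distrib_right mult_1_left)
    moreover have "w \<le> 1" if "b \<le> a" "c \<le> a" "a + w = 1 + (b + c) / 2" for a b c w :: real
      using that by (simp add: field_simps)
    ultimately have "m\<^sup>2 * ?s k \<le> 1" by blast
    then show ?thesis using m by (simp add: field_simps)
  next
    case False
    with k(1) have "k = 0 \<or> k = n + 1" by auto
    then show ?thesis using bd by auto
  qed
  have "finite (?s ` {0..n+1})" "?s ` {0..n+1} \<noteq> {}" by auto
  from Min_in[OF this] obtain l where l2: "Min (?s ` {0..n+1}) = ?s l" and "l \<in> {0..n+1}"
    by (rule imageE)
  then have l: "l \<le> n + 1" "?s l = Min (?s ` {0..n+1})" by simp_all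
  have l': "?s l \<le> ?s q" if "q \<le> n + 1" for q using that unfolding l(2) by (intro Min_le) auto
  have low: "0 \<le> ?s l"
  proof (cases "l \<in> {1..n}")
    case True
    then have "?s l \<le> ?s (l - 1)" "?s l \<le> ?s (l + 1)" by (auto intro!: l')
    moreover have "?s l + m\<^sup>2 * ?s l = 1 + (?s (l - 1) + ?s (l + 1)) / 2"
      using eq[OF True] by (simp only: distrib_right mult_1_left)
    moreover have "1 \<le> w" if "a \<le> b" "a \<le> c" "a + w = 1 + (b + c) / 2" for a b c w :: real
      using that by (simp add: field_simps)
    ultimately have "1 \<le> m\<^sup>2 * ?s l" by blast
    then have "0 < m\<^sup>2 * ?s l" by linarith
    then show ?thesis using m by (simp add: zero_less_mult_iff)
  next
    case False
    with l(1) have "l = 0 \<or> l = n + 1" by auto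
    then show ?thesis using bd by auto
  qed
  show ?thesis using k'[OF i] l'[OF i] up low by simp
qed

text \<open>
  The total variance is the energy of the response. Compare the response with the constant \<open>t\<close>: the energy
  of the difference is nonnegative, and \<open>t = n / (1 + m\<^sup>2 n)\<close> gives the best bound.
\<close>

lemma total_variance_lower:
  assumes m: "m \<noteq> 0" and n: "1 \<le> n"
  shows "(real n)\<^sup>2 / (1 + m\<^sup>2 * real n) \<le> total_variance m n"
proof -
  let ?s = "response m n"
  define t where "t = real n / (1 + m\<^sup>2 * real n)"
  have den: "0 < 1 + m\<^sup>2 * real n" by (intro add_pos_nonneg) auto
  have bd: "?s 0 = 0" "?s (n + 1) = 0" unfolding response_def by (rule potential_boundary)+
  let ?d = "\<lambda>i. (?s i - ?s (i - 1))\<^sup>2"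
  have energy: "total_variance m n = (\<Sum>i=1..n+1. ?d i) / 2 + m\<^sup>2 * (\<Sum>i=1..n. (?s i)\<^sup>2)"
    using potential_energy[OF m, where n=n and u="\<lambda>_. 1"] by (simp add: total_variance_def response_def)
  \<comment> \<open>of the gradient energy, only the two boundary bonds are kept\<close>
  have "(\<Sum>i\<in>{1, n+1}. ?d i) \<le> (\<Sum>i=1..n+1. ?d i)" by (intro sum_mono2) auto
  then have grad: "(?s 1)\<^sup>2 + (?s n)\<^sup>2 \<le> (\<Sum>i=1..n+1. ?d i)" using n bd by simp
  \<comment> \<open>summing the equation over all sites leaves the flux through the two ends\<close>
  have flux: "real n = m\<^sup>2 * total_variance m n + (?s 1 + ?s n) / 2"
  proof -
    have "(\<Sum>i=1..k. 2 * ?s i - ?s (i - 1) - ?s (i + 1)) = ?s 1 + ?s k - ?s (k + 1)" if "1 \<le> k" for k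
      using that
    proof (induction k rule: dec_induct)
      case base
      then show ?case using bd by simp
    qed simp
    from this[OF n] have tele: "(\<Sum>i=1..n. 2 * ?s i - ?s (i - 1) - ?s (i + 1)) = ?s 1 + ?s n" using bd by simp
    have "real n = (\<Sum>i=1..n. massive_laplacian m ?s i)"
      unfolding response_def using potential_solves[OF m] by simp
    also have "\<dots> = (\<Sum>i=1..n. m\<^sup>2 * ?s i + (2 * ?s i - ?s (i - 1) - ?s (i + 1)) / 2)"
      by (intro sum.cong) (auto simp: massive_laplacian_def field_simps)
    also have "\<dots> = m\<^sup>2 * total_variance m n + (?s 1 + ?s n) / 2"
      by (simp only: sum.distrib sum_distrib_left[symmetric] sum_divide_distrib[symmetric] tele total_variance_def)
    finally show ?thesis .
  qed
  have "0 \<le> (?s 1 - t)\<^sup>2 / 2 + (?s n - t)\<^sup>2 / 2 + m\<^sup>2 * (\<Sum>i=1..n. (?s i - t)\<^sup>2)"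
    by (intro add_nonneg_nonneg mult_nonneg_nonneg sum_nonneg) auto
  also have "(\<Sum>i=1..n. (?s i - t)\<^sup>2) = (\<Sum>i=1..n. (?s i)\<^sup>2) - 2 * t * total_variance m n + real n * t\<^sup>2"
    by (simp add: power2_diff sum.distrib sum_subtractf total_variance_def sum_distrib_left mult_ac)
  also have "(?s 1 - t)\<^sup>2 / 2 + (?s n - t)\<^sup>2 / 2 + m\<^sup>2 * \<dots> =
      ((?s 1)\<^sup>2 + (?s n)\<^sup>2) / 2 + m\<^sup>2 * (\<Sum>i=1..n. (?s i)\<^sup>2)
      - 2 * t * (m\<^sup>2 * total_variance m n + (?s 1 + ?s n) / 2) + t\<^sup>2 * (1 + m\<^sup>2 * real n)"
    by (simp add: power2_diff field_simps)
  also have "\<dots> = ((?s 1)\<^sup>2 + (?s n)\<^sup>2) / 2 + m\<^sup>2 * (\<Sum>i=1..n. (?s i)\<^sup>2)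
      - 2 * t * real n + t\<^sup>2 * (1 + m\<^sup>2 * real n)"
    by (simp only: flux[symmetric])
  also have "\<dots> \<le> total_variance m n - 2 * t * real n + t\<^sup>2 * (1 + m\<^sup>2 * real n)"
    unfolding energy using grad by simp
  also have "\<dots> = total_variance m n - (real n)\<^sup>2 / (1 + m\<^sup>2 * real n)"
  proof -
    have "t * (1 + m\<^sup>2 * real n) = real n" using den by (simp add: t_def)
    then have "t\<^sup>2 * (1 + m\<^sup>2 * real n) = t * real n" by (simp add: power2_eq_square)
    moreover have "(real n)\<^sup>2 / (1 + m\<^sup>2 * real n) = t * real n" by (simp add: t_def power2_eq_square)
    ultimately show ?thesis by simp
  qed
  finally show ?thesis by simp
qed

section \<open>The Cameron--Martin formula for the lattice field\<close>

definition shift :: "'i set \<Rightarrow> ('i \<Rightarrow> real) \<Rightarrow> ('i \<Rightarrow> real) \<Rightarrow> 'i \<Rightarrow> real" where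
  "shift I v \<phi> = (\<lambda>i\<in>I. \<phi> i + v i)"

lemma lborel_emeasure_translate:
  fixes c :: real
  assumes "A \<in> sets borel" shows "emeasure lborel {x. x + c \<in> A} = emeasure lborel A"
proof -
  have "emeasure lborel A = emeasure (distr lborel borel ((+) c)) A"
    by (simp only: lborel_distr_plus)
  also have "\<dots> = emeasure lborel {x. x + c \<in> A}"
    using assms by (subst emeasure_distr) (auto intro!: arg_cong[where f="emeasure lborel"] simp: add.commute)
  finally show ?thesis by simp
qed

lemma shift_measurable:
  assumes "finite I" and M: "\<And>i. i \<in> I \<Longrightarrow> sets (M i) = sets borel"
  shows "shift I v \<in> Pi\<^sub>M I M \<rightarrow>\<^sub>M Pi\<^sub>M I M"
  unfolding shift_def
proof (rule measurable_restrict)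
  fix i assume i: "i \<in> I"
  have "(\<lambda>x. x i) \<in> Pi\<^sub>M I M \<rightarrow>\<^sub>M borel"
    using measurable_component_singleton[OF i, of M] by (simp add: measurable_cong_sets[OF refl M[OF i]])
  then show "(\<lambda>x. x i + v i) \<in> Pi\<^sub>M I M \<rightarrow>\<^sub>M M i"
    by (simp add: measurable_cong_sets[OF refl M[OF i]])
qed

lemma PiM_lborel_translation:
  fixes I :: "'i set"
  assumes I: "finite I"
  shows "distr (Pi\<^sub>M I (\<lambda>_. lborel)) (Pi\<^sub>M I (\<lambda>_. lborel)) (shift I v) = Pi\<^sub>M I (\<lambda>_. lborel)"
proof -
  interpret product_sigma_finite "\<lambda>_::'i. lborel :: real measure" by standard
  let ?L = "Pi\<^sub>M I (\<lambda>_. lborel :: real measure)"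
  have sm: "shift I v \<in> ?L \<rightarrow>\<^sub>M ?L" by (rule shift_measurable[OF I]) simp
  show ?thesis
  proof (rule PiM_eqI[OF I])
    fix A :: "'i \<Rightarrow> real set" assume A: "\<And>i. i \<in> I \<Longrightarrow> A i \<in> sets lborel"
    have A': "{x. x + v i \<in> A i} \<in> sets lborel" if "i \<in> I" for i
    proof -
      have "(\<lambda>x. x + v i) -` A i \<inter> space borel \<in> sets borel"
        using A[OF that] by (intro measurable_sets[where A=borel]) auto
      then show ?thesis by (simp add: vimage_def)
    qed
    have "emeasure (distr ?L ?L (shift I v)) (Pi\<^sub>E I A) = emeasure ?L (shift I v -` Pi\<^sub>E I A \<inter> space ?L)"
      using A I by (intro emeasure_distr sm) (auto intro!: sets_PiM_I_finite)
    also have "shift I v -` Pi\<^sub>E I A \<inter> space ?L = Pi\<^sub>E I (\<lambda>i. {x. x + v i \<in> A i})"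
      by (auto simp: shift_def space_PiM PiE_iff extensional_def)
    also have "emeasure ?L \<dots> = (\<Prod>i\<in>I. emeasure lborel {x. x + v i \<in> A i})"
      using A' by (intro emeasure_PiM I) auto
    also have "\<dots> = (\<Prod>i\<in>I. emeasure lborel (A i))"
      using A by (intro prod.cong lborel_emeasure_translate) auto
    finally show "emeasure (distr ?L ?L (shift I v)) (Pi\<^sub>E I A) = (\<Prod>i\<in>I. emeasure lborel (A i))" .
  qed simp
qed

lemma nn_integral_translation:
  fixes F :: "('i \<Rightarrow> real) \<Rightarrow> ennreal"
  assumes I: "finite I" and F: "F \<in> borel_measurable (Pi\<^sub>M I (\<lambda>_. lborel))"
  shows "(\<integral>\<^sup>+\<phi>. F (shift I v \<phi>) \<partial>Pi\<^sub>M I (\<lambda>_. lborel)) = (\<integral>\<^sup>+\<phi>. F \<phi> \<partial>Pi\<^sub>M I (\<lambda>_. lborel))"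
proof -
  have "(\<integral>\<^sup>+\<phi>. F \<phi> \<partial>Pi\<^sub>M I (\<lambda>_. lborel)) =
      (\<integral>\<^sup>+\<phi>. F \<phi> \<partial>distr (Pi\<^sub>M I (\<lambda>_. lborel)) (Pi\<^sub>M I (\<lambda>_. lborel)) (shift I v))"
    by (simp only: PiM_lborel_translation[OF I])
  also have "\<dots> = (\<integral>\<^sup>+\<phi>. F (shift I v \<phi>) \<partial>Pi\<^sub>M I (\<lambda>_. lborel))"
    by (rule nn_integral_distr) (use shift_measurable[OF I] F in simp_all)
  finally show ?thesis by simp
qed

text \<open>
  Completing the square: \<open>v\<close> solves the massive Laplace equation with source \<open>u\<close>, so the mixed term in the
  exponent is the linear functional with coefficients \<open>u\<close>.
\<close>

lemma field_weight_shift: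
  fixes u \<phi> :: "nat \<Rightarrow> real" and n :: nat
  assumes m: "m \<noteq> 0" and \<phi>: "\<phi> 0 = 0" "\<phi> (n + 1) = 0"
  defines "v \<equiv> potential m n u"
  shows "field_weight m n (\<lambda>i. \<phi> i - v i) =
    field_weight m n \<phi> * exp (\<Sum>i=1..n. u i * \<phi> i) * exp (- (\<Sum>i=1..n. u i * v i) / 2)"
proof -
  have v0: "v 0 = 0" "v (n + 1) = 0" unfolding v_def by (rule potential_boundary)+
  have uv: "(\<Sum>i=1..n. \<psi> i * massive_laplacian m v i) = (\<Sum>i=1..n. u i * \<psi> i)" for \<psi> :: "nat \<Rightarrow> real"
    unfolding v_def using potential_solves[OF m] by (intro sum.cong) auto
  define A B C where "A = (\<Sum>i=1..n+1. (\<phi> i - \<phi> (i - 1))\<^sup>2)"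
    and "B = (\<Sum>i=1..n+1. (\<phi> i - \<phi> (i - 1)) * (v i - v (i - 1)))"
    and "C = (\<Sum>i=1..n+1. (v i - v (i - 1)) * (v i - v (i - 1)))"
  define a b c where "a = (\<Sum>i=1..n+1. (\<phi> i)\<^sup>2)" and "b = (\<Sum>i=1..n+1. \<phi> i * v i)"
    and "c = (\<Sum>i=1..n+1. v i * v i)"
  have 1: "(\<Sum>i=1..n+1. ((\<phi> i - v i) - (\<phi> (i - 1) - v (i - 1)))\<^sup>2) = A - 2 * B + C"
    unfolding A_def B_def C_def sum_distrib_left sum_subtractf[symmetric] sum.distrib[symmetric]
    by (intro sum.cong) (auto simp: power2_eq_square algebra_simps)
  have 2: "(\<Sum>i=1..n+1. (\<phi> i - v i)\<^sup>2) = a - 2 * b + c"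
    unfolding a_def b_def c_def sum_distrib_left sum_subtractf[symmetric] sum.distrib[symmetric]
    by (intro sum.cong) (auto simp: power2_eq_square algebra_simps)
  have 3: "B / 2 + m\<^sup>2 * b = (\<Sum>i=1..n. u i * \<phi> i)" "C / 2 + m\<^sup>2 * c = (\<Sum>i=1..n. u i * v i)"
    unfolding B_def b_def C_def c_def
    using dirichlet_form_eq[OF \<phi>, of v m] dirichlet_form_eq[OF v0, of v m] uv by auto
  have "- (1/4) * (A - 2 * B + C) - m\<^sup>2 / 2 * (a - 2 * b + c) =
      (- (1/4) * A - m\<^sup>2 / 2 * a) + (B / 2 + m\<^sup>2 * b) + (- (C / 2 + m\<^sup>2 * c) / 2)"
    by (simp add: field_simps)
  then show ?thesis
    unfolding field_weight_def 1 2 A_def[symmetric] a_def[symmetric]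
    by (simp only: 3 exp_add)
qed

lemma field_weight_pos: "0 < field_weight m n \<phi>"
  by (simp add: field_weight_def)

lemma pin_boundary: "pin n \<phi> 0 = 0" "pin n \<phi> (n + 1) = 0"
  by (simp_all add: pin_def)

lemma field_weight_cong: "(\<And>i. i \<le> n + 1 \<Longrightarrow> \<phi> i = \<psi> i) \<Longrightarrow> field_weight m n \<phi> = field_weight m n \<psi>"
  unfolding field_weight_def by (intro arg_cong[where f=exp] arg_cong2[where f="(-)"] arg_cong2[where f="(*)"] refl sum.cong) auto

lemma pin_component_measurable:
  "i \<le> n + 1 \<Longrightarrow> (\<lambda>\<phi>. pin n \<phi> i) \<in> borel_measurable (Pi\<^sub>M {1..n} (\<lambda>_. lborel))"
proof -
  assume i: "i \<le> n + 1"
  show ?thesis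
  proof (cases "i \<in> {1..n}")
    case True
    have "(\<lambda>\<phi>. \<phi> i) \<in> Pi\<^sub>M {1..n} (\<lambda>_. lborel) \<rightarrow>\<^sub>M (lborel :: real measure)"
      using True by (rule measurable_component_singleton)
    moreover have "(\<lambda>\<phi>. pin n \<phi> i) = (\<lambda>\<phi>. \<phi> i)" using True by (auto simp: pin_def)
    ultimately show ?thesis by simp
  next
    case False
    with i have "(\<lambda>\<phi>. pin n \<phi> i) = (\<lambda>_. 0)" by (auto simp: pin_def)
    then show ?thesis by simp
  qed
qed

lemma pin_measurable: "pin n \<in> Pi\<^sub>M {1..n} (\<lambda>_. lborel) \<rightarrow>\<^sub>M field_space n"
proof -
  have "(\<lambda>\<phi>. \<lambda>i\<in>{0..n+1}. pin n \<phi> i) \<in> Pi\<^sub>M {1..n} (\<lambda>_. lborel) \<rightarrow>\<^sub>M field_space n"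
    unfolding field_space_def by (rule measurable_restrict) (use pin_component_measurable in auto)
  moreover have "(\<lambda>\<phi>. \<lambda>i\<in>{0..n+1}. pin n \<phi> i) = pin n"
    by (intro ext) (simp add: pin_def restrict_def)
  ultimately show ?thesis by simp
qed

lemma field_weight_pin_measurable:
  "(\<lambda>\<phi>. field_weight m n (pin n \<phi>)) \<in> borel_measurable (Pi\<^sub>M {1..n} (\<lambda>_. lborel))"
  unfolding field_weight_def
  by (intro measurable_compose[OF _ borel_measurable_exp] borel_measurable_diff borel_measurable_times
      borel_measurable_const borel_measurable_sum borel_measurable_power pin_component_measurable) auto

definition partition_function :: "real \<Rightarrow> nat \<Rightarrow> real" where
  "partition_function m n = (\<integral>\<phi>. field_weight m n (pin n \<phi>) \<partial>Pi\<^sub>M {1..n} (\<lambda>_. lborel))"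

lemma integrable_exp_square:
  assumes "m \<noteq> 0" shows "integrable lborel (\<lambda>x::real. exp (- (m\<^sup>2 / 2 * x\<^sup>2)))"
proof -
  have "integrable lborel (\<lambda>x. sqrt (2 * pi * (1 / \<bar>m\<bar>)\<^sup>2) * normal_density 0 (1 / \<bar>m\<bar>) x)"
    using assms by (intro integrable_mult_right) auto
  moreover have "sqrt (2 * pi * (1 / \<bar>m\<bar>)\<^sup>2) * normal_density 0 (1 / \<bar>m\<bar>) x = exp (- (m\<^sup>2 / 2 * x\<^sup>2))" for x
    using assms by (simp add: normal_density_def power_divide)
  ultimately show ?thesis by simp
qed

lemma partition_function:
  assumes m: "m \<noteq> 0"
  shows "integrable (Pi\<^sub>M {1..n} (\<lambda>_. lborel)) (\<lambda>\<phi>. field_weight m n (pin n \<phi>))"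
    and "0 < partition_function m n"
proof -
  interpret product_sigma_finite "\<lambda>_::nat. lborel :: real measure" by standard
  let ?L = "Pi\<^sub>M {1..n} (\<lambda>_. lborel :: real measure)"
  let ?w = "\<lambda>\<phi>. field_weight m n (pin n \<phi>)"
  show int: "integrable ?L ?w"
  proof (rule Bochner_Integration.integrable_bound)
    show "integrable ?L (\<lambda>\<phi>. \<Prod>i\<in>{1..n}. exp (- (m\<^sup>2 / 2 * (\<phi> i)\<^sup>2)))"
      by (rule product_integrable_prod) (use integrable_exp_square[OF m] in auto)
    show "AE \<phi> in ?L. norm (?w \<phi>) \<le> norm (\<Prod>i\<in>{1..n}. exp (- (m\<^sup>2 / 2 * (\<phi> i)\<^sup>2)))"
    proof (rule AE_I2)
      fix \<phi> :: "nat \<Rightarrow> real"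
      have "(\<Sum>i=1..n+1. (pin n \<phi> i)\<^sup>2) = (\<Sum>i=1..n. (\<phi> i)\<^sup>2)"
        by (simp add: pin_def)
      moreover have "0 \<le> (\<Sum>i=1..n+1. (pin n \<phi> i - pin n \<phi> (i - 1))\<^sup>2)" by (intro sum_nonneg) auto
      ultimately have "?w \<phi> \<le> exp (- (m\<^sup>2 / 2 * (\<Sum>i=1..n. (\<phi> i)\<^sup>2)))"
        unfolding field_weight_def by simp
      also have "\<dots> = (\<Prod>i\<in>{1..n}. exp (- (m\<^sup>2 / 2 * (\<phi> i)\<^sup>2)))"
        by (simp add: exp_sum[symmetric] sum_negf sum_distrib_left)
      finally show "norm (?w \<phi>) \<le> norm (\<Prod>i\<in>{1..n}. exp (- (m\<^sup>2 / 2 * (\<phi> i)\<^sup>2)))"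
        using field_weight_pos[of m n "pin n \<phi>"] by simp
    qed
  qed (rule field_weight_pin_measurable)
  have "0 \<le> partition_function m n"
    unfolding partition_function_def using field_weight_pos by (intro Bochner_Integration.integral_nonneg) (auto intro: less_imp_le)
  moreover have "partition_function m n \<noteq> 0"
  proof
    assume "partition_function m n = 0"
    then have "AE \<phi> in ?L. ?w \<phi> = 0"
      unfolding partition_function_def
      by (subst (asm) integral_nonneg_eq_0_iff_AE[OF int]) (auto intro: less_imp_le field_weight_pos)
    then have "AE \<phi> in ?L. False" using field_weight_pos by (auto elim!: eventually_mono simp: less_le)
    then have "emeasure ?L (space ?L) = 0" using AE_iff_measurable[of "space ?L" ?L "\<lambda>_. False"] by simp
    moreover have "Pi\<^sub>E {1..n} (\<lambda>_. {0..1}) \<subseteq> space ?L" by (auto simp: space_PiM)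
    then have "emeasure ?L (Pi\<^sub>E {1..n} (\<lambda>_. {0..1})) \<le> emeasure ?L (space ?L)" by (intro emeasure_mono) auto
    moreover have "emeasure ?L (Pi\<^sub>E {1..n} (\<lambda>_. {0..1})) = (\<Prod>i\<in>{1..n}. emeasure lborel {0..1::real})"
      by (rule emeasure_PiM) auto
    ultimately show False by simp
  qed
  ultimately show "0 < partition_function m n" by simp
qed

lemma sets_grand_canonical [simp]: "sets (grand_canonical m n) = sets (field_space n)"
  by (simp add: grand_canonical_def Let_def)

lemma space_grand_canonical [simp]: "space (grand_canonical m n) = space (field_space n)"
  by (simp add: grand_canonical_def Let_def)

lemma nn_integral_grand_canonical:
  assumes F: "F \<in> borel_measurable (field_space n)"
  shows "(\<integral>\<^sup>+\<phi>. F \<phi> \<partial>grand_canonical m n) =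
    (\<integral>\<^sup>+\<phi>. ennreal (field_weight m n (pin n \<phi>) / partition_function m n) * F (pin n \<phi>) \<partial>Pi\<^sub>M {1..n} (\<lambda>_. lborel))"
proof -
  have pm: "pin n \<in> density (Pi\<^sub>M {1..n} (\<lambda>_. lborel)) f \<rightarrow>\<^sub>M field_space n" for f
    using pin_measurable by simp
  have wm: "(\<lambda>\<phi>. ennreal (field_weight m n (pin n \<phi>) / partition_function m n)) \<in>
      borel_measurable (Pi\<^sub>M {1..n} (\<lambda>_. lborel))"
    by (intro measurable_compose[OF _ measurable_ennreal] borel_measurable_divide field_weight_pin_measurable borel_measurable_const)
  have "(\<integral>\<^sup>+\<phi>. F \<phi> \<partial>grand_canonical m n) =
      (\<integral>\<^sup>+\<phi>. F (pin n \<phi>) \<partial>density (Pi\<^sub>M {1..n} (\<lambda>_. lborel))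
        (\<lambda>\<phi>. ennreal (field_weight m n (pin n \<phi>) / partition_function m n)))"
    unfolding grand_canonical_def Let_def partition_function_def[symmetric]
    by (rule nn_integral_distr[OF pm]) (use F in simp)
  also have "\<dots> = (\<integral>\<^sup>+\<phi>. ennreal (field_weight m n (pin n \<phi>) / partition_function m n) * F (pin n \<phi>) \<partial>Pi\<^sub>M {1..n} (\<lambda>_. lborel))"
    by (rule nn_integral_density[OF wm measurable_compose[OF pin_measurable F]])
  finally show ?thesis .
qed

lemma prob_space_grand_canonical:
  assumes m: "m \<noteq> 0" shows "prob_space (grand_canonical m n)"
proof
  let ?L = "Pi\<^sub>M {1..n} (\<lambda>_. lborel :: real measure)"
  have "emeasure (grand_canonical m n) (space (grand_canonical m n)) = (\<integral>\<^sup>+\<phi>. 1 \<partial>grand_canonical m n)"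
    by simp
  also have "\<dots> = (\<integral>\<^sup>+\<phi>. ennreal (field_weight m n (pin n \<phi>) / partition_function m n) \<partial>?L)"
    by (subst nn_integral_grand_canonical) auto
  also have "\<dots> = ennreal (\<integral>\<phi>. field_weight m n (pin n \<phi>) / partition_function m n \<partial>?L)"
    using partition_function[OF m, of n] field_weight_pos
    by (intro nn_integral_eq_integral) (auto intro!: divide_nonneg_nonneg less_imp_le)
  also have "\<dots> = 1"
    using partition_function(2)[OF m, of n]
    unfolding integral_divide_zero partition_function_def[symmetric] by simp
  finally show "emeasure (grand_canonical m n) (space (grand_canonical m n)) = 1" .
qed

lemma field_component_measurable:
  "i \<le> n + 1 \<Longrightarrow> (\<lambda>\<phi>. \<phi> i) \<in> borel_measurable (field_space n)"
  unfolding field_space_def by (rule measurable_component_singleton) simp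

lemma linear_functional_measurable:
  "(\<lambda>\<phi>. \<Sum>i=1..n. u i * \<phi> i) \<in> borel_measurable (field_space n)"
  by (intro borel_measurable_sum borel_measurable_times borel_measurable_const field_component_measurable) auto

lemma shift_field_measurable: "shift {0..n+1} v \<in> field_space n \<rightarrow>\<^sub>M field_space n"
  unfolding field_space_def by (rule shift_measurable) auto

text \<open>
  Translate the Lebesgue measure by \<open>v\<close> and apply \<open>field_weight_shift\<close>. The function \<open>F\<close> takes values in
  \<open>[0, \<infinity>]\<close>, so that both sides are defined for every measurable \<open>F\<close>.
\<close>

theorem cameron_martin:
  fixes F :: "(nat \<Rightarrow> real) \<Rightarrow> ennreal" and u :: "nat \<Rightarrow> real"
  assumes m: "m \<noteq> 0" and F: "F \<in> borel_measurable (field_space n)"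
  defines "v \<equiv> potential m n u"
  shows "(\<integral>\<^sup>+\<phi>. ennreal (exp (\<Sum>i=1..n. u i * \<phi> i)) * F \<phi> \<partial>grand_canonical m n) =
    ennreal (exp ((\<Sum>i=1..n. u i * v i) / 2)) * (\<integral>\<^sup>+\<phi>. F (shift {0..n+1} v \<phi>) \<partial>grand_canonical m n)"
proof -
  let ?L = "Pi\<^sub>M {1..n} (\<lambda>_. lborel :: real measure)"
  let ?Z = "partition_function m n"
  let ?w = "\<lambda>\<phi>. field_weight m n (pin n \<phi>)"
  define E where "E = exp ((\<Sum>i=1..n. u i * v i) / 2)"
  have v0: "v 0 = 0" "v (n + 1) = 0" unfolding v_def by (rule potential_boundary)+
  have Z: "0 < ?Z" by (rule partition_function[OF m])
  define H where "H \<phi> = ennreal (?w \<phi> / ?Z) * F (shift {0..n+1} v (pin n \<phi>))" for \<phi>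
  have Hm: "H \<in> borel_measurable ?L"
    unfolding H_def[abs_def]
    by (intro borel_measurable_times_ennreal measurable_compose[OF _ measurable_ennreal] borel_measurable_divide field_weight_pin_measurable borel_measurable_const
        measurable_compose[OF measurable_compose[OF pin_measurable shift_field_measurable] F])
  \<comment> \<open>the potential vanishes at both ends, so translating commutes with pinning\<close>
  have unshift: "shift {0..n+1} v (pin n (shift {1..n} (\<lambda>i. - v i) \<phi>)) = pin n \<phi>" for \<phi>
  proof
    fix i
    consider "i = 0" | "i = n + 1" | "i \<in> {1..n}" | "i > n + 1" by fastforce
    then show "shift {0..n+1} v (pin n (shift {1..n} (\<lambda>i. - v i) \<phi>)) i = pin n \<phi> i"
      by cases (use v0 in \<open>simp_all add: shift_def pin_def\<close>)
  qed
  have weight: "?w (shift {1..n} (\<lambda>i. - v i) \<phi>) = ?w \<phi> * exp (\<Sum>i=1..n. u i * \<phi> i) / E" for \<phi>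
  proof -
    have "?w (shift {1..n} (\<lambda>i. - v i) \<phi>) = field_weight m n (\<lambda>i. pin n \<phi> i - v i)"
    proof (rule field_weight_cong)
      fix i assume "i \<le> n + 1"
      then consider "i = 0" | "i = n + 1" | "i \<in> {1..n}" by fastforce
      then show "pin n (shift {1..n} (\<lambda>i. - v i) \<phi>) i = pin n \<phi> i - v i"
        by cases (use v0 in \<open>simp_all add: shift_def pin_def\<close>)
    qed
    also have "\<dots> = ?w \<phi> * exp (\<Sum>i=1..n. u i * pin n \<phi> i) * exp (- (\<Sum>i=1..n. u i * v i) / 2)"
      unfolding v_def by (rule field_weight_shift[OF m pin_boundary])
    also have "(\<Sum>i=1..n. u i * pin n \<phi> i) = (\<Sum>i=1..n. u i * \<phi> i)"
      by (intro sum.cong) (auto simp: pin_def)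
    also have "exp (- (\<Sum>i=1..n. u i * v i) / 2) = 1 / E" by (simp add: E_def exp_minus inverse_eq_divide)
    finally show ?thesis by simp
  qed
  have pinsum: "(\<Sum>i=1..n. u i * pin n \<phi> i) = (\<Sum>i=1..n. u i * \<phi> i)" for \<phi>
    by (intro sum.cong) (auto simp: pin_def)
  have "(\<integral>\<^sup>+\<phi>. ennreal (exp (\<Sum>i=1..n. u i * \<phi> i)) * F \<phi> \<partial>grand_canonical m n) =
      (\<integral>\<^sup>+\<phi>. ennreal (?w \<phi> / ?Z) * (ennreal (exp (\<Sum>i=1..n. u i * pin n \<phi> i)) * F (pin n \<phi>)) \<partial>?L)"
    by (rule nn_integral_grand_canonical)
      (intro borel_measurable_times_ennreal measurable_compose[OF _ measurable_ennreal] F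
        measurable_compose[OF _ borel_measurable_exp] linear_functional_measurable)
  also have "\<dots> = (\<integral>\<^sup>+\<phi>. ennreal E * H (shift {1..n} (\<lambda>i. - v i) \<phi>) \<partial>?L)"
  proof (rule nn_integral_cong)
    fix \<phi>
    have "E * (?w (shift {1..n} (\<lambda>i. - v i) \<phi>) / ?Z) = ?w \<phi> / ?Z * exp (\<Sum>i=1..n. u i * \<phi> i)"
      unfolding weight by (simp add: E_def)
    then have "ennreal E * ennreal (?w (shift {1..n} (\<lambda>i. - v i) \<phi>) / ?Z) =
        ennreal (?w \<phi> / ?Z) * ennreal (exp (\<Sum>i=1..n. u i * \<phi> i))"
      using Z by (simp add: ennreal_mult[symmetric] E_def less_imp_le field_weight_pos)
    then show "ennreal (?w \<phi> / ?Z) * (ennreal (exp (\<Sum>i=1..n. u i * pin n \<phi> i)) * F (pin n \<phi>)) =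
        ennreal E * H (shift {1..n} (\<lambda>i. - v i) \<phi>)"
      unfolding H_def unshift pinsum by (simp only: mult.assoc[symmetric])
  qed
  also have "\<dots> = ennreal E * (\<integral>\<^sup>+\<phi>. H (shift {1..n} (\<lambda>i. - v i) \<phi>) \<partial>?L)"
    by (rule nn_integral_cmult) (rule measurable_compose[OF shift_measurable Hm], auto)
  also have "(\<integral>\<^sup>+\<phi>. H (shift {1..n} (\<lambda>i. - v i) \<phi>) \<partial>?L) = (\<integral>\<^sup>+\<phi>. H \<phi> \<partial>?L)"
    by (rule nn_integral_translation[OF _ Hm]) simp
  also have "\<dots> = (\<integral>\<^sup>+\<phi>. F (shift {0..n+1} v \<phi>) \<partial>grand_canonical m n)"
    unfolding H_def by (rule nn_integral_grand_canonical[symmetric]) (rule measurable_compose[OF shift_field_measurable F])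
  finally show ?thesis by (simp only: E_def)
qed

section \<open>Disintegration along a linear functional\<close>

definition functional_variance :: "real \<Rightarrow> nat \<Rightarrow> (nat \<Rightarrow> real) \<Rightarrow> real" where
  "functional_variance m n u = (\<Sum>i=1..n. u i * potential m n u i)"

lemma functional_variance_nonneg:
  assumes m: "m \<noteq> 0" shows "0 \<le> functional_variance m n u"
proof -
  let ?v = "potential m n u"
  have "0 \<le> (\<Sum>i=1..n+1. (?v i - ?v (i - 1))\<^sup>2)" "0 \<le> (\<Sum>i=1..n. (?v i)\<^sup>2)"
    by (rule sum_nonneg, rule zero_le_power2)+
  then show ?thesis
    unfolding functional_variance_def potential_energy[OF m]
    by (intro add_nonneg_nonneg divide_nonneg_nonneg mult_nonneg_nonneg) (assumption | simp)+
qed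

text \<open>
  Positive definiteness: the variance of the functional is the energy of the potential, which dominates
  \<open>m\<^sup>2\<close> times its squared norm, and the source is recovered from the potential.
\<close>

lemma functional_variance_eq_0:
  assumes m: "m \<noteq> 0" and 0: "functional_variance m n u = 0" and i: "i \<in> {1..n}"
  shows "u i = 0"
proof -
  let ?v = "potential m n u"
  have "0 \<le> (\<Sum>i=1..n+1. (?v i - ?v (i - 1))\<^sup>2) / 2" "0 \<le> m\<^sup>2 * (\<Sum>i=1..n. (?v i)\<^sup>2)"
    by (intro divide_nonneg_nonneg mult_nonneg_nonneg sum_nonneg zero_le_power2; simp)+
  with 0 have "m\<^sup>2 * (\<Sum>i=1..n. (?v i)\<^sup>2) = 0"
    unfolding functional_variance_def potential_energy[OF m] by linarith
  then have "(\<Sum>i=1..n. (?v i)\<^sup>2) = 0" using m by simp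
  then have *: "?v k = 0" if "k \<in> {1..n}" for k
    using that by (subst (asm) sum_nonneg_eq_0_iff) auto
  have v: "?v k = 0" if "k \<le> n + 1" for k
  proof -
    from that consider "k = 0" | "k = n + 1" | "k \<in> {1..n}" by fastforce
    then show ?thesis using potential_boundary[of m n u] * by cases auto
  qed
  have "massive_laplacian m ?v i = 0" using i v[of i] v[of "i - 1"] v[of "i + 1"] unfolding massive_laplacian_def by auto
  with potential_solves[OF m i, of u] show ?thesis by simp
qed

lemma measurable_grand_canonical_iff:
  "f \<in> grand_canonical m n \<rightarrow>\<^sub>M N \<longleftrightarrow> f \<in> field_space n \<rightarrow>\<^sub>M N"
  by (simp only: measurable_cong_sets[OF sets_grand_canonical refl])

lemma potential_scale: "potential m n (\<lambda>i. c * u i) i = c * potential m n u i"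
  by (simp add: potential_def sum_distrib_left mult_ac)

text \<open>
  Moves \<open>\<phi>\<close> along the regression direction of the functional with coefficients \<open>u\<close>, that is \<open>Cov (\<phi>, X) / Var X\<close>, until the
  functional has the value \<open>y\<close>.
\<close>

definition reset :: "real \<Rightarrow> nat \<Rightarrow> (nat \<Rightarrow> real) \<Rightarrow> real \<Rightarrow> (nat \<Rightarrow> real) \<Rightarrow> nat \<Rightarrow> real" where
  "reset m n u y \<phi> = shift {0..n+1}
     (\<lambda>i. (y - (\<Sum>i=1..n. u i * \<phi> i)) * (potential m n u i / functional_variance m n u)) \<phi>"

lemma shift_pair_measurable:
  assumes f: "f \<in> borel_measurable N" and g: "g \<in> N \<rightarrow>\<^sub>M field_space n"
  shows "(\<lambda>x. shift {0..n+1} (\<lambda>i. f x * h i) (g x)) \<in> N \<rightarrow>\<^sub>M field_space n"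
  unfolding shift_def field_space_def
proof (rule measurable_restrict)
  fix i assume "i \<in> {0..n+1}"
  then have "(\<lambda>x. g x i) \<in> borel_measurable N"
    by (intro measurable_compose[OF g field_component_measurable]) simp
  then show "(\<lambda>x. g x i + f x * h i) \<in> borel_measurable N" using f by measurable
qed

lemma reset_measurable2:
  "(\<lambda>(\<phi>, y). reset m n u y \<phi>) \<in> field_space n \<Otimes>\<^sub>M borel \<rightarrow>\<^sub>M field_space n"
proof -
  have "(\<lambda>p. shift {0..n+1} (\<lambda>i. (snd p - (\<Sum>i=1..n. u i * fst p i)) * (potential m n u i / functional_variance m n u)) (fst p))
      \<in> field_space n \<Otimes>\<^sub>M borel \<rightarrow>\<^sub>M field_space n"
    by (intro shift_pair_measurable borel_measurable_diff measurable_snd measurable_fst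
        measurable_compose[OF measurable_fst linear_functional_measurable])
  then show ?thesis by (simp add: reset_def case_prod_beta')
qed

lemma reset_measurable: "reset m n u y \<in> field_space n \<rightarrow>\<^sub>M field_space n"
  unfolding reset_def[abs_def]
  by (intro shift_pair_measurable borel_measurable_diff borel_measurable_const linear_functional_measurable measurable_ident_sets refl)

lemma reset_functional:
  assumes "functional_variance m n u \<noteq> 0"
  shows "(\<Sum>i=1..n. u i * reset m n u y \<phi> i) = y"
proof -
  let ?s = "functional_variance m n u" and ?z = "\<Sum>i=1..n. u i * \<phi> i"
  have r: "reset m n u y \<phi> i = \<phi> i + (y - ?z) / ?s * potential m n u i" if "i \<in> {1..n}" for i
    using that by (simp add: reset_def shift_def)
  have "(\<Sum>i=1..n. u i * reset m n u y \<phi> i) =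
      (\<Sum>i=1..n. u i * \<phi> i + (y - ?z) / ?s * (u i * potential m n u i))"
    by (intro sum.cong) (simp_all only: r distrib_left mult.left_commute)
  also have "\<dots> = ?z + (y - ?z) / ?s * ?s"
    by (simp only: sum.distrib sum_distrib_left[symmetric] functional_variance_def)
  finally show ?thesis using assms by simp
qed

text \<open>
  Apply the Cameron--Martin formula to the source \<open>(y / s) * u\<close>, where \<open>s\<close> is the variance of the functional \<open>X\<close>, with
  test function \<open>J\<close> times the normal density \<open>\<rho>\<close> at \<open>X\<close>. The exponentials combine to
  \<open>E (J * \<rho> (X - y)) = E (K (\<phi> + y h))\<close> with \<open>K = J * \<rho> (X)\<close>. Integrate over \<open>y\<close>: on the left \<open>\<rho>\<close> integrates to 1; on
  the right the substitution of \<open>y - X\<close> for \<open>y\<close> turns \<open>\<phi> + y h\<close> into the reset field, on which \<open>X = y\<close>.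
\<close>

theorem disintegration:
  fixes J :: "(nat \<Rightarrow> real) \<Rightarrow> ennreal" and u :: "nat \<Rightarrow> real"
  assumes m: "m \<noteq> 0" and J: "J \<in> borel_measurable (field_space n)"
    and s: "0 < functional_variance m n u"
  shows "(\<integral>\<^sup>+\<phi>. J \<phi> \<partial>grand_canonical m n) =
    (\<integral>\<^sup>+y. ennreal (normal_density 0 (sqrt (functional_variance m n u)) y) *
        (\<integral>\<^sup>+\<phi>. J (reset m n u y \<phi>) \<partial>grand_canonical m n) \<partial>lborel)"
proof -
  let ?P = "grand_canonical m n"
  define s where "s = functional_variance m n u"
  have s0: "0 < s" using s by (simp add: s_def)
  define \<rho> where "\<rho> = normal_density 0 (sqrt s)"
  have \<rho>: "\<rho> x = exp (- x\<^sup>2 / (2 * s)) / sqrt (2 * pi * s)" for x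
    using s0 by (simp add: \<rho>_def normal_density_def)
  have \<rho>_nonneg: "0 \<le> \<rho> x" for x by (simp add: \<rho>_def)
  have \<rho>_meas: "\<rho> \<in> borel_measurable borel" unfolding \<rho>_def by measurable
  have \<rho>_int: "(\<integral>\<^sup>+x. ennreal (\<rho> x) \<partial>lborel) = 1"
    using s0 by (subst nn_integral_eq_integral) (auto simp: \<rho>_def)
  define X where "X \<phi> = (\<Sum>i=1..n. u i * \<phi> i)" for \<phi>
  have Xm: "X \<in> borel_measurable (field_space n)" unfolding X_def by (rule linear_functional_measurable)
  define h where "h i = potential m n u i / s" for i
  define K where "K \<phi> = J \<phi> * ennreal (\<rho> (X \<phi>))" for \<phi>
  have Km: "K \<in> borel_measurable (field_space n)"
    unfolding K_def[abs_def]
    by (intro borel_measurable_times_ennreal J measurable_compose[OF _ measurable_ennreal]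
        measurable_compose[OF Xm \<rho>_meas])
  interpret P: prob_space ?P by (rule prob_space_grand_canonical[OF m])
  interpret pair_sigma_finite ?P "lborel :: real measure" by standard
  have tilt: "(\<integral>\<^sup>+\<phi>. J \<phi> * ennreal (\<rho> (X \<phi> - y)) \<partial>?P) = (\<integral>\<^sup>+\<phi>. K (shift {0..n+1} (\<lambda>i. y * h i) \<phi>) \<partial>?P)" for y
  proof -
    let ?u = "\<lambda>i. y / s * u i"
    have pot: "potential m n ?u = (\<lambda>i. y * h i)"
    proof
      show "potential m n ?u i = y * h i" for i unfolding potential_scale h_def by simp
    qed
    have "(\<Sum>i=1..n. ?u i * (y * h i)) = y\<^sup>2 / s\<^sup>2 * s"
      unfolding s_def functional_variance_def h_def sum_distrib_left
      by (intro sum.cong) (auto simp: power2_eq_square)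
    then have ex: "(\<Sum>i=1..n. ?u i * (y * h i)) / 2 = y\<^sup>2 / (2 * s)" using s0 by (simp add: power2_eq_square)
    have lin: "(\<Sum>i=1..n. ?u i * \<phi> i) = y * X \<phi> / s" for \<phi>
      by (simp add: X_def sum_distrib_left sum_divide_distrib mult_ac)
    have "\<rho> (X \<phi> - y) = exp (- (y\<^sup>2 / (2 * s))) * (exp (y * X \<phi> / s) * \<rho> (X \<phi>))" for \<phi>
    proof -
      have "- (X \<phi> - y)\<^sup>2 / (2 * s) = - (y\<^sup>2 / (2 * s)) + (y * X \<phi> / s + - (X \<phi>)\<^sup>2 / (2 * s))"
        using s0 by (simp add: power2_diff field_simps)
      then show ?thesis unfolding \<rho> by (simp only: exp_add times_divide_eq_right)
    qed
    then have "J \<phi> * ennreal (\<rho> (X \<phi> - y)) =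
        ennreal (exp (- (y\<^sup>2 / (2 * s)))) * (ennreal (exp (\<Sum>i=1..n. ?u i * \<phi> i)) * K \<phi>)" for \<phi>
      unfolding lin K_def using \<rho>_nonneg by (simp add: ennreal_mult mult_ac)
    then have "(\<integral>\<^sup>+\<phi>. J \<phi> * ennreal (\<rho> (X \<phi> - y)) \<partial>?P) =
        (\<integral>\<^sup>+\<phi>. ennreal (exp (- (y\<^sup>2 / (2 * s)))) * (ennreal (exp (\<Sum>i=1..n. ?u i * \<phi> i)) * K \<phi>) \<partial>?P)"
      by (simp only:)
    also have "\<dots> = ennreal (exp (- (y\<^sup>2 / (2 * s)))) * (\<integral>\<^sup>+\<phi>. ennreal (exp (\<Sum>i=1..n. ?u i * \<phi> i)) * K \<phi> \<partial>?P)"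
      by (intro nn_integral_cmult measurable_cong_sets[OF sets_grand_canonical refl, THEN equalityD2, THEN subsetD]
          borel_measurable_times_ennreal Km measurable_compose[OF _ measurable_ennreal]
          measurable_compose[OF _ borel_measurable_exp] linear_functional_measurable)
    also have "\<dots> = ennreal (exp (- (y\<^sup>2 / (2 * s)))) * (ennreal (exp (y\<^sup>2 / (2 * s))) *
        (\<integral>\<^sup>+\<phi>. K (shift {0..n+1} (\<lambda>i. y * h i) \<phi>) \<partial>?P))"
      unfolding cameron_martin[OF m Km] pot ex ..
    also have "\<dots> = (\<integral>\<^sup>+\<phi>. K (shift {0..n+1} (\<lambda>i. y * h i) \<phi>) \<partial>?P)"
      by (simp add: mult.assoc[symmetric] ennreal_mult[symmetric] exp_add[symmetric] del: mult.assoc)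
    finally show ?thesis .
  qed
  have fst_m: "fst \<in> ?P \<Otimes>\<^sub>M lborel \<rightarrow>\<^sub>M field_space n"
    using measurable_fst[of ?P lborel] by (simp add: measurable_cong_sets[OF refl sets_grand_canonical])
  have snd_m: "snd \<in> borel_measurable (?P \<Otimes>\<^sub>M lborel)"
    using measurable_snd[of ?P "lborel :: real measure"] by (simp add: measurable_cong_sets[OF refl sets_lborel])
  have m1: "(\<lambda>(\<phi>, y). J \<phi> * ennreal (\<rho> (X \<phi> - y))) \<in> borel_measurable (?P \<Otimes>\<^sub>M lborel)"
    unfolding case_prod_beta'
    by (intro borel_measurable_times_ennreal measurable_compose[OF fst_m J] measurable_compose[OF _ measurable_ennreal]
        measurable_compose[OF _ \<rho>_meas] borel_measurable_diff measurable_compose[OF fst_m Xm] snd_m)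
  have sh_m: "(\<lambda>p. shift {0..n+1} (\<lambda>i. snd p * h i) (fst p)) \<in> ?P \<Otimes>\<^sub>M lborel \<rightarrow>\<^sub>M field_space n"
    by (intro shift_pair_measurable snd_m fst_m)
  have m2: "(\<lambda>(\<phi>, y). K (shift {0..n+1} (\<lambda>i. y * h i) \<phi>)) \<in> borel_measurable (?P \<Otimes>\<^sub>M lborel)"
    unfolding case_prod_beta' by (rule measurable_compose[OF sh_m Km])
  have re_m: "(\<lambda>p. reset m n u (snd p) (fst p)) \<in> ?P \<Otimes>\<^sub>M lborel \<rightarrow>\<^sub>M field_space n"
    unfolding reset_def
    by (intro shift_pair_measurable borel_measurable_diff snd_m fst_m measurable_compose[OF fst_m linear_functional_measurable])
  have m3: "(\<lambda>(\<phi>, y). ennreal (\<rho> y) * J (reset m n u y \<phi>)) \<in> borel_measurable (?P \<Otimes>\<^sub>M lborel)"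
    unfolding case_prod_beta'
    by (intro borel_measurable_times_ennreal measurable_compose[OF re_m J] measurable_compose[OF _ measurable_ennreal]
        measurable_compose[OF snd_m \<rho>_meas])
  have "(\<integral>\<^sup>+\<phi>. J \<phi> \<partial>?P) = (\<integral>\<^sup>+\<phi>. (\<integral>\<^sup>+y. J \<phi> * ennreal (\<rho> (X \<phi> - y)) \<partial>lborel) \<partial>?P)"
  proof (rule nn_integral_cong)
    fix \<phi>
    have "(\<integral>\<^sup>+y. J \<phi> * ennreal (\<rho> (X \<phi> - y)) \<partial>lborel) = J \<phi> * (\<integral>\<^sup>+y. ennreal (\<rho> (X \<phi> - y)) \<partial>lborel)"
      by (intro nn_integral_cmult measurable_compose[OF _ measurable_ennreal] measurable_compose[OF _ \<rho>_meas]) simp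
    also have "(\<integral>\<^sup>+y. ennreal (\<rho> (X \<phi> - y)) \<partial>lborel) = (\<integral>\<^sup>+y. ennreal (\<rho> y) \<partial>lborel)"
      using nn_integral_real_affine[of "\<lambda>y. ennreal (\<rho> y)" "-1" "X \<phi>"]
        measurable_compose[OF \<rho>_meas measurable_ennreal] by simp
    finally show "J \<phi> = (\<integral>\<^sup>+y. J \<phi> * ennreal (\<rho> (X \<phi> - y)) \<partial>lborel)" by (simp add: \<rho>_int)
  qed
  also have "\<dots> = (\<integral>\<^sup>+y. (\<integral>\<^sup>+\<phi>. J \<phi> * ennreal (\<rho> (X \<phi> - y)) \<partial>?P) \<partial>lborel)"
    by (rule Fubini'[OF m1, symmetric])
  also have "\<dots> = (\<integral>\<^sup>+y. (\<integral>\<^sup>+\<phi>. K (shift {0..n+1} (\<lambda>i. y * h i) \<phi>) \<partial>?P) \<partial>lborel)"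
    by (simp only: tilt)
  also have "\<dots> = (\<integral>\<^sup>+\<phi>. (\<integral>\<^sup>+y. K (shift {0..n+1} (\<lambda>i. y * h i) \<phi>) \<partial>lborel) \<partial>?P)"
    by (rule Fubini'[OF m2])
  also have "\<dots> = (\<integral>\<^sup>+\<phi>. (\<integral>\<^sup>+y. ennreal (\<rho> y) * J (reset m n u y \<phi>) \<partial>lborel) \<partial>?P)"
  proof (rule nn_integral_cong)
    fix \<phi> assume \<phi>: "\<phi> \<in> space ?P"
    have km: "(\<lambda>y. K (shift {0..n+1} (\<lambda>i. y * h i) \<phi>)) \<in> borel_measurable borel"
      using \<phi> by (intro measurable_compose[OF _ Km] shift_pair_measurable) auto
    have "(\<integral>\<^sup>+y. K (shift {0..n+1} (\<lambda>i. y * h i) \<phi>) \<partial>lborel) =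
        (\<integral>\<^sup>+y. K (shift {0..n+1} (\<lambda>i. (- X \<phi> + 1 * y) * h i) \<phi>) \<partial>lborel)"
      using nn_integral_real_affine[OF km, of 1 "- X \<phi>"] by simp
    also have "\<dots> = (\<integral>\<^sup>+y. ennreal (\<rho> y) * J (reset m n u y \<phi>) \<partial>lborel)"
    proof (rule nn_integral_cong)
      fix y
      have "shift {0..n+1} (\<lambda>i. (- X \<phi> + 1 * y) * h i) \<phi> = reset m n u y \<phi>"
        by (simp add: reset_def X_def h_def s_def)
      moreover have "X (reset m n u y \<phi>) = y"
        unfolding X_def using s by (intro reset_functional) simp
      ultimately show "K (shift {0..n+1} (\<lambda>i. (- X \<phi> + 1 * y) * h i) \<phi>) = ennreal (\<rho> y) * J (reset m n u y \<phi>)"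
        by (simp add: K_def mult.commute)
    qed
    finally show "(\<integral>\<^sup>+y. K (shift {0..n+1} (\<lambda>i. y * h i) \<phi>) \<partial>lborel) =
        (\<integral>\<^sup>+y. ennreal (\<rho> y) * J (reset m n u y \<phi>) \<partial>lborel)" .
  qed
  also have "\<dots> = (\<integral>\<^sup>+y. (\<integral>\<^sup>+\<phi>. ennreal (\<rho> y) * J (reset m n u y \<phi>) \<partial>?P) \<partial>lborel)"
    by (rule Fubini'[OF m3, symmetric])
  also have "\<dots> = (\<integral>\<^sup>+y. ennreal (\<rho> y) * (\<integral>\<^sup>+\<phi>. J (reset m n u y \<phi>) \<partial>?P) \<partial>lborel)"
    by (intro nn_integral_cong nn_integral_cmult measurable_cong_sets[OF sets_grand_canonical refl, THEN equalityD2, THEN subsetD]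
        measurable_compose[OF reset_measurable J])
  finally show ?thesis by (simp only: \<rho>_def s_def)
qed

text \<open>
  Disintegrate a function of \<open>X\<close> alone; on the reset field \<open>X\<close> is constant.
\<close>

lemma functional_distributed:
  assumes m: "m \<noteq> 0" and s: "0 < functional_variance m n u"
  shows "distributed (grand_canonical m n) lborel (\<lambda>\<phi>. \<Sum>i=1..n. u i * \<phi> i)
    (normal_density 0 (sqrt (functional_variance m n u)))"
  unfolding distributed_def
proof (intro conjI)
  let ?P = "grand_canonical m n" and ?X = "\<lambda>\<phi>. \<Sum>i=1..n. u i * \<phi> i"
  let ?\<rho> = "normal_density 0 (sqrt (functional_variance m n u))"
  interpret P: prob_space ?P by (rule prob_space_grand_canonical[OF m])
  show Xm: "?X \<in> ?P \<rightarrow>\<^sub>M lborel"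
    unfolding measurable_grand_canonical_iff measurable_cong_sets[OF refl sets_lborel]
    by (rule linear_functional_measurable)
  show "(\<lambda>x. ennreal (?\<rho> x)) \<in> borel_measurable lborel" by measurable
  show "distr ?P lborel ?X = density lborel (\<lambda>x. ennreal (?\<rho> x))"
  proof (rule measure_eqI)
    fix A assume "A \<in> sets (distr ?P lborel ?X)"
    then have A: "A \<in> sets borel" by simp
    have iA: "(\<lambda>\<phi>. indicator A (?X \<phi>) :: ennreal) \<in> borel_measurable (field_space n)"
      using A by (intro measurable_compose[OF linear_functional_measurable]) simp
    have "emeasure (distr ?P lborel ?X) A = (\<integral>\<^sup>+x. indicator A x \<partial>distr ?P lborel ?X)"
      using A by simp
    also have "\<dots> = (\<integral>\<^sup>+\<phi>. indicator A (?X \<phi>) \<partial>?P)"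
      using A by (intro nn_integral_distr Xm) simp
    also have "\<dots> = (\<integral>\<^sup>+y. ennreal (?\<rho> y) * (\<integral>\<^sup>+\<phi>. indicator A (?X (reset m n u y \<phi>)) \<partial>?P) \<partial>lborel)"
      by (rule disintegration[OF m iA s])
    also have "\<dots> = (\<integral>\<^sup>+y. ennreal (?\<rho> y) * indicator A y \<partial>lborel)"
      by (simp only: reset_functional[OF less_imp_neq[OF s, symmetric]] nn_integral_const P.emeasure_space_1 mult_1_right)
    also have "\<dots> = emeasure (density lborel (\<lambda>x. ennreal (?\<rho> x))) A"
      using A by (subst emeasure_density) auto
    finally show "emeasure (distr ?P lborel ?X) A = emeasure (density lborel (\<lambda>x. ennreal (?\<rho> x))) A" .
  qed simp
qed

lemma grand_canonical_functional:
  fixes u :: "nat \<Rightarrow> real" and n :: nat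
  assumes m: "m \<noteq> 0"
  defines "X \<equiv> \<lambda>\<phi>. \<Sum>i=1..n. u i * \<phi> i"
  shows "gaussian_rv (grand_canonical m n) X"
    and "integral\<^sup>L (grand_canonical m n) X = 0"
    and "(\<integral>\<phi>. (X \<phi>)\<^sup>2 \<partial>grand_canonical m n) = functional_variance m n u"
proof -
  let ?P = "grand_canonical m n"
  interpret P: prob_space ?P by (rule prob_space_grand_canonical[OF m])
  have Xm: "X \<in> borel_measurable ?P"
    unfolding X_def measurable_grand_canonical_iff by (rule linear_functional_measurable)
  consider "functional_variance m n u = 0" | "0 < functional_variance m n u"
    using functional_variance_nonneg[OF m, of n u] by linarith
  then have "gaussian_rv ?P X \<and> integral\<^sup>L ?P X = 0 \<and> (\<integral>\<phi>. (X \<phi>)\<^sup>2 \<partial>?P) = functional_variance m n u"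
  proof cases
    case 1
    then have "X = (\<lambda>_. 0)"
      unfolding X_def using functional_variance_eq_0[OF m 1] by (auto intro!: sum.neutral)
    then show ?thesis using 1 by (auto simp: gaussian_rv_def)
  next
    case 2
    define \<sigma> where "\<sigma> = sqrt (functional_variance m n u)"
    have \<sigma>: "0 < \<sigma>" "\<sigma>\<^sup>2 = functional_variance m n u" using 2 by (simp_all add: \<sigma>_def)
    have D: "distributed ?P lborel X (normal_density 0 \<sigma>)"
      unfolding X_def \<sigma>_def by (rule functional_distributed[OF m 2])
    have E: "integral\<^sup>L ?P X = 0" by (rule P.normal_distributed_expectation[OF \<sigma>(1) D])
    have "(\<integral>\<phi>. (X \<phi>)\<^sup>2 \<partial>?P) = \<sigma>\<^sup>2" using P.normal_distributed_variance[OF \<sigma>(1) D] E by simp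
    moreover have "gaussian_rv ?P X"
      unfolding gaussian_rv_def using Xm D \<sigma>(1) by (intro conjI disjI2 exI[of _ 0] exI[of _ \<sigma>])
    ultimately show ?thesis using E \<sigma>(2) by simp
  qed
  then show "gaussian_rv ?P X" "integral\<^sup>L ?P X = 0" "(\<integral>\<phi>. (X \<phi>)\<^sup>2 \<partial>?P) = functional_variance m n u"
    by blast+
qed

section \<open>The canonical law\<close>

lemma restrict_continuous:
  "continuous_map euclidean (field_topology n) (\<lambda>y. restrict y {0..n+1})"
  unfolding field_topology_def continuous_map_componentwise
  by (auto simp: continuous_on_product_coordinates)

lemma field_topspace: "topspace (field_topology n) = extensional {0..n+1}"
  by (simp add: field_topology_def PiE_UNIV_domain PiE_def)

lemma field_space_eq: "space (field_space n) = extensional {0..n+1}"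
  by (simp add: field_space_def space_PiM PiE_def)

text \<open>
  The field topology lives on extensional functions. Inclusion and \<open>restrict_continuous\<close> connect it with the type
  \<open>nat \<Rightarrow> real\<close>, which is a metric space.
\<close>

lemma inclusion_continuous: "continuous_map (field_topology n) euclidean (\<lambda>\<phi>. \<phi>)"
proof -
  have "continuous_map (field_topology n) (product_topology (\<lambda>_. euclideanreal) UNIV) (\<lambda>\<phi>. \<phi>)"
    unfolding continuous_map_componentwise_UNIV
  proof
    fix i
    show "continuous_map (field_topology n) euclideanreal (\<lambda>\<phi>. \<phi> i)"
    proof (cases "i \<in> {0..n+1}")
      case True
      then show ?thesis unfolding field_topology_def by (rule continuous_map_product_projection)
    next
      case False
      have "continuous_map (field_topology n) euclideanreal (\<lambda>_. undefined)" by simp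
      then show ?thesis
        by (rule continuous_map_eq) (use False in \<open>auto simp: field_topspace extensional_def\<close>)
    qed
  qed
  then show ?thesis by (simp add: euclidean_product_topology)
qed

lemma inclusion_measurable: "(\<lambda>\<phi>. \<phi>) \<in> field_space n \<rightarrow>\<^sub>M (borel :: (nat \<Rightarrow> real) measure)"
proof (rule measurable_coordinatewise_then_product)
  fix i
  show "(\<lambda>\<phi>. \<phi> i) \<in> borel_measurable (field_space n)"
  proof (cases "i \<in> {0..n+1}")
    case True
    then show ?thesis by (intro field_component_measurable) simp
  next
    case False
    have "(\<lambda>_. undefined) \<in> borel_measurable (field_space n)" by simp
    then show ?thesis
      by (rule measurable_cong[THEN iffD1, rotated]) (use False in \<open>auto simp: field_space_eq extensional_def\<close>)
  qed
qed

lemma restrict_measurable: "(\<lambda>y. restrict y {0..n+1}) \<in> (borel :: (nat \<Rightarrow> real) measure) \<rightarrow>\<^sub>M field_space n"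
  unfolding field_space_def
  by (rule measurable_restrict) (auto intro!: borel_measurable_continuous_onI continuous_on_product_coordinates)

lemma field_continuous_measurable:
  assumes f: "continuous_map (field_topology n) euclideanreal f"
  shows "f \<in> borel_measurable (field_space n)"
proof -
  have "continuous_on UNIV (\<lambda>y. f (restrict y {0..n+1}))"
    using continuous_map_compose[OF restrict_continuous f] by (simp add: comp_def)
  then have "(\<lambda>y. f (restrict y {0..n+1})) \<in> borel_measurable borel" by (rule borel_measurable_continuous_onI)
  from measurable_compose[OF inclusion_measurable this]
  have "(\<lambda>\<phi>. f (restrict \<phi> {0..n+1})) \<in> borel_measurable (field_space n)" .
  then show ?thesis
    by (rule measurable_cong[THEN iffD1, rotated]) (simp add: field_space_eq extensional_restrict)
qed

text \<open>
  Closed sets generate the Borel sets and are stable under intersection; the indicator of a closed set is the limit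
  of \<open>max 0 (1 - k * infdist x C)\<close>.
\<close>

lemma metric_measure_eqI:
  fixes M N :: "'a::metric_space measure"
  assumes M: "prob_space M" "sets M = sets borel" and N: "prob_space N" "sets N = sets borel"
    and eq: "\<And>f. continuous_on UNIV f \<Longrightarrow> (\<And>x. 0 \<le> f x) \<Longrightarrow> (\<And>x. f x \<le> (1::real)) \<Longrightarrow> integral\<^sup>L M f = integral\<^sup>L N f"
  shows "M = N"
proof (rule measure_eqI_generator_eq[where E="Collect closed" and \<Omega>=UNIV and A="\<lambda>_. UNIV"])
  show "Int_stable (Collect closed :: 'a set set)" by (auto simp: Int_stable_def)
  show "sets M = sigma_sets UNIV (Collect closed)" "sets N = sigma_sets UNIV (Collect closed)"
    unfolding M(2) N(2) borel_eq_closed by simp_all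
  interpret M: prob_space M by fact
  interpret N: prob_space N by fact
  show "emeasure M UNIV \<noteq> \<infinity>" by simp
  fix C :: "'a set" assume "C \<in> Collect closed"
  then have C: "closed C" by simp
  show "emeasure M C = emeasure N C"
  proof (cases "C = {}")
    case False
    define g where "g k x = max 0 (1 - real k * infdist x C)" for k x
    have gc: "continuous_on UNIV (g k)" for k unfolding g_def by (intro continuous_intros)
    have g01: "0 \<le> g k x" "g k x \<le> 1" for k x by (auto simp: g_def infdist_nonneg)
    have glim: "(\<lambda>k. g k x) \<longlonglongrightarrow> indicator C x" for x
    proof (cases "x \<in> C")
      case True
      then show ?thesis by (simp add: g_def)
    next
      case False
      then have d: "0 < infdist x C"
        using C \<open>C \<noteq> {}\<close> in_closed_iff_infdist_zero[OF C \<open>C \<noteq> {}\<close>, of x] infdist_nonneg[of x C] by linarith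
      obtain k0 :: nat where k0: "1 / infdist x C < real k0" using reals_Archimedean2 by blast
      have "g k x = 0" if "k0 \<le> k" for k
      proof -
        have "1 < real k0 * infdist x C" using k0 d by (simp add: divide_less_eq)
        also have "\<dots> \<le> real k * infdist x C" using that d by (intro mult_right_mono) auto
        finally show ?thesis by (simp add: g_def)
      qed
      then have "(\<lambda>k. g k x) \<longlonglongrightarrow> 0" by (intro tendsto_eventually) (auto simp: eventually_sequentially)
      with False show ?thesis by simp
    qed
    have lim: "(\<lambda>k. integral\<^sup>L K (g k)) \<longlonglongrightarrow> measure K C" if "prob_space K" "sets K = sets borel" for K
    proof -
      interpret K: prob_space K by fact
      have gm: "g k \<in> borel_measurable K" for k
        using borel_measurable_continuous_onI[OF gc] by (simp add: measurable_cong_sets[OF that(2) refl])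
      have cs: "C \<in> sets K" using C that(2) by simp
      have "(\<lambda>k. integral\<^sup>L K (g k)) \<longlonglongrightarrow> integral\<^sup>L K (indicator C)"
        by (rule integral_dominated_convergence[where w="\<lambda>_. 1"]) (use gm cs glim g01 in auto)
      then show ?thesis using cs sets_eq_imp_space_eq[OF that(2)] by (simp add: Int_absorb2)
    qed
    have "measure M C = measure N C"
      using LIMSEQ_unique[OF lim[OF M] lim[OF N, folded eq[OF gc g01]]] by simp
    then show ?thesis by (simp add: M.emeasure_eq_measure N.emeasure_eq_measure)
  qed simp
qed auto

lemma field_measure_eqI:
  assumes M: "prob_space M" "sets M = sets (field_space n)" and N: "prob_space N" "sets N = sets (field_space n)"
    and eq: "\<And>f. continuous_map (field_topology n) euclideanreal f \<Longrightarrow> (\<And>x. 0 \<le> f x) \<Longrightarrow> (\<And>x. f x \<le> 1)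
        \<Longrightarrow> integral\<^sup>L M f = integral\<^sup>L N f"
  shows "M = N"
proof -
  have inc: "(\<lambda>\<phi>. \<phi>) \<in> K \<rightarrow>\<^sub>M (borel :: (nat \<Rightarrow> real) measure)" if "sets K = sets (field_space n)" for K
    using inclusion_measurable by (simp add: measurable_cong_sets[OF that refl])
  have "distr M borel (\<lambda>\<phi>. \<phi>) = distr N borel (\<lambda>\<phi>. \<phi>)"
  proof (rule metric_measure_eqI)
    show "prob_space (distr M borel (\<lambda>\<phi>. \<phi>))" "prob_space (distr N borel (\<lambda>\<phi>. \<phi>))"
      using prob_space.prob_space_distr[OF M(1) inc[OF M(2)]] prob_space.prob_space_distr[OF N(1) inc[OF N(2)]] by auto
    fix f :: "(nat \<Rightarrow> real) \<Rightarrow> real"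
    assume f: "continuous_on UNIV f" "\<And>x. 0 \<le> f x" "\<And>x. f x \<le> 1"
    have fm: "f \<in> borel_measurable borel" using f(1) by (rule borel_measurable_continuous_onI)
    have "continuous_map (field_topology n) euclideanreal f"
      using continuous_map_compose[OF inclusion_continuous, of euclideanreal f n] f(1) by (simp add: comp_def)
    from eq[OF this f(2,3)]
    show "integral\<^sup>L (distr M borel (\<lambda>\<phi>. \<phi>)) f = integral\<^sup>L (distr N borel (\<lambda>\<phi>. \<phi>)) f"
      by (simp add: integral_distr[OF inc[OF M(2)] fm] integral_distr[OF inc[OF N(2)] fm])
  qed simp_all
  moreover have "emeasure K A = emeasure (distr K borel (\<lambda>\<phi>. \<phi>)) ((\<lambda>y. restrict y {0..n+1}) -` A)"
    if K: "sets K = sets (field_space n)" and A: "A \<in> sets (field_space n)" for K A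
  proof -
    have sp: "space K = extensional {0..n+1}" using sets_eq_imp_space_eq[OF K] by (simp add: field_space_eq)
    have "(\<lambda>y. restrict y {0..n+1}) -` A \<inter> space K = A"
      using sets.sets_into_space[OF A] sp by (auto simp: extensional_restrict field_space_eq)
    then show ?thesis
      using measurable_sets[OF restrict_measurable A] by (subst emeasure_distr[OF inc[OF K]]) auto
  qed
  ultimately show ?thesis using M(2) N(2) by (intro measure_eqI) auto
qed

lemma continuous_AE_lborel_eq:
  fixes U U' :: "real \<Rightarrow> real"
  assumes U: "\<And>y. (U \<longlongrightarrow> U y) (at y)" "\<And>y. (U' \<longlongrightarrow> U' y) (at y)"
    and ae: "AE y in lborel. U y = U' y"
  shows "U x = U' x"
proof (rule ccontr)
  assume ne: "U x \<noteq> U' x"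
  have "isCont (\<lambda>y. U y - U' y) x" unfolding isCont_def by (intro tendsto_diff U)
  then have "\<forall>\<^sub>F y in at x. U y - U' y \<noteq> 0"
    using ne unfolding isCont_def by (intro tendsto_imp_eventually_ne) auto
  then obtain d where d: "0 < d" "\<And>y. y \<noteq> x \<Longrightarrow> dist y x < d \<Longrightarrow> U y - U' y \<noteq> 0"
    unfolding eventually_at by auto
  have "U y \<noteq> U' y" if "y \<in> {x - d<..<x + d}" for y
    using d(2)[of y] ne that by (cases "y = x") (auto simp: dist_real_def abs_less_iff)
  with ae have "AE y in lborel. y \<notin> {x - d<..<x + d}" by (auto elim!: eventually_mono)
  then have "{x - d<..<x + d} \<in> null_sets lborel" by (subst AE_iff_null_sets) auto
  then have "emeasure lborel {x - d<..<x + d} = 0" by (simp add: null_sets_def)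
  with d(1) show False by simp
qed

text \<open>
  The defining identity of a regular conditional law concerns sets only. It says that two measures
  coincide, one of them a bind of the kernel; integrating \<open>f\<close> against both extends it to functions.
\<close>

lemma regular_cond_law_integral:
  assumes P: "prob_space P" and X: "X \<in> borel_measurable P" and \<kappa>: "regular_cond_law P X \<kappa>"
    and f: "f \<in> borel_measurable P" and B: "B \<in> sets borel"
  shows "(\<integral>\<^sup>+y. (\<integral>\<^sup>+\<omega>. f \<omega> \<partial>\<kappa> y) * indicator B y \<partial>distr P borel X) = (\<integral>\<^sup>+\<omega>. f \<omega> * indicator B (X \<omega>) \<partial>P)"
proof -
  let ?D = "distr P borel X"
  interpret prob_space P by fact
  have ks: "\<kappa> \<in> borel \<rightarrow>\<^sub>M subprob_algebra P"
    using \<kappa> by (auto simp: regular_cond_law_def intro: measurable_prob_algebraD)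
  let ?DB = "density ?D (indicator B)" and ?PB = "density P (\<lambda>\<omega>. indicator B (X \<omega>))"
  have ks': "\<kappa> \<in> ?DB \<rightarrow>\<^sub>M subprob_algebra P" using ks by simp
  have iB: "(\<lambda>\<omega>. indicator B (X \<omega>) :: ennreal) \<in> borel_measurable P"
    using B by (intro measurable_compose[OF X]) simp
  have iB': "(indicator B :: real \<Rightarrow> ennreal) \<in> borel_measurable ?D" using B by simp
  have sk: "sets (\<kappa> y) = sets P" for y using subprob_measurableD(2)[OF ks, of y] by simp
  have "?DB \<bind> \<kappa> = ?PB"
  proof (rule measure_eqI)
    show "sets (?DB \<bind> \<kappa>) = sets ?PB" by (subst sets_bind[of _ _ P]) (auto simp: sk)
    fix A assume "A \<in> sets (?DB \<bind> \<kappa>)"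
    then have A: "A \<in> sets P" by (subst (asm) sets_bind[of _ _ P]) (auto simp: sk)
    have em: "(\<lambda>y. emeasure (\<kappa> y) A) \<in> borel_measurable ?D"
      using measurable_compose[OF ks measurable_emeasure_subprob_algebra[OF A]] by simp
    have "emeasure (?DB \<bind> \<kappa>) A = (\<integral>\<^sup>+y. emeasure (\<kappa> y) A \<partial>?DB)"
      by (rule emeasure_bind[OF _ ks' A]) simp
    also have "\<dots> = (\<integral>\<^sup>+y\<in>B. emeasure (\<kappa> y) A \<partial>?D)"
      by (subst nn_integral_density[OF iB' em]) (simp add: mult.commute)
    also have "\<dots> = emeasure P (A \<inter> X -` B)"
      using \<kappa> A B by (simp add: regular_cond_law_def)
    also have "\<dots> = (\<integral>\<^sup>+\<omega>. indicator (A \<inter> X -` B) \<omega> \<partial>P)"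
    proof (rule nn_integral_indicator[symmetric])
      have "A \<inter> X -` B = A \<inter> (X -` B \<inter> space P)" using sets.sets_into_space[OF A] by auto
      then show "A \<inter> X -` B \<in> sets P" using A measurable_sets[OF X B] by auto
    qed
    also have "\<dots> = emeasure ?PB A"
      by (subst emeasure_density[OF iB A]) (auto intro!: nn_integral_cong simp: indicator_def)
    finally show "emeasure (?DB \<bind> \<kappa>) A = emeasure ?PB A" .
  qed
  then have eq: "(\<integral>\<^sup>+\<omega>. f \<omega> \<partial>(?DB \<bind> \<kappa>)) = (\<integral>\<^sup>+\<omega>. f \<omega> \<partial>?PB)" by simp
  have um: "(\<lambda>y. \<integral>\<^sup>+\<omega>. f \<omega> \<partial>\<kappa> y) \<in> borel_measurable ?D"
    using measurable_compose[OF ks nn_integral_measurable_subprob_algebra[OF f]] by simp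
  have "(\<integral>\<^sup>+y. (\<integral>\<^sup>+\<omega>. f \<omega> \<partial>\<kappa> y) * indicator B y \<partial>?D) = (\<integral>\<^sup>+y. (\<integral>\<^sup>+\<omega>. f \<omega> \<partial>\<kappa> y) \<partial>?DB)"
    by (subst nn_integral_density[OF iB' um]) (simp add: mult.commute)
  also have "\<dots> = (\<integral>\<^sup>+\<omega>. f \<omega> \<partial>(?DB \<bind> \<kappa>))" by (rule nn_integral_bind[OF f ks', symmetric])
  also have "\<dots> = (\<integral>\<^sup>+\<omega>. f \<omega> * indicator B (X \<omega>) \<partial>P)"
    unfolding eq by (subst nn_integral_density[OF iB f]) (simp add: mult.commute)
  finally show ?thesis .
qed

text \<open>
  For a fixed bounded continuous \<open>f\<close>, both kernels give the same integral of \<open>f\<close> for almost every \<open>y\<close> under the law of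
  \<open>X\<close>, hence for Lebesgue-almost every \<open>y\<close> because the normal density is positive. Both integrals are
  continuous in \<open>y\<close>, so they agree everywhere.
\<close>

lemma cond_law_unique:
  assumes P: "prob_space P" "sets P = sets (field_space n)" and X: "X \<in> borel_measurable P"
    and D: "distr P borel X = density lborel (\<lambda>x. ennreal (normal_density 0 \<sigma> x))" and \<sigma>: "0 < \<sigma>"
    and \<kappa>: "regular_cond_law P X \<kappa>" "\<And>y. weak_converges (field_topology n) \<kappa> (\<kappa> y) (at y)"
    and \<kappa>': "regular_cond_law P X \<kappa>'" "\<And>y. weak_converges (field_topology n) \<kappa>' (\<kappa>' y) (at y)"
  shows "\<kappa> x = \<kappa>' x"
proof (rule field_measure_eqI)
  have kp: "prob_space (\<kappa> y)" "prob_space (\<kappa>' y)" for y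
    using \<kappa>(2) \<kappa>'(2) by (auto simp: weak_converges_def)
  have sk: "sets (\<kappa> y) = sets P" "sets (\<kappa>' y) = sets P" for y
    using \<kappa>(1) \<kappa>'(1) measurable_space[of \<kappa> borel "prob_algebra P" y] measurable_space[of \<kappa>' borel "prob_algebra P" y]
    by (auto simp: regular_cond_law_def space_prob_algebra)
  show "prob_space (\<kappa> x)" "prob_space (\<kappa>' x)" by (rule kp)+
  show "sets (\<kappa> x) = sets (field_space n)" "sets (\<kappa>' x) = sets (field_space n)" using sk P(2) by auto
  fix f :: "(nat \<Rightarrow> real) \<Rightarrow> real"
  assume f: "continuous_map (field_topology n) euclideanreal f" "\<And>x. 0 \<le> f x" "\<And>x. f x \<le> 1"
  have fm: "f \<in> borel_measurable P"
    using field_continuous_measurable[OF f(1)] by (simp add: measurable_cong_sets[OF P(2) refl])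
  have fm': "(\<lambda>\<omega>. ennreal (f \<omega>)) \<in> borel_measurable P" using fm by measurable
  interpret P: prob_space P by fact
  interpret D: prob_space "distr P borel X" using X by (rule P.prob_space_distr)
  have bd: "bounded (f ` topspace (field_topology n))"
    using f(2,3) by (intro boundedI[where B=1]) auto
  define U U' where "U y = integral\<^sup>L (\<kappa> y) f" and "U' y = integral\<^sup>L (\<kappa>' y) f" for y
  have nn: "(\<integral>\<^sup>+\<omega>. ennreal (f \<omega>) \<partial>\<kappa> y) = ennreal (U y)" "(\<integral>\<^sup>+\<omega>. ennreal (f \<omega>) \<partial>\<kappa>' y) = ennreal (U' y)" for y
  proof -
    have "integrable K f" if "prob_space K" "sets K = sets P" for K
    proof -
      interpret K: prob_space K by fact
      show ?thesis
        using fm f(2,3) by (intro K.integrable_const_bound[where B=1]) (auto simp: measurable_cong_sets[OF that(2) refl])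
    qed
    then show "(\<integral>\<^sup>+\<omega>. ennreal (f \<omega>) \<partial>\<kappa> y) = ennreal (U y)" "(\<integral>\<^sup>+\<omega>. ennreal (f \<omega>) \<partial>\<kappa>' y) = ennreal (U' y)"
      unfolding U_def U'_def using kp sk f(2) by (auto intro!: nn_integral_eq_integral)
  qed
  have U0: "0 \<le> U y" "0 \<le> U' y" for y using f(2) by (auto simp: U_def U'_def)
  have ks: "\<kappa> \<in> borel \<rightarrow>\<^sub>M subprob_algebra P" "\<kappa>' \<in> borel \<rightarrow>\<^sub>M subprob_algebra P"
    using \<kappa>(1) \<kappa>'(1) by (auto simp: regular_cond_law_def intro: measurable_prob_algebraD)
  have um: "(\<lambda>y. ennreal (U y)) \<in> borel_measurable (distr P borel X)"
    "(\<lambda>y. ennreal (U' y)) \<in> borel_measurable (distr P borel X)"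
    using measurable_compose[OF ks(1) nn_integral_measurable_subprob_algebra[OF fm']]
      measurable_compose[OF ks(2) nn_integral_measurable_subprob_algebra[OF fm']] by (simp_all add: nn)
  have "AE y in distr P borel X. ennreal (U y) = ennreal (U' y)"
  proof (rule D.density_unique_finite_measure[OF um])
    fix A assume "A \<in> sets (distr P borel X)"
    then have A: "A \<in> sets borel" by simp
    show "(\<integral>\<^sup>+y. ennreal (U y) * indicator A y \<partial>distr P borel X) = (\<integral>\<^sup>+y. ennreal (U' y) * indicator A y \<partial>distr P borel X)"
      using regular_cond_law_integral[OF P(1) X \<kappa>(1) fm' A] regular_cond_law_integral[OF P(1) X \<kappa>'(1) fm' A]
      by (simp add: nn)
  qed auto
  then have "AE y in distr P borel X. U y = U' y" using U0 by simp
  then have ae: "AE y in lborel. U y = U' y"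
    unfolding D using \<sigma> by (subst (asm) AE_density) (auto simp: normal_density_pos)
  show "integral\<^sup>L (\<kappa> x) f = integral\<^sup>L (\<kappa>' x) f"
    using continuous_AE_lborel_eq[OF _ _ ae, of x] \<kappa>(2) \<kappa>'(2) f(1) bd
    unfolding weak_converges_def U_def U'_def by blast
qed

definition reset_sum :: "real \<Rightarrow> nat \<Rightarrow> real \<Rightarrow> (nat \<Rightarrow> real) \<Rightarrow> nat \<Rightarrow> real" where
  "reset_sum m n = reset m n (\<lambda>_. 1)"

lemma functional_variance_one: "functional_variance m n (\<lambda>_. 1) = total_variance m n"
  by (simp add: functional_variance_def total_variance_def response_def)

lemma total_variance_pos:
  assumes "m \<noteq> 0" "1 \<le> n" shows "0 < total_variance m n"
proof -
  have "0 < (real n)\<^sup>2 / (1 + m\<^sup>2 * real n)" using assms by (intro divide_pos_pos add_pos_nonneg) auto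
  with total_variance_lower[OF assms] show ?thesis by linarith
qed

lemma sum_distributed:
  assumes m: "m \<noteq> 0" and n: "1 \<le> n"
  shows "distr (grand_canonical m n) borel (\<lambda>\<phi>. \<Sum>i=1..n. \<phi> i) =
    density lborel (\<lambda>x. ennreal (normal_density 0 (sqrt (total_variance m n)) x))"
proof -
  let ?P = "grand_canonical m n" and ?X = "\<lambda>\<phi>. \<Sum>i=1..n. \<phi> i" and ?s = "total_variance m n"
  have s: "0 < ?s" by (rule total_variance_pos[OF m n])
  show "distr ?P borel ?X = density lborel (\<lambda>x. ennreal (normal_density 0 (sqrt ?s) x))"
  proof -
    have "distributed ?P lborel ?X (normal_density 0 (sqrt ?s))"
      using functional_distributed[OF m, of n "\<lambda>_. 1"] s by (simp add: functional_variance_one)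
    then have "distr ?P lborel ?X = density lborel (\<lambda>x. ennreal (normal_density 0 (sqrt ?s) x))"
      by (rule distributed_distr_eq_density)
    moreover have "distr ?P borel ?X = distr ?P lborel ?X" by (rule distr_cong) auto
    ultimately show ?thesis by simp
  qed
qed

text \<open>
  This is \<open>disintegration\<close> for the indicator of \<open>A\<close> times the indicator of \<open>X \<in> B\<close>; the latter becomes the constant
  \<open>y \<in> B\<close> on the reset field.
\<close>

lemma reset_sum_regular_cond_law:
  assumes m: "m \<noteq> 0" and n: "1 \<le> n"
  shows "regular_cond_law (grand_canonical m n) (\<lambda>\<phi>. \<Sum>i=1..n. \<phi> i)
    (\<lambda>y. distr (grand_canonical m n) (field_space n) (reset_sum m n y))"
proof -
  let ?P = "grand_canonical m n" and ?X = "\<lambda>\<phi>. \<Sum>i=1..n. \<phi> i" and ?T = "field_topology n"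
  let ?s = "total_variance m n"
  interpret P: prob_space ?P by (rule prob_space_grand_canonical[OF m])
  have s: "0 < ?s" by (rule total_variance_pos[OF m n])
  define \<kappa> where "\<kappa> y = distr ?P (field_space n) (reset_sum m n y)" for y
  have Xm: "?X \<in> borel_measurable (field_space n)"
    using linear_functional_measurable[of "\<lambda>_. 1" n] by simp
  have XP: "?X \<in> borel_measurable ?P" unfolding measurable_grand_canonical_iff by (rule Xm)
  have Xr: "?X (reset_sum m n y \<phi>) = y" for y \<phi>
    using reset_functional[where u="\<lambda>_. 1" and m=m and n=n and y=y and \<phi>=\<phi>] s by (simp add: reset_sum_def functional_variance_one)
  have rm: "reset_sum m n y \<in> ?P \<rightarrow>\<^sub>M field_space n" for y
    unfolding measurable_grand_canonical_iff reset_sum_def by (rule reset_measurable)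
  note D = sum_distributed[OF m n]
  have km: "\<kappa> \<in> borel \<rightarrow>\<^sub>M prob_algebra ?P"
  proof -
    have "(\<lambda>(y, \<phi>). reset_sum m n y \<phi>) \<in> borel \<Otimes>\<^sub>M field_space n \<rightarrow>\<^sub>M field_space n"
      using measurable_compose[OF measurable_pair_swap' reset_measurable2[where m=m and n=n and u="\<lambda>_. 1"]]
      by (simp add: reset_sum_def case_prod_beta')
    then have "(\<lambda>(y, \<phi>). reset_sum m n y \<phi>) \<in> borel \<Otimes>\<^sub>M ?P \<rightarrow>\<^sub>M ?P"
      by (subst measurable_cong_sets[OF sets_pair_measure_cong[OF refl sets_grand_canonical] sets_grand_canonical])
    moreover have "(\<lambda>_::real. ?P) \<in> borel \<rightarrow>\<^sub>M prob_algebra ?P"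
      by (intro measurable_const) (simp add: space_prob_algebra P.prob_space_axioms)
    ultimately have "(\<lambda>y. distr ?P ?P (reset_sum m n y)) \<in> borel \<rightarrow>\<^sub>M prob_algebra ?P"
      by (intro measurable_distr_prob_space2)
    moreover have "distr ?P ?P (reset_sum m n y) = \<kappa> y" for y
      unfolding \<kappa>_def by (rule distr_cong) auto
    ultimately show "\<kappa> \<in> borel \<rightarrow>\<^sub>M prob_algebra ?P" by simp
  qed
  have "regular_cond_law ?P ?X \<kappa>"
    unfolding regular_cond_law_def
  proof (intro conjI ballI)
    show "\<kappa> \<in> borel \<rightarrow>\<^sub>M prob_algebra ?P" by (rule km)
  next
    fix A B assume A: "A \<in> sets ?P" and B: "B \<in> sets (borel :: real measure)"
    have A': "A \<in> sets (field_space n)" using A by simp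
    have AB: "A \<inter> ?X -` B \<in> sets (field_space n)"
    proof -
      have "A \<inter> ?X -` B = A \<inter> (?X -` B \<inter> space (field_space n))" using sets.sets_into_space[OF A'] by auto
      then show ?thesis using A' measurable_sets[OF Xm B] by auto
    qed
    define J where "J \<phi> = (indicator A \<phi> * indicator B (?X \<phi>) :: ennreal)" for \<phi>
    have Jm: "J \<in> borel_measurable (field_space n)"
      unfolding J_def[abs_def] using A' B
      by (intro borel_measurable_times_ennreal measurable_compose[OF Xm] borel_measurable_indicator) auto
    have "emeasure ?P (A \<inter> ?X -` B) = (\<integral>\<^sup>+\<phi>. indicator (A \<inter> ?X -` B) \<phi> \<partial>?P)"
      using AB by (intro nn_integral_indicator[symmetric]) simp
    also have "indicator (A \<inter> ?X -` B) = J" by (auto simp: J_def indicator_def)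
    finally have "emeasure ?P (A \<inter> ?X -` B) = (\<integral>\<^sup>+\<phi>. J \<phi> \<partial>?P)" .
    also have "\<dots> = (\<integral>\<^sup>+y. ennreal (normal_density 0 (sqrt ?s) y) * (\<integral>\<^sup>+\<phi>. J (reset_sum m n y \<phi>) \<partial>?P) \<partial>lborel)"
      using disintegration[OF m Jm, of "\<lambda>_. 1"] s by (simp add: functional_variance_one reset_sum_def)
    also have "\<dots> = (\<integral>\<^sup>+y. ennreal (normal_density 0 (sqrt ?s) y) * (emeasure (\<kappa> y) A * indicator B y) \<partial>lborel)"
    proof (rule nn_integral_cong)
      fix y
      have "(\<integral>\<^sup>+\<phi>. J (reset_sum m n y \<phi>) \<partial>?P) = (\<integral>\<^sup>+\<phi>. indicator A (reset_sum m n y \<phi>) * indicator B y \<partial>?P)"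
        unfolding J_def Xr ..
      also have "\<dots> = (\<integral>\<^sup>+\<phi>. indicator A (reset_sum m n y \<phi>) \<partial>?P) * indicator B y"
        using A' by (intro nn_integral_multc measurable_compose[OF rm] borel_measurable_indicator)
      also have "(\<integral>\<^sup>+\<phi>. indicator A (reset_sum m n y \<phi>) \<partial>?P) = (\<integral>\<^sup>+\<phi>. indicator A \<phi> \<partial>\<kappa> y)"
        unfolding \<kappa>_def using A' by (intro nn_integral_distr[symmetric] rm) simp
      also have "\<dots> = emeasure (\<kappa> y) A" using A' by (intro nn_integral_indicator) (simp add: \<kappa>_def)
      finally show "ennreal (normal_density 0 (sqrt ?s) y) * (\<integral>\<^sup>+\<phi>. J (reset_sum m n y \<phi>) \<partial>?P) =
          ennreal (normal_density 0 (sqrt ?s) y) * (emeasure (\<kappa> y) A * indicator B y)" by simp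
    qed
    also have "\<dots> = (\<integral>\<^sup>+y. emeasure (\<kappa> y) A * indicator B y \<partial>distr ?P borel ?X)"
    proof -
      have "(\<lambda>y. emeasure (\<kappa> y) A) \<in> borel_measurable borel"
        by (rule measurable_compose[OF measurable_prob_algebraD[OF km] measurable_emeasure_subprob_algebra[OF A]])
      then have em: "(\<lambda>y. emeasure (\<kappa> y) A * indicator B y) \<in> borel_measurable lborel"
        using B by (simp add: measurable_cong_sets[OF sets_lborel refl])
      have dm: "(\<lambda>x. ennreal (normal_density 0 (sqrt ?s) x)) \<in> borel_measurable lborel" by measurable
      show ?thesis unfolding D by (rule nn_integral_density[OF dm em, symmetric])
    qed
    finally show "emeasure ?P (A \<inter> ?X -` B) = (\<integral>\<^sup>+y\<in>B. emeasure (\<kappa> y) A \<partial>distr ?P borel ?X)" .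
  qed
  then show ?thesis by (simp only: \<kappa>_def[abs_def])
qed

text \<open>
  For each field the reset field depends continuously on \<open>y\<close>, so dominated convergence applies.
\<close>

lemma reset_sum_weakly_continuous:
  assumes m: "m \<noteq> 0" and n: "1 \<le> n"
  shows "weak_converges (field_topology n)
    (\<lambda>y. distr (grand_canonical m n) (field_space n) (reset_sum m n y))
    (distr (grand_canonical m n) (field_space n) (reset_sum m n y)) (at y)"
proof -
  let ?P = "grand_canonical m n" and ?X = "\<lambda>\<phi>. \<Sum>i=1..n. \<phi> i" and ?T = "field_topology n"
  let ?s = "total_variance m n"
  interpret P: prob_space ?P by (rule prob_space_grand_canonical[OF m])
  have s: "0 < ?s" by (rule total_variance_pos[OF m n])
  define \<kappa> where "\<kappa> y = distr ?P (field_space n) (reset_sum m n y)" for y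
  have Xm: "?X \<in> borel_measurable (field_space n)"
    using linear_functional_measurable[of "\<lambda>_. 1" n] by simp
  have XP: "?X \<in> borel_measurable ?P" unfolding measurable_grand_canonical_iff by (rule Xm)
  have Xr: "?X (reset_sum m n y \<phi>) = y" for y \<phi>
    using reset_functional[where u="\<lambda>_. 1" and m=m and n=n and y=y and \<phi>=\<phi>] s by (simp add: reset_sum_def functional_variance_one)
  have rm: "reset_sum m n y \<in> ?P \<rightarrow>\<^sub>M field_space n" for y
    unfolding measurable_grand_canonical_iff reset_sum_def by (rule reset_measurable)
  have "weak_converges ?T \<kappa> (\<kappa> y) (at y)" for y
    unfolding weak_converges_def
  proof (intro conjI allI impI)
    have kp: "prob_space (\<kappa> z)" for z unfolding \<kappa>_def by (rule P.prob_space_distr[OF rm])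
    then show "\<forall>\<^sub>F z in at y. prob_space (\<kappa> z)" "prob_space (\<kappa> y)" by auto
    fix f assume "continuous_map ?T euclideanreal f \<and> bounded (f ` topspace ?T)"
    then have f: "continuous_map ?T euclideanreal f" and "bounded (f ` topspace ?T)" by auto
    then obtain B where B: "\<And>\<phi>. \<phi> \<in> topspace ?T \<Longrightarrow> \<bar>f \<phi>\<bar> \<le> B" unfolding bounded_iff by auto
    have fm: "f \<in> borel_measurable (field_space n)" by (rule field_continuous_measurable[OF f])
    have rt: "reset_sum m n z \<phi> \<in> topspace ?T" for z \<phi>
      by (simp add: field_topspace reset_sum_def reset_def shift_def)
    have int: "integral\<^sup>L (\<kappa> z) f = (\<integral>\<phi>. f (reset_sum m n z \<phi>) \<partial>?P)" for z
      unfolding \<kappa>_def by (rule integral_distr[OF rm fm])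
    have cont_f: "isCont (\<lambda>z. f (reset_sum m n z \<phi>)) z" for \<phi> z
    proof -
      have "continuous_map euclideanreal ?T (\<lambda>z. reset_sum m n z \<phi>)"
        unfolding field_topology_def continuous_map_componentwise
      proof (intro conjI ballI)
        show "(\<lambda>z. reset_sum m n z \<phi>) ` topspace euclideanreal \<subseteq> extensional {0..n+1}"
          by (auto simp: reset_sum_def reset_def shift_def)
        fix k assume k: "k \<in> {0..n+1}"
        have "(\<lambda>z. reset_sum m n z \<phi> k) = (\<lambda>z. \<phi> k + (z - (\<Sum>i=1..n. 1 * \<phi> i)) *
            (potential m n (\<lambda>_. 1) k / functional_variance m n (\<lambda>_. 1)))"
          unfolding reset_sum_def reset_def shift_def using k by (intro ext) (simp only: restrict_apply if_True)
        moreover have "continuous_on UNIV (\<lambda>z. \<phi> k + (z - c) * w)" for c w :: real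
          by (intro continuous_intros)
        ultimately show "continuous_map euclideanreal euclideanreal (\<lambda>z. reset_sum m n z \<phi> k)"
          unfolding continuous_map_iff_continuous2 by (simp only:)
      qed
      from continuous_map_compose[OF this f] have "continuous_on UNIV (\<lambda>z. f (reset_sum m n z \<phi>))"
        unfolding continuous_map_iff_continuous2 comp_def .
      then show ?thesis by (rule continuous_on_interior) simp
    qed
    show "((\<lambda>z. integral\<^sup>L (\<kappa> z) f) \<longlongrightarrow> integral\<^sup>L (\<kappa> y) f) (at y)"
      unfolding int tendsto_at_iff_sequentially
    proof (intro allI impI)
      fix z :: "nat \<Rightarrow> real" assume "z \<longlonglongrightarrow> y"
      show "((\<lambda>z. \<integral>\<phi>. f (reset_sum m n z \<phi>) \<partial>?P) \<circ> z) \<longlonglongrightarrow> (\<integral>\<phi>. f (reset_sum m n y \<phi>) \<partial>?P)"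
        unfolding comp_def
      proof (rule integral_dominated_convergence[where w="\<lambda>_. B"])
        show "AE \<phi> in ?P. (\<lambda>k. f (reset_sum m n (z k) \<phi>)) \<longlonglongrightarrow> f (reset_sum m n y \<phi>)"
          by (rule AE_I2) (rule isCont_tendsto_compose[OF cont_f \<open>z \<longlonglongrightarrow> y\<close>])
        show "AE \<phi> in ?P. norm (f (reset_sum m n (z k) \<phi>)) \<le> B" for k
          by (rule AE_I2) (simp only: real_norm_def B[OF rt])
        show "(\<lambda>\<phi>. f (reset_sum m n w \<phi>)) \<in> borel_measurable ?P" for w
          by (rule measurable_compose[OF rm fm])
        then show "(\<lambda>\<phi>. f (reset_sum m n (z k) \<phi>)) \<in> borel_measurable ?P" for k .
      qed simp
    qed
  qed
  then show ?thesis by (simp only: \<kappa>_def[abs_def])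
qed

theorem canonical_eq:
  assumes m: "m \<noteq> 0" and n: "1 \<le> n"
  shows "canonical m n = distr (grand_canonical m n) (field_space n) (reset_sum m n 0)"
proof -
  let ?P = "grand_canonical m n" and ?X = "\<lambda>\<phi>. \<Sum>i=1..n. \<phi> i" and ?T = "field_topology n"
  let ?s = "total_variance m n"
  interpret P: prob_space ?P by (rule prob_space_grand_canonical[OF m])
  have s: "0 < ?s" by (rule total_variance_pos[OF m n])
  define \<kappa> where "\<kappa> y = distr ?P (field_space n) (reset_sum m n y)" for y
  have Xm: "?X \<in> borel_measurable (field_space n)"
    using linear_functional_measurable[of "\<lambda>_. 1" n] by simp
  have XP: "?X \<in> borel_measurable ?P" unfolding measurable_grand_canonical_iff by (rule Xm)
  have Xr: "?X (reset_sum m n y \<phi>) = y" for y \<phi>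
    using reset_functional[where u="\<lambda>_. 1" and m=m and n=n and y=y and \<phi>=\<phi>] s by (simp add: reset_sum_def functional_variance_one)
  have rm: "reset_sum m n y \<in> ?P \<rightarrow>\<^sub>M field_space n" for y
    unfolding measurable_grand_canonical_iff reset_sum_def by (rule reset_measurable)
  note D = sum_distributed[OF m n]
  have cond: "regular_cond_law ?P ?X \<kappa>"
    unfolding \<kappa>_def[abs_def] by (rule reset_sum_regular_cond_law[OF m n])
  have cont: "weak_converges ?T \<kappa> (\<kappa> y) (at y)" for y
    unfolding \<kappa>_def[abs_def] by (rule reset_sum_weakly_continuous[OF m n])
  have "canonical m n = \<kappa> 0"
    unfolding canonical_def cond_law_def
  proof (rule the_equality)
    show "\<exists>\<kappa>'. regular_cond_law ?P ?X \<kappa>' \<and> (\<forall>y. weak_converges ?T \<kappa>' (\<kappa>' y) (at y)) \<and> \<kappa> 0 = \<kappa>' 0"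
      by (intro exI[of _ \<kappa>] conjI allI cond cont refl)
    fix Q assume "\<exists>\<kappa>'. regular_cond_law ?P ?X \<kappa>' \<and> (\<forall>y. weak_converges ?T \<kappa>' (\<kappa>' y) (at y)) \<and> Q = \<kappa>' 0"
    then obtain \<kappa>' where k': "regular_cond_law ?P ?X \<kappa>'" "\<forall>y. weak_converges ?T \<kappa>' (\<kappa>' y) (at y)" "Q = \<kappa>' 0"
      by (elim exE conjE)
    show "Q = \<kappa> 0"
      unfolding k'(3)
    proof (rule cond_law_unique[OF P.prob_space_axioms sets_grand_canonical XP D])
      show "0 < sqrt ?s" using s by simp
      show "weak_converges ?T \<kappa>' (\<kappa>' y) (at y)" for y using k'(2) by (rule spec)
    qed (rule k'(1) cond cont)+
  qed
  then show ?thesis by (simp add: \<kappa>_def)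
qed

section \<open>The lattice field as a Gaussian process\<close>

lemma gaussian_rv_cong_AE:
  assumes "AE \<omega> in M. X \<omega> = X' \<omega>" and X': "X' \<in> borel_measurable M" and X: "gaussian_rv M X"
  shows "gaussian_rv M X'"
proof -
  have Xm: "X \<in> borel_measurable M" using X by (simp add: gaussian_rv_def)
  have d: "distr M lborel X = distr M lborel X'"
    by (rule distr_cong_AE) (use assms Xm in auto)
  from X consider c where "AE \<omega> in M. X \<omega> = c"
    | \<mu> \<sigma> where "0 < \<sigma>" "distributed M lborel X (normal_density \<mu> \<sigma>)"
    unfolding gaussian_rv_def by blast
  then show ?thesis
  proof cases
    case (1 c)
    then have "AE \<omega> in M. X' \<omega> = c" using assms(1) by eventually_elim simp
    with X' show ?thesis unfolding gaussian_rv_def by (intro conjI disjI1 exI[of _ c])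
  next
    case (2 \<mu> \<sigma>)
    then have "distributed M lborel X' (normal_density \<mu> \<sigma>)"
      using X' d unfolding distributed_def by simp
    with X' 2(1) show ?thesis unfolding gaussian_rv_def by (intro conjI disjI2 exI[of _ \<mu>] exI[of _ \<sigma>])
  qed
qed

lemma gaussian_rv_distr:
  assumes T: "T \<in> M \<rightarrow>\<^sub>M N" and X: "X \<in> borel_measurable N" and g: "gaussian_rv M (\<lambda>\<omega>. X (T \<omega>))"
  shows "gaussian_rv (distr M N T) X"
proof -
  have X': "X \<in> borel_measurable (distr M N T)" using X by simp
  from g consider c where "AE \<omega> in M. X (T \<omega>) = c"
    | \<mu> \<sigma> where "0 < \<sigma>" "distributed M lborel (\<lambda>\<omega>. X (T \<omega>)) (normal_density \<mu> \<sigma>)"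
    unfolding gaussian_rv_def by blast
  then show ?thesis
  proof cases
    case (1 c)
    have "{x \<in> space N. X x = c} \<in> sets N" using X by simp
    then have "AE x in distr M N T. X x = c" using 1 by (subst AE_distr_iff[OF T]) auto
    with X' show ?thesis unfolding gaussian_rv_def by (intro conjI disjI1 exI[of _ c])
  next
    case (2 \<mu> \<sigma>)
    have "distr (distr M N T) lborel X = distr M lborel (X \<circ> T)"
      by (rule distr_distr) (use X T in auto)
    then have "distributed (distr M N T) lborel X (normal_density \<mu> \<sigma>)"
      using 2(2) X unfolding distributed_def by (simp add: comp_def)
    with X' 2(1) show ?thesis unfolding gaussian_rv_def by (intro conjI disjI2 exI[of _ \<mu>] exI[of _ \<sigma>])
  qed
qed

lemma centered_gaussian_distr:
  assumes T: "T \<in> M \<rightarrow>\<^sub>M N" and Z: "\<And>t. Z t \<in> borel_measurable N"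
    and g: "centered_gaussian M (\<lambda>t \<omega>. Z t (T \<omega>))"
  shows "centered_gaussian (distr M N T) Z"
  unfolding centered_gaussian_def gaussian_process_def
proof (intro conjI allI impI)
  show "prob_space (distr M N T)"
    by (rule prob_space.prob_space_distr[OF centered_gaussian_prob_space[OF g] T])
  show "gaussian_rv (distr M N T) (\<lambda>\<omega>. \<Sum>t\<in>S. c t * Z t \<omega>)" if "finite S" for S c
  proof (rule gaussian_rv_distr[OF T])
    show "(\<lambda>\<omega>. \<Sum>t\<in>S. c t * Z t \<omega>) \<in> borel_measurable N"
      by (intro borel_measurable_sum borel_measurable_times borel_measurable_const Z)
    show "gaussian_rv M (\<lambda>\<omega>. \<Sum>t\<in>S. c t * Z t (T \<omega>))"
      by (rule centered_gaussian_combination(1)[OF g that])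
  qed
  show "integral\<^sup>L (distr M N T) (Z t) = 0" for t
    using centered_gaussian_mean[OF g, of t] by (simp add: integral_distr[OF T Z])
qed

lemma field_at_measurable: "(\<lambda>\<phi>. field_at n \<phi> k) \<in> borel_measurable (field_space n)"
proof (cases "k \<in> {0..int n + 1}")
  case True
  then have "nat k \<le> n + 1" by auto
  with True show ?thesis using field_component_measurable[of "nat k" n] by (simp add: field_at_def)
next
  case False
  then have "(\<lambda>\<phi>. field_at n \<phi> k) = (\<lambda>_. 0)" by (auto simp: field_at_def)
  then show ?thesis by simp
qed

lemma grand_canonical_boundary:
  assumes m: "m \<noteq> 0"
  shows "AE \<phi> in grand_canonical m n. \<phi> 0 = 0 \<and> \<phi> (n + 1) = 0"
proof -
  let ?L = "density (Pi\<^sub>M {1..n} (\<lambda>_. lborel)) (\<lambda>\<phi>. ennreal (field_weight m n (pin n \<phi>) / partition_function m n))"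
  have pm: "pin n \<in> ?L \<rightarrow>\<^sub>M field_space n" using pin_measurable by simp
  have gc: "grand_canonical m n = distr ?L (field_space n) (pin n)"
    by (simp add: grand_canonical_def Let_def partition_function_def)
  have "{\<phi> \<in> space (field_space n). \<phi> 0 = 0 \<and> \<phi> (n + 1) = 0} \<in> sets (field_space n)"
    using field_component_measurable[of 0 n] field_component_measurable[of "n + 1" n] by measurable
  then show ?thesis
    unfolding gc by (subst AE_distr_iff[OF pm]) (auto simp: pin_boundary[simplified] pin_def)
qed

text \<open>
  Sites outside the lattice are moved to the nearest pinned end. There the Green function vanishes,
  as the covariance of the field beyond its ends must, and the map is 1-Lipschitz, so
  increment bounds survive.
\<close>

definition lattice_index :: "nat \<Rightarrow> int \<Rightarrow> nat" where
  "lattice_index n k = nat (max 0 (min (int n + 1) k))"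

lemma lattice_index: "lattice_index n k \<le> n + 1" "\<bar>real (lattice_index n k) - real (lattice_index n l)\<bar> \<le> \<bar>of_int k - of_int l\<bar>"
  by (auto simp: lattice_index_def)

definition point_source :: "int \<Rightarrow> nat \<Rightarrow> real" where
  "point_source k i = (if int i = k then 1 else 0)"

lemma sum_point_source:
  assumes "f 0 = 0" "f (n + 1) = 0"
  shows "(\<Sum>i=1..n. point_source k i * f i) = f (lattice_index n k)"
proof (cases "0 < k \<and> k < int n + 1")
  case True
  define j where "j = nat k"
  have j: "k = int j" "j \<in> {1..n}" using True by (auto simp: j_def)
  have "(\<Sum>i=1..n. point_source k i * f i) = (\<Sum>i=1..n. if i = j then f i else 0)"
    by (intro sum.cong) (auto simp: point_source_def j)
  also have "\<dots> = f j" using j(2) by simp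
  also have "j = lattice_index n k" using True by (simp add: lattice_index_def j_def)
  finally show ?thesis .
next
  case False
  then have "point_source k i * f i = 0" if "i \<in> {1..n}" for i
    using that by (auto simp: point_source_def)
  then have "(\<Sum>i=1..n. point_source k i * f i) = 0" by (intro sum.neutral) blast
  moreover have "lattice_index n k = 0 \<or> lattice_index n k = n + 1"
    using False unfolding lattice_index_def by linarith
  ultimately show ?thesis using assms by auto
qed

definition lattice_covariance :: "real \<Rightarrow> nat \<Rightarrow> int \<Rightarrow> int \<Rightarrow> real" where
  "lattice_covariance m n k l = green m n (lattice_index n k) (lattice_index n l)"

lemma lattice_covariance_sym: "lattice_covariance m n k l = lattice_covariance m n l k"
  unfolding lattice_covariance_def by (rule green_sym)

lemma potential_point_source:
  assumes i: "i \<le> n + 1"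
  shows "potential m n (point_source k) i = green m n i (lattice_index n k)"
proof -
  have "potential m n (point_source k) i = (\<Sum>j=1..n. point_source k j * green m n i j)"
    unfolding potential_def by (intro sum.cong) (auto simp: mult.commute)
  also have "\<dots> = green m n i (lattice_index n k)"
    by (rule sum_point_source) (simp_all only: green_sym[of m n i] green_boundary[OF i])
  finally show ?thesis .
qed

lemma functional_variance_two_points:
  "functional_variance m n (\<lambda>i. a * point_source k i + b * point_source l i) =
    a\<^sup>2 * lattice_covariance m n k k + 2 * a * b * lattice_covariance m n k l + b\<^sup>2 * lattice_covariance m n l l"
proof -
  define E where "E p q = (\<Sum>i=1..n. point_source p i * potential m n (point_source q) i)" for p q
  have E: "E p q = lattice_covariance m n p q" for p q
    unfolding E_def lattice_covariance_def sum_point_source[OF potential_boundary]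
    by (rule potential_point_source[OF lattice_index(1)])
  have lin: "potential m n (\<lambda>i. a * point_source k i + b * point_source l i) i =
      a * potential m n (point_source k) i + b * potential m n (point_source l) i" for i
    unfolding potential_def sum_distrib_left sum.distrib[symmetric]
    by (intro sum.cong) (auto simp: algebra_simps)
  have "functional_variance m n (\<lambda>i. a * point_source k i + b * point_source l i) =
      a\<^sup>2 * E k k + a * b * E k l + a * b * E l k + b\<^sup>2 * E l l"
    unfolding functional_variance_def lin E_def sum_distrib_left sum.distrib[symmetric]
    by (intro sum.cong) (auto simp: power2_eq_square algebra_simps)
  then show ?thesis unfolding E using lattice_covariance_sym[of m n l k] by simp
qed

text \<open>
  The pinned end points carry the value 0 only almost surely, since the law lives on all
  functions on \<open>{0..n+1}\<close>.
\<close>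

lemma field_combination_AE:
  assumes m: "m \<noteq> 0" and S: "finite S"
  shows "AE \<phi> in grand_canonical m n.
    (\<Sum>i=1..n. (\<Sum>k\<in>S. c k * point_source k i) * \<phi> i) = (\<Sum>k\<in>S. c k * field_at n \<phi> k)"
  using grand_canonical_boundary[OF m]
proof eventually_elim
  case (elim \<phi>)
  define f where "f i = (if i \<in> {1..n} then \<phi> i else 0)" for i
  have "field_at n \<phi> k = f (lattice_index n k)" for k
  proof -
    consider "k < 0" | "k > int n + 1" | "k = 0" | "k = int n + 1" | "0 < k" "k < int n + 1" by linarith
    then show ?thesis
    proof cases
      case 5
      then have "lattice_index n k = nat k" "nat k \<in> {1..n}" by (auto simp: lattice_index_def)
      with 5 show ?thesis by (simp add: f_def field_at_def)
    qed (use elim in \<open>simp_all add: f_def field_at_def lattice_index_def nat_add_distrib\<close>)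
  qed
  moreover have "f (lattice_index n k) = (\<Sum>i=1..n. point_source k i * f i)" for k
    by (rule sum_point_source[symmetric]) (simp_all add: f_def)
  moreover have "(\<Sum>i=1..n. point_source k i * f i) = (\<Sum>i=1..n. point_source k i * \<phi> i)" for k
    by (intro sum.cong) (auto simp: f_def)
  ultimately have F: "field_at n \<phi> k = (\<Sum>i=1..n. point_source k i * \<phi> i)" for k by simp
  have "(\<Sum>k\<in>S. c k * field_at n \<phi> k) = (\<Sum>k\<in>S. \<Sum>i=1..n. c k * point_source k i * \<phi> i)"
    unfolding F sum_distrib_left by (simp only: mult.assoc)
  also have "\<dots> = (\<Sum>i=1..n. \<Sum>k\<in>S. c k * point_source k i * \<phi> i)" by (rule sum.swap)
  finally show ?case by (simp only: sum_distrib_right)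
qed

lemma field_combination:
  assumes m: "m \<noteq> 0" and S: "finite S"
  shows "gaussian_rv (grand_canonical m n) (\<lambda>\<phi>. \<Sum>k\<in>S. c k * field_at n \<phi> k)"
    and "(\<integral>\<phi>. (\<Sum>k\<in>S. c k * field_at n \<phi> k) \<partial>grand_canonical m n) = 0"
    and "(\<integral>\<phi>. (\<Sum>k\<in>S. c k * field_at n \<phi> k)\<^sup>2 \<partial>grand_canonical m n) =
      functional_variance m n (\<lambda>i. \<Sum>k\<in>S. c k * point_source k i)"
proof -
  let ?P = "grand_canonical m n" and ?u = "\<lambda>i. \<Sum>k\<in>S. c k * point_source k i"
  note ae = field_combination_AE[OF m S, where n=n and c=c]
  have lm: "(\<lambda>\<phi>. \<Sum>i=1..n. ?u i * \<phi> i) \<in> borel_measurable ?P"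
    unfolding measurable_grand_canonical_iff by (rule linear_functional_measurable)
  have sm: "(\<lambda>\<phi>. \<Sum>k\<in>S. c k * field_at n \<phi> k) \<in> borel_measurable ?P"
    unfolding measurable_grand_canonical_iff
    by (intro borel_measurable_sum borel_measurable_times borel_measurable_const field_at_measurable)
  show "gaussian_rv ?P (\<lambda>\<phi>. \<Sum>k\<in>S. c k * field_at n \<phi> k)"
    by (rule gaussian_rv_cong_AE[OF ae sm grand_canonical_functional(1)[OF m]])
  have "(\<integral>\<phi>. (\<Sum>k\<in>S. c k * field_at n \<phi> k) \<partial>?P) = (\<integral>\<phi>. (\<Sum>i=1..n. ?u i * \<phi> i) \<partial>?P)"
    by (rule integral_cong_AE[OF sm lm]) (use ae in eventually_elim, simp)
  then show "(\<integral>\<phi>. (\<Sum>k\<in>S. c k * field_at n \<phi> k) \<partial>?P) = 0"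
    by (simp only: grand_canonical_functional(2)[OF m])
  have "(\<integral>\<phi>. (\<Sum>k\<in>S. c k * field_at n \<phi> k)\<^sup>2 \<partial>?P) = (\<integral>\<phi>. (\<Sum>i=1..n. ?u i * \<phi> i)\<^sup>2 \<partial>?P)"
    by (rule integral_cong_AE[OF borel_measurable_power[OF sm] borel_measurable_power[OF lm]])
      (use ae in eventually_elim, simp)
  then show "(\<integral>\<phi>. (\<Sum>k\<in>S. c k * field_at n \<phi> k)\<^sup>2 \<partial>?P) = functional_variance m n ?u"
    by (simp only: grand_canonical_functional(3)[OF m])
qed

lemma centered_gaussian_grand_canonical:
  assumes m: "m \<noteq> 0"
  shows "centered_gaussian (grand_canonical m n) (\<lambda>k \<phi>. field_at n \<phi> k)"
  unfolding centered_gaussian_def gaussian_process_def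
proof (intro conjI allI impI)
  show "prob_space (grand_canonical m n)" by (rule prob_space_grand_canonical[OF m])
  show "gaussian_rv (grand_canonical m n) (\<lambda>\<phi>. \<Sum>k\<in>S. c k * field_at n \<phi> k)" if "finite S" for S c
    by (rule field_combination(1)[OF m that])
  show "(\<integral>\<phi>. field_at n \<phi> k \<partial>grand_canonical m n) = 0" for k
    using field_combination(2)[OF m, where S="{k}" and c="\<lambda>_. 1" and n=n] by simp
qed

text \<open>
  Polarisation of the variances of linear functionals.
\<close>

lemma grand_canonical_covariance:
  assumes m: "m \<noteq> 0"
  shows "(\<integral>\<phi>. field_at n \<phi> k * field_at n \<phi> l \<partial>grand_canonical m n) = lattice_covariance m n k l"
proof -
  let ?P = "grand_canonical m n"
  note G = centered_gaussian_grand_canonical[OF m, of n]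
  have diag: "(\<integral>\<phi>. field_at n \<phi> j * field_at n \<phi> j \<partial>?P) = lattice_covariance m n j j" for j
  proof -
    have "(\<lambda>i. \<Sum>k\<in>{j}. 1 * point_source k i) = (\<lambda>i. 1 * point_source j i + 0 * point_source j i)" by auto
    then have "(\<integral>\<phi>. (\<Sum>k\<in>{j}. 1 * field_at n \<phi> k)\<^sup>2 \<partial>?P) = lattice_covariance m n j j"
      using field_combination(3)[OF m, where S="{j}" and c="\<lambda>_. 1" and n=n] functional_variance_two_points[of m n 1 j 0 j] by simp
    then show ?thesis by (simp add: power2_eq_square)
  qed
  show ?thesis
  proof (cases "k = l")
    case True
    with diag show ?thesis by simp
  next
    case False
    have "(\<lambda>i. \<Sum>j\<in>{k, l}. 1 * point_source j i) = (\<lambda>i. 1 * point_source k i + 1 * point_source l i)"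
      using False by auto
    then have "(\<integral>\<phi>. (\<Sum>j\<in>{k, l}. 1 * field_at n \<phi> j)\<^sup>2 \<partial>?P) =
        lattice_covariance m n k k + 2 * lattice_covariance m n k l + lattice_covariance m n l l"
      using field_combination(3)[OF m, where S="{k, l}" and c="\<lambda>_. 1" and n=n] functional_variance_two_points[of m n 1 k 1 l] by simp
    moreover have "(\<integral>\<phi>. (\<Sum>j\<in>{k, l}. 1 * field_at n \<phi> j)\<^sup>2 \<partial>?P) =
        lattice_covariance m n k k + 2 * (\<integral>\<phi>. field_at n \<phi> k * field_at n \<phi> l \<partial>?P) + lattice_covariance m n l l"
    proof -
      have "(\<integral>\<phi>. field_at n \<phi> l * field_at n \<phi> k \<partial>?P) = (\<integral>\<phi>. field_at n \<phi> k * field_at n \<phi> l \<partial>?P)"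
        by (simp only: mult.commute)
      then show ?thesis unfolding second_moment_combination[OF G] using False diag by simp
    qed
    ultimately show ?thesis by simp
  qed
qed

section \<open>The rescaled field\<close>

lemma lattice_covariance_increment:
  assumes m: "m \<noteq> 0"
  shows "lattice_covariance m n k k + lattice_covariance m n l l - 2 * lattice_covariance m n k l \<le> 2 * \<bar>of_int k - of_int l\<bar>"
proof -
  have "lattice_covariance m n k k + lattice_covariance m n l l - 2 * lattice_covariance m n k l
      \<le> 2 * \<bar>real (lattice_index n k) - real (lattice_index n l)\<bar>"
    unfolding lattice_covariance_def by (rule green_increment[OF m lattice_index(1) lattice_index(1)])
  also have "\<dots> \<le> 2 * \<bar>of_int k - of_int l\<bar>"
    by (intro mult_left_mono lattice_index(2)) simp
  finally show ?thesis .
qed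

lemma field_at_reset_sum:
  "field_at n (reset_sum m n 0 \<phi>) k =
    field_at n \<phi> k - response m n (lattice_index n k) / total_variance m n * (\<Sum>i=1..n. field_at n \<phi> (int i))"
proof -
  have sum: "(\<Sum>i=1..n. field_at n \<phi> (int i)) = (\<Sum>i=1..n. \<phi> i)"
    by (intro sum.cong) (auto simp: field_at_def)
  show ?thesis
  proof (cases "k \<in> {0..int n + 1}")
    case True
    then have "lattice_index n k = nat k" "nat k \<in> {0..n+1}" by (auto simp: lattice_index_def)
    with True show ?thesis
      unfolding sum by (simp add: field_at_def reset_sum_def reset_def shift_def functional_variance_one response_def)
  next
    case False
    then have "lattice_index n k = 0 \<or> lattice_index n k = n + 1" unfolding lattice_index_def by auto
    then have "response m n (lattice_index n k) = 0" unfolding response_def using potential_boundary by metis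
    moreover have "field_at n \<psi> k = 0" for \<psi> unfolding field_at_def by (simp only: if_not_P[OF False])
    ultimately show ?thesis by simp
  qed
qed

text \<open>
  Covers both settings: \<open>c = 0\<close> is the grand canonical law, and for the inverse of the total variance the rank-one term
  is the loss of covariance caused by conditioning on the sum.
\<close>

definition pinned_field_law :: "real \<Rightarrow> nat \<Rightarrow> real \<Rightarrow> (nat \<Rightarrow> real) measure \<Rightarrow> bool" where
  "pinned_field_law m n c \<mu> \<longleftrightarrow> centered_gaussian \<mu> (\<lambda>k \<phi>. field_at n \<phi> k) \<and>
    (\<forall>k l. (\<integral>\<phi>. field_at n \<phi> k * field_at n \<phi> l \<partial>\<mu>) = lattice_covariance m n k l
      - c * (response m n (lattice_index n k) * response m n (lattice_index n l)))"

lemma pinned_field_law_grand_canonical: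
  "m \<noteq> 0 \<Longrightarrow> pinned_field_law m n 0 (grand_canonical m n)"
  using centered_gaussian_grand_canonical grand_canonical_covariance by (simp add: pinned_field_law_def)

text \<open>
  Under the canonical law the field is the grand canonical one minus its regression on the sum, which
  is again a linear image of a Gaussian process.
\<close>

lemma pinned_field_law_canonical:
  assumes m: "m \<noteq> 0" and n: "1 \<le> n"
  shows "pinned_field_law m n (1 / total_variance m n) (canonical m n)"
proof -
  let ?P = "grand_canonical m n"
  define s where "s = total_variance m n"
  have s: "0 < s" unfolding s_def by (rule total_variance_pos[OF m n])
  define r where "r k = response m n (lattice_index n k)" for k
  let ?\<Phi> = "\<lambda>k \<phi>. field_at n \<phi> k"
  define X where "X \<phi> = (\<Sum>i=1..n. field_at n \<phi> (int i))" for \<phi>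
  define \<Psi> where "\<Psi> k \<phi> = field_at n (reset_sum m n 0 \<phi>) k" for k \<phi>
  note G = centered_gaussian_grand_canonical[OF m, of n]
  have T: "reset_sum m n 0 \<in> ?P \<rightarrow>\<^sub>M field_space n"
    unfolding measurable_grand_canonical_iff reset_sum_def by (rule reset_measurable)
  have \<Psi>: "\<Psi> k \<phi> = ?\<Phi> k \<phi> - r k / s * X \<phi>" for k \<phi>
    unfolding \<Psi>_def X_def r_def s_def by (rule field_at_reset_sum)
  have \<Psi>G: "centered_gaussian ?P \<Psi>"
  proof (rule centered_gaussian_linear_image[OF G])
    let ?I = "\<lambda>k. insert k (int ` {1..n})"
    let ?w = "\<lambda>k j. (if j = k then 1 else 0) - (if j \<in> int ` {1..n} then r k / s else 0)"
    show "finite (?I k)" for k by simp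
    show "\<Psi> k \<phi> = (\<Sum>j\<in>?I k. ?w k j * ?\<Phi> j \<phi>)" for k \<phi>
    proof -
      have "(\<Sum>j\<in>?I k. (if j = k then 1 else 0) * ?\<Phi> j \<phi>) = (\<Sum>j\<in>?I k. if j = k then ?\<Phi> j \<phi> else 0)"
        by (intro sum.cong) auto
      also have "\<dots> = ?\<Phi> k \<phi>" by simp
      finally have 1: "(\<Sum>j\<in>?I k. (if j = k then 1 else 0) * ?\<Phi> j \<phi>) = ?\<Phi> k \<phi>" .
      have "(\<Sum>j\<in>?I k. (if j \<in> int ` {1..n} then r k / s else 0) * ?\<Phi> j \<phi>) = (\<Sum>j\<in>int ` {1..n}. r k / s * ?\<Phi> j \<phi>)"
        by (intro sum.mono_neutral_cong_right) auto
      also have "\<dots> = (\<Sum>i=1..n. r k / s * ?\<Phi> (int i) \<phi>)" by (subst sum.reindex) auto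
      also have "\<dots> = r k / s * X \<phi>" by (simp only: X_def sum_distrib_left)
      finally show ?thesis using 1 by (simp only: \<Psi> left_diff_distrib sum_subtractf)
    qed
  qed
  note cov = grand_canonical_covariance[OF m, of n]
  note im = centered_gaussian_integrable_mult[OF G]
  have EX: "(\<integral>\<phi>. ?\<Phi> k \<phi> * X \<phi> \<partial>?P) = r k" for k
  proof -
    have "(\<integral>\<phi>. ?\<Phi> k \<phi> * X \<phi> \<partial>?P) = (\<Sum>i=1..n. \<integral>\<phi>. ?\<Phi> k \<phi> * ?\<Phi> (int i) \<phi> \<partial>?P)"
      unfolding X_def sum_distrib_left by (rule Bochner_Integration.integral_sum) (rule im)
    also have "\<dots> = (\<Sum>i=1..n. green m n (lattice_index n k) i)"
      unfolding cov lattice_covariance_def by (intro sum.cong) (auto simp: lattice_index_def)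
    finally show ?thesis by (simp add: r_def response_def potential_def)
  qed
  have iX: "integrable ?P (\<lambda>\<phi>. ?\<Phi> k \<phi> * X \<phi>)" for k
    unfolding X_def sum_distrib_left by (intro Bochner_Integration.integrable_sum im)
  have iXX: "integrable ?P (\<lambda>\<phi>. X \<phi> * X \<phi>)"
    unfolding X_def[of _] sum_distrib_right by (fold X_def) (intro Bochner_Integration.integrable_sum iX)
  have EXX: "(\<integral>\<phi>. X \<phi> * X \<phi> \<partial>?P) = s"
  proof -
    have "(\<integral>\<phi>. X \<phi> * X \<phi> \<partial>?P) = (\<integral>\<phi>. (\<Sum>i=1..n. ?\<Phi> (int i) \<phi> * X \<phi>) \<partial>?P)"
      by (simp only: sum_distrib_right[symmetric] X_def)
    also have "\<dots> = (\<Sum>i=1..n. r (int i))"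
      by (subst Bochner_Integration.integral_sum) (simp_all only: iX EX)
    also have "\<dots> = s"
      unfolding r_def s_def total_variance_def by (intro sum.cong) (auto simp: lattice_index_def)
    finally show ?thesis .
  qed
  have \<Psi>cov: "(\<integral>\<phi>. \<Psi> k \<phi> * \<Psi> l \<phi> \<partial>?P) = lattice_covariance m n k l - 1 / s * (r k * r l)" for k l
  proof -
    have eq: "\<Psi> k \<phi> * \<Psi> l \<phi> = ?\<Phi> k \<phi> * ?\<Phi> l \<phi> - r l / s * (?\<Phi> k \<phi> * X \<phi>) - r k / s * (?\<Phi> l \<phi> * X \<phi>)
        + r k / s * (r l / s) * (X \<phi> * X \<phi>)" for \<phi>
      unfolding \<Psi> by (simp add: algebra_simps)
    have "(\<integral>\<phi>. \<Psi> k \<phi> * \<Psi> l \<phi> \<partial>?P) =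
        lattice_covariance m n k l - r l / s * r k - r k / s * r l + r k / s * (r l / s) * s"
      unfolding eq using im[of k l] iX[of k] iX[of l] iXX
      by (simp only: Bochner_Integration.integral_add Bochner_Integration.integral_diff
          Bochner_Integration.integrable_diff integrable_mult_right integral_mult_right_zero cov EX EXX)
    moreover have "r k / s * (r l / s) * s = r k * r l / s" using s by simp
    ultimately show ?thesis by (simp add: mult.commute)
  qed
  show ?thesis
    unfolding pinned_field_law_def canonical_eq[OF m n]
  proof (intro conjI allI)
    show "centered_gaussian (distr ?P (field_space n) (reset_sum m n 0)) ?\<Phi>"
      by (rule centered_gaussian_distr[OF T field_at_measurable]) (use \<Psi>G in \<open>simp only: \<Psi>_def[abs_def]\<close>)
    fix k l
    have "(\<integral>\<phi>. ?\<Phi> k \<phi> * ?\<Phi> l \<phi> \<partial>distr ?P (field_space n) (reset_sum m n 0)) = (\<integral>\<phi>. \<Psi> k \<phi> * \<Psi> l \<phi> \<partial>?P)"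
      unfolding \<Psi>_def by (rule integral_distr[OF T]) (intro borel_measurable_times field_at_measurable)
    then show "(\<integral>\<phi>. ?\<Phi> k \<phi> * ?\<Phi> l \<phi> \<partial>distr ?P (field_space n) (reset_sum m n 0)) =
        lattice_covariance m n k l - 1 / total_variance m n * (response m n (lattice_index n k) * response m n (lattice_index n l))"
      unfolding \<Psi>cov r_def s_def .
  qed
qed

text \<open>
  The rank-one term lowers the variance of an increment by \<open>c * (r k - r l)\<^sup>2\<close>, \<open>r\<close> being the response.
\<close>

lemma pinned_field_law_increment:
  assumes m: "m \<noteq> 0" and c: "0 \<le> c" and \<mu>: "pinned_field_law m n c \<mu>"
  shows "(\<integral>\<phi>. (field_at n \<phi> k - field_at n \<phi> l)\<^sup>2 \<partial>\<mu>) \<le> 2 * \<bar>of_int k - of_int l\<bar>"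
proof -
  have G: "centered_gaussian \<mu> (\<lambda>k \<phi>. field_at n \<phi> k)" using \<mu> by (simp add: pinned_field_law_def)
  define r where "r k = response m n (lattice_index n k)" for k
  have cov: "(\<integral>\<phi>. field_at n \<phi> k * field_at n \<phi> l \<partial>\<mu>) = lattice_covariance m n k l - c * (r k * r l)" for k l
    using \<mu> by (simp add: pinned_field_law_def r_def)
  note im = centered_gaussian_integrable_mult[OF G]
  have eq: "(field_at n \<phi> k - field_at n \<phi> l)\<^sup>2 = field_at n \<phi> k * field_at n \<phi> k + field_at n \<phi> l * field_at n \<phi> l
      - 2 * (field_at n \<phi> k * field_at n \<phi> l)" for \<phi>
    by (simp add: power2_eq_square algebra_simps)
  have "(\<integral>\<phi>. (field_at n \<phi> k - field_at n \<phi> l)\<^sup>2 \<partial>\<mu>) =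
      lattice_covariance m n k k - c * (r k * r k) + (lattice_covariance m n l l - c * (r l * r l))
      - 2 * (lattice_covariance m n k l - c * (r k * r l))"
    unfolding eq using im[of k k] im[of l l] im[of k l]
    by (simp only: Bochner_Integration.integral_add Bochner_Integration.integral_diff
        Bochner_Integration.integrable_add integrable_mult_right integral_mult_right_zero cov)
  also have "\<dots> = lattice_covariance m n k k + lattice_covariance m n l l - 2 * lattice_covariance m n k l - c * (r k - r l)\<^sup>2"
    by (simp add: power2_eq_square algebra_simps)
  also have "\<dots> \<le> 2 * \<bar>of_int k - of_int l\<bar>"
    using lattice_covariance_increment[OF m, of n k l] c zero_le_power2[of "r k - r l"]
    by (smt (verit) mult_nonneg_nonneg)
  finally show ?thesis .
qed

text \<open>
  Split the increment at the lattice points between \<open>x\<close> and \<open>y\<close>. Inside a cell it is a fraction \<open>u\<close> of a lattice step, so its variance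
  carries \<open>u\<^sup>2 \<le> u\<close>. There are at most three pieces, and the square of a sum of three is at most three times the sum
  of the squares.
\<close>

lemma lin_interp_increment:
  fixes Z :: "int \<Rightarrow> 'w \<Rightarrow> real"
  assumes Z: "centered_gaussian \<mu> Z"
    and incr: "\<And>k l. (\<integral>\<omega>. (Z k \<omega> - Z l \<omega>)\<^sup>2 \<partial>\<mu>) \<le> 2 * \<bar>of_int k - of_int l\<bar>"
  shows "(\<integral>\<omega>. (lin_interp (\<lambda>k. Z k \<omega>) x - lin_interp (\<lambda>k. Z k \<omega>) y)\<^sup>2 \<partial>\<mu>) \<le> 6 * \<bar>x - y\<bar>"
proof -
  define L where "L x \<omega> = lin_interp (\<lambda>k. Z k \<omega>) x" for x \<omega>
  define D where "D k l = (\<integral>\<omega>. (Z k \<omega> - Z l \<omega>)\<^sup>2 \<partial>\<mu>)" for k l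
  have D: "D k l \<le> 2 * \<bar>of_int k - of_int l\<bar>" for k l unfolding D_def by (rule incr)
  have D1: "D (k + 1) k \<le> 2" for k using D[of "k + 1" k] by simp
  have iD: "integrable \<mu> (\<lambda>\<omega>. (Z k \<omega> - Z l \<omega>)\<^sup>2)" for k l by (rule integrable_increment_sq[OF Z])
  have sq: "u\<^sup>2 * d \<le> 2 * u" if "0 \<le> u" "u \<le> 1" "d \<le> 2" for u d :: real
  proof -
    have "u\<^sup>2 * d \<le> u\<^sup>2 * 2" using that by (intro mult_left_mono) auto
    also have "u\<^sup>2 \<le> u" using that by (simp add: power2_eq_square mult_left_le)
    finally show ?thesis by simp
  qed
  have main: "(\<integral>\<omega>. (L y \<omega> - L x \<omega>)\<^sup>2 \<partial>\<mu>) \<le> 6 * (y - x)" if "x \<le> y" for x y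
  proof (cases "y \<le> of_int \<lfloor>x\<rfloor> + 1")
    case True
    define k where "k = \<lfloor>x\<rfloor>"
    have k: "of_int k \<le> x" "x \<le> of_int k + 1" "of_int k \<le> y" "y \<le> of_int k + 1"
      using True \<open>x \<le> y\<close> unfolding k_def by linarith+
    have "L y \<omega> - L x \<omega> = (y - x) * (Z (k + 1) \<omega> - Z k \<omega>)" for \<omega>
      unfolding L_def lin_interp_cell[OF k(1,2)] lin_interp_cell[OF k(3,4)] by (simp add: algebra_simps)
    then have "(\<integral>\<omega>. (L y \<omega> - L x \<omega>)\<^sup>2 \<partial>\<mu>) = (y - x)\<^sup>2 * D (k + 1) k"
      unfolding D_def by (simp add: power_mult_distrib)
    also have "\<dots> \<le> 2 * (y - x)" using \<open>x \<le> y\<close> k D1 by (intro sq) auto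
    also have "\<dots> \<le> 6 * (y - x)" using \<open>x \<le> y\<close> by simp
    finally show ?thesis .
  next
    case False
    define k l where "k = \<lfloor>x\<rfloor>" and "l = \<lfloor>y\<rfloor>"
    have k: "of_int k \<le> x" "x \<le> of_int k + 1" unfolding k_def by linarith+
    have l: "of_int l \<le> y" "y \<le> of_int l + 1" unfolding l_def by linarith+
    have kl: "k + 1 \<le> l" using False unfolding k_def l_def by (simp add: le_floor_iff)
    define u v where "u = of_int k + 1 - x" and "v = y - of_int l"
    have uv: "0 \<le> u" "u \<le> 1" "0 \<le> v" "v \<le> 1" using k l unfolding u_def v_def by linarith+
    have split: "L y \<omega> - L x \<omega> = v * (Z (l + 1) \<omega> - Z l \<omega>) + (Z l \<omega> - Z (k + 1) \<omega>) + u * (Z (k + 1) \<omega> - Z k \<omega>)" for \<omega>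
      unfolding L_def lin_interp_cell[OF k] lin_interp_cell[OF l] u_def v_def by (simp add: algebra_simps)
    have three: "(a + b + c)\<^sup>2 \<le> 3 * a\<^sup>2 + 3 * b\<^sup>2 + 3 * c\<^sup>2" for a b c :: real
    proof -
      have "3 * a\<^sup>2 + 3 * b\<^sup>2 + 3 * c\<^sup>2 - (a + b + c)\<^sup>2 = (a - b)\<^sup>2 + (b - c)\<^sup>2 + (a - c)\<^sup>2"
        by (simp add: power2_eq_square algebra_simps)
      moreover have "0 \<le> (a - b)\<^sup>2 + (b - c)\<^sup>2 + (a - c)\<^sup>2" by simp
      ultimately show ?thesis by linarith
    qed
    let ?R = "\<lambda>\<omega>. 3 * v\<^sup>2 * (Z (l + 1) \<omega> - Z l \<omega>)\<^sup>2 + 3 * (Z l \<omega> - Z (k + 1) \<omega>)\<^sup>2 + 3 * u\<^sup>2 * (Z (k + 1) \<omega> - Z k \<omega>)\<^sup>2"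
    have pt: "(L y \<omega> - L x \<omega>)\<^sup>2 \<le> ?R \<omega>" for \<omega>
      using three[of "v * (Z (l + 1) \<omega> - Z l \<omega>)" "Z l \<omega> - Z (k + 1) \<omega>" "u * (Z (k + 1) \<omega> - Z k \<omega>)"]
      unfolding split by (simp add: power_mult_distrib)
    have iR: "integrable \<mu> ?R" by (intro Bochner_Integration.integrable_add integrable_mult_right iD)
    have Lm: "(\<lambda>\<omega>. (L y \<omega> - L x \<omega>)\<^sup>2) \<in> borel_measurable \<mu>"
      unfolding split
      by (intro borel_measurable_power borel_measurable_add borel_measurable_diff borel_measurable_times
          borel_measurable_const centered_gaussian_measurable[OF Z])
    have iL: "integrable \<mu> (\<lambda>\<omega>. (L y \<omega> - L x \<omega>)\<^sup>2)"
    proof (rule Bochner_Integration.integrable_bound[OF iR Lm], rule AE_I2)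
      fix \<omega>
      show "norm ((L y \<omega> - L x \<omega>)\<^sup>2) \<le> norm (?R \<omega>)"
        unfolding real_norm_def by (rule order_trans[OF _ abs_ge_self], rule order_trans[OF _ pt]) simp
    qed
    have "(\<integral>\<omega>. (L y \<omega> - L x \<omega>)\<^sup>2 \<partial>\<mu>) \<le> (\<integral>\<omega>. ?R \<omega> \<partial>\<mu>)"
      by (rule integral_mono[OF iL iR pt])
    also have "\<dots> = 3 * v\<^sup>2 * D (l + 1) l + 3 * D l (k + 1) + 3 * u\<^sup>2 * D (k + 1) k"
      unfolding D_def using iD
      by (simp only: Bochner_Integration.integral_add Bochner_Integration.integrable_add integrable_mult_right integral_mult_right_zero)
    also have "\<dots> \<le> 3 * (2 * v) + 3 * (2 * (of_int l - (of_int k + 1))) + 3 * (2 * u)"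
      using sq[OF uv(1,2) D1[of k]] sq[OF uv(3,4) D1[of l]] D[of l "k + 1"] kl by simp
    also have "\<dots> = 6 * (y - x)" by (simp add: u_def v_def)
    finally show ?thesis .
  qed
  show ?thesis
  proof (cases "x \<le> y")
    case True
    then show ?thesis using main[OF True] by (simp add: L_def power2_commute)
  next
    case False
    then show ?thesis using main[of y x] by (simp add: L_def)
  qed
qed

lemma W_eq_lin_interp:
  "W n t \<phi> = 1 / real n powr (1/4) * lin_interp (\<lambda>k. field_at n \<phi> (int (n div 2) + k)) (t * sqrt (real n))"
  by (simp add: W_def lin_interp_def)

lemma continuous_W: "continuous_on UNIV (\<lambda>t. W n t \<phi>)"
  unfolding W_eq_lin_interp
  by (intro continuous_intros continuous_on_compose2[OF continuous_on_lin_interp[of UNIV]]) auto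

lemma W_combination:
  fixes n :: nat and t :: real
  defines "a \<equiv> int (n div 2) + \<lfloor>t * sqrt (real n)\<rfloor>" and "b \<equiv> int (n div 2) + \<lceil>t * sqrt (real n)\<rceil>"
    and "p \<equiv> frac (t * sqrt (real n))"
  shows "W n t \<phi> = (\<Sum>j\<in>{a, b}. (1 / real n powr (1/4) * ((1 - p) * (if j = a then 1 else 0) + p * (if j = b then 1 else 0))) * field_at n \<phi> j)"
  unfolding W_def a_def[symmetric] b_def[symmetric] p_def[symmetric]
  by (cases "a = b") (simp_all add: algebra_simps add_divide_distrib)

lemma centered_gaussian_W:
  assumes "centered_gaussian \<mu> (\<lambda>k \<phi>. field_at n \<phi> k)"
  shows "centered_gaussian \<mu> (W n)"
  by (rule centered_gaussian_linear_image[OF assms _ W_combination]) simp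

lemma powr_quarter_sq: "(1 / real n powr (1/4))\<^sup>2 = 1 / sqrt (real n)"
  by (cases "n = 0") (simp_all add: power_divide power2_eq_square powr_add[symmetric] powr_half_sqrt)

lemma W_increment:
  assumes m: "m \<noteq> 0" and c: "0 \<le> c" and n: "0 < n" and \<mu>: "pinned_field_law m n c \<mu>"
  shows "(\<integral>\<phi>. (W n s \<phi> - W n t \<phi>)\<^sup>2 \<partial>\<mu>) \<le> 6 * \<bar>s - t\<bar>"
proof -
  let ?h = "int (n div 2)"
  let ?L = "\<lambda>x \<phi>. lin_interp (\<lambda>k. field_at n \<phi> (?h + k)) x"
  have G: "centered_gaussian \<mu> (\<lambda>k \<phi>. field_at n \<phi> (?h + k))"
    using \<mu> centered_gaussian_reindex[of \<mu> "\<lambda>k \<phi>. field_at n \<phi> k" "\<lambda>k. ?h + k"] by (simp add: pinned_field_law_def)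
  have "(W n s \<phi> - W n t \<phi>)\<^sup>2 = 1 / sqrt (real n) * (?L (s * sqrt (real n)) \<phi> - ?L (t * sqrt (real n)) \<phi>)\<^sup>2" for \<phi>
    unfolding W_eq_lin_interp right_diff_distrib[symmetric] power_mult_distrib powr_quarter_sq ..
  then have "(\<integral>\<phi>. (W n s \<phi> - W n t \<phi>)\<^sup>2 \<partial>\<mu>) =
      1 / sqrt (real n) * (\<integral>\<phi>. (?L (s * sqrt (real n)) \<phi> - ?L (t * sqrt (real n)) \<phi>)\<^sup>2 \<partial>\<mu>)"
    by (simp only: integral_mult_right_zero)
  also have "\<dots> \<le> 1 / sqrt (real n) * (6 * \<bar>s * sqrt (real n) - t * sqrt (real n)\<bar>)"
  proof (intro mult_left_mono lin_interp_increment[OF G])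
    show "(\<integral>\<phi>. (field_at n \<phi> (?h + k) - field_at n \<phi> (?h + l))\<^sup>2 \<partial>\<mu>) \<le> 2 * \<bar>of_int k - of_int l\<bar>" for k l
      using pinned_field_law_increment[OF m c \<mu>, of "?h + k" "?h + l"] by simp
  qed simp
  also have "\<bar>s * sqrt (real n) - t * sqrt (real n)\<bar> = \<bar>s - t\<bar> * sqrt (real n)"
    by (simp add: left_diff_distrib[symmetric] abs_mult)
  also have "1 / sqrt (real n) * (6 * (\<bar>s - t\<bar> * sqrt (real n))) = 6 * \<bar>s - t\<bar>" using n by simp
  finally show ?thesis .
qed

lemma W_covariance:
  fixes n :: nat
  assumes G: "centered_gaussian \<mu> (\<lambda>k \<phi>. field_at n \<phi> k)"
  defines "lo \<equiv> \<lambda>t. int (n div 2) + \<lfloor>t * sqrt (real n)\<rfloor>" and "hi \<equiv> \<lambda>t. int (n div 2) + \<lceil>t * sqrt (real n)\<rceil>"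
    and "p \<equiv> \<lambda>t. frac (t * sqrt (real n))"
    and "E \<equiv> \<lambda>k l. (\<integral>\<phi>. field_at n \<phi> k * field_at n \<phi> l \<partial>\<mu>) / sqrt (real n)"
  shows "(\<integral>\<phi>. W n s \<phi> * W n t \<phi> \<partial>\<mu>) =
    (1 - p s) * ((1 - p t) * E (lo s) (lo t) + p t * E (lo s) (hi t))
    + p s * ((1 - p t) * E (hi s) (lo t) + p t * E (hi s) (hi t))"
proof -
  let ?q = "1 / sqrt (real n)" and ?\<Phi> = "\<lambda>k \<phi>. field_at n \<phi> k"
  note im = centered_gaussian_integrable_mult[OF G]
  have c2: "1 / real n powr (1/4) * (1 / real n powr (1/4)) = ?q"
    using powr_quarter_sq[of n] by (simp only: power2_eq_square)
  have mult: "(c * x) * (c * y) = (c * c) * (x * y)" for c x y :: real by simp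
  have "W n s \<phi> * W n t \<phi> = ?q * ((1 - p s) * ((1 - p t) * (?\<Phi> (lo s) \<phi> * ?\<Phi> (lo t) \<phi>) + p t * (?\<Phi> (lo s) \<phi> * ?\<Phi> (hi t) \<phi>))
      + p s * ((1 - p t) * (?\<Phi> (hi s) \<phi> * ?\<Phi> (lo t) \<phi>) + p t * (?\<Phi> (hi s) \<phi> * ?\<Phi> (hi t) \<phi>)))" for \<phi>
    unfolding W_def lo_def hi_def p_def mult c2 by (simp add: algebra_simps)
  then have "(\<integral>\<phi>. W n s \<phi> * W n t \<phi> \<partial>\<mu>) = ?q *
      ((1 - p s) * ((1 - p t) * (\<integral>\<phi>. ?\<Phi> (lo s) \<phi> * ?\<Phi> (lo t) \<phi> \<partial>\<mu>) + p t * (\<integral>\<phi>. ?\<Phi> (lo s) \<phi> * ?\<Phi> (hi t) \<phi> \<partial>\<mu>))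
      + p s * ((1 - p t) * (\<integral>\<phi>. ?\<Phi> (hi s) \<phi> * ?\<Phi> (lo t) \<phi> \<partial>\<mu>) + p t * (\<integral>\<phi>. ?\<Phi> (hi s) \<phi> * ?\<Phi> (hi t) \<phi> \<partial>\<mu>)))"
    using im by (simp only: integral_mult_right_zero Bochner_Integration.integral_add
        Bochner_Integration.integrable_add integrable_mult_right)
  moreover have "q * ((1 - x) * ((1 - y) * a + y * b) + x * ((1 - y) * c + y * d)) =
      (1 - x) * ((1 - y) * (q * a) + y * (q * b)) + x * ((1 - y) * (q * c) + y * (q * d))" for q x y a b c d :: real
    by (simp add: algebra_simps)
  moreover have "E k l = ?q * (\<integral>\<phi>. ?\<Phi> k \<phi> * ?\<Phi> l \<phi> \<partial>\<mu>)" for k l by (simp add: E_def)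
  ultimately show ?thesis by (simp only:)
qed

section \<open>The scaling limit\<close>

lemma sinh_rate: "sinh (rate m) = sqrt (2 * m\<^sup>2 + m ^ 4)"
proof -
  have "(sinh (rate m))\<^sup>2 = (1 + m\<^sup>2)\<^sup>2 - 1" using hyperbolic_pythagoras[of "rate m"] by (simp add: cosh_rate)
  also have "\<dots> = 2 * m\<^sup>2 + m ^ 4" by (simp add: power2_eq_square power4_eq_xxxx algebra_simps)
  finally have "(sinh (rate m))\<^sup>2 = 2 * m\<^sup>2 + m ^ 4" .
  moreover have "0 \<le> sinh (rate m)" by (simp add: rate_def arcosh_nonneg_real)
  ultimately show ?thesis by (metis real_sqrt_unique)
qed

lemma sinh_over_self: "((\<lambda>x::real. sinh x / x) \<longlongrightarrow> 1) (at 0)"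
proof -
  have "(sinh has_real_derivative cosh 0) (at 0)" by (auto intro!: derivative_eq_intros)
  then show ?thesis by (simp add: has_field_derivative_iff)
qed

context
  fixes g :: real and N :: "nat \<Rightarrow> nat"
  assumes g: "0 < g" and N: "\<And>k. 0 < N k" "\<And>k. even (N k)" and Nlim: "filterlim (\<lambda>k. real (N k)) at_top sequentially"
begin

definition mass :: "nat \<Rightarrow> real" where "mass k = g / sqrt (real (N k))"

lemma mass_nz: "mass k \<noteq> 0"
  using g N(1)[of k] by (simp add: mass_def)

lemma mass_sq: "(mass k)\<^sup>2 = g\<^sup>2 / real (N k)"
  by (simp add: mass_def power_divide)

lemma sqrt_N_lim: "filterlim (\<lambda>k. sqrt (real (N k))) at_top sequentially"
  by (rule filterlim_compose[OF sqrt_at_top Nlim])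

lemma inverse_N_lim: "(\<lambda>k. c / real (N k)) \<longlonglongrightarrow> 0" "(\<lambda>k. c / sqrt (real (N k))) \<longlonglongrightarrow> 0"
  by (rule tendsto_divide_0[OF tendsto_const filterlim_at_top_imp_at_infinity[OF Nlim]])
     (rule tendsto_divide_0[OF tendsto_const filterlim_at_top_imp_at_infinity[OF sqrt_N_lim]])

lemma sinh_rate_lim: "(\<lambda>k. sqrt (real (N k)) * sinh (rate (mass k))) \<longlonglongrightarrow> sqrt 2 * g"
proof -
  have "sqrt (real (N k)) * sinh (rate (mass k)) = sqrt (2 * g\<^sup>2 + g ^ 4 / real (N k))" for k
  proof -
    have m4: "(mass k) ^ 4 = (g\<^sup>2 / real (N k))\<^sup>2" unfolding mass_sq[symmetric] by simp
    have "real (N k) * (2 * (mass k)\<^sup>2 + (mass k) ^ 4) = 2 * g\<^sup>2 + g ^ 4 / real (N k)"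
      unfolding m4 mass_sq using N(1)[of k] by (simp add: field_simps power2_eq_square power4_eq_xxxx)
    then show ?thesis by (simp add: sinh_rate real_sqrt_mult[symmetric])
  qed
  moreover have "(\<lambda>k. sqrt (2 * g\<^sup>2 + g ^ 4 / real (N k))) \<longlonglongrightarrow> sqrt (2 * g\<^sup>2 + 0)"
    by (intro tendsto_intros inverse_N_lim)
  ultimately show ?thesis using g by (simp add: real_sqrt_mult)
qed

lemma rate_lim_0: "(\<lambda>k. rate (mass k)) \<longlonglongrightarrow> 0"
proof -
  have "(\<lambda>k. arsinh (sinh (rate (mass k)))) \<longlonglongrightarrow> arsinh 0"
  proof (rule tendsto_arsinh)
    have "(\<lambda>k. (sqrt (real (N k)) * sinh (rate (mass k))) * (1 / sqrt (real (N k)))) \<longlonglongrightarrow> (sqrt 2 * g) * 0"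
      by (intro tendsto_mult sinh_rate_lim inverse_N_lim)
    then show "(\<lambda>k. sinh (rate (mass k))) \<longlonglongrightarrow> 0" using N(1) by simp
  qed
  then show ?thesis by (simp add: arsinh_sinh_real)
qed

text \<open>
  Passes from \<open>sinh \<theta>\<close>, which is explicit, to \<open>\<theta>\<close> by \<open>sinh \<theta> / \<theta> \<longlonglongrightarrow> 1\<close>.
\<close>

lemma rate_lim: "(\<lambda>k. rate (mass k) * sqrt (real (N k))) \<longlonglongrightarrow> sqrt 2 * g"
proof -
  have pos: "0 < rate (mass k)" for k by (rule rate_pos[OF mass_nz])
  have "filterlim (\<lambda>k. rate (mass k)) (at 0) sequentially"
    using rate_lim_0 pos by (auto simp: filterlim_at less_imp_neq[symmetric] intro!: always_eventually)
  then have "(\<lambda>k. sinh (rate (mass k)) / rate (mass k)) \<longlonglongrightarrow> 1"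
    by (rule filterlim_compose[OF sinh_over_self])
  from tendsto_divide[OF sinh_rate_lim this]
  have "(\<lambda>k. sqrt (real (N k)) * sinh (rate (mass k)) / (sinh (rate (mass k)) / rate (mass k))) \<longlonglongrightarrow> sqrt 2 * g / 1" by simp
  moreover have "sqrt (real (N k)) * sinh (rate (mass k)) / (sinh (rate (mass k)) / rate (mass k)) = rate (mass k) * sqrt (real (N k))" for k
    using pos[of k] by simp
  ultimately show ?thesis by simp
qed

lemma width_lim: "filterlim (\<lambda>k. rate (mass k) * real (N k + 1)) at_top sequentially"
proof -
  have "filterlim (\<lambda>k. sqrt (real (N k)) + 1 / sqrt (real (N k))) at_top sequentially"
    by (rule filterlim_at_top_mono[OF sqrt_N_lim]) auto
  then have "filterlim (\<lambda>k. (rate (mass k) * sqrt (real (N k))) * (sqrt (real (N k)) + 1 / sqrt (real (N k)))) at_top sequentially"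
    using g by (intro filterlim_tendsto_pos_mult_at_top[OF rate_lim]) auto
  moreover have "(rate (mass k) * sqrt (real (N k))) * (sqrt (real (N k)) + 1 / sqrt (real (N k))) = rate (mass k) * real (N k + 1)" for k
    using N(1)[of k] by (simp add: field_simps)
  ultimately show ?thesis by simp
qed

text \<open>
  With \<open>X = \<theta> (n + 1)\<close>, which tends to infinity, and \<open>d = \<theta> \<bar>a - b\<bar>\<close>, the leading term is
  \<open>cosh (X - d) / sinh X = cosh d * coth X - sinh d\<close>, which tends to \<open>exp (- d)\<close> at the limit of \<open>d\<close>. In the boundary term the argument of \<open>cosh\<close>
  stays bounded, because the window sits in the middle of the lattice, and \<open>sinh X\<close> in its denominator tends to infinity.
\<close>

lemma lattice_covariance_lim:
  fixes a b :: "nat \<Rightarrow> int"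
  assumes a: "(\<lambda>k. of_int (a k) / sqrt (real (N k))) \<longlonglongrightarrow> s" and b: "(\<lambda>k. of_int (b k) / sqrt (real (N k))) \<longlonglongrightarrow> t"
  shows "(\<lambda>k. lattice_covariance (mass k) (N k) (int (N k div 2) + a k) (int (N k div 2) + b k) / sqrt (real (N k)))
    \<longlonglongrightarrow> 1 / (sqrt 2 * g) * exp (- sqrt 2 * g * \<bar>t - s\<bar>)"
proof -
  define \<theta> where "\<theta> k = rate (mass k)" for k
  define X where "X k = \<theta> k * real (N k + 1)" for k
  define d where "d k = \<theta> k * \<bar>of_int (a k) - of_int (b k)\<bar>" for k
  define e where "e k = \<theta> k * (1 - of_int (a k) - of_int (b k))" for k
  let ?r = "\<lambda>k. sqrt (real (N k))"
  have r0: "0 < ?r k" for k using N(1)[of k] by simp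
  have \<theta>: "0 < \<theta> k" for k unfolding \<theta>_def by (rule rate_pos[OF mass_nz])
  have X0: "0 < sinh (X k)" for k using \<theta>[of k] by (simp add: X_def)
  have "d k = (rate (mass k) * ?r k) * \<bar>of_int (a k) / ?r k - of_int (b k) / ?r k\<bar>" for k
    using r0[of k] by (simp add: d_def \<theta>_def diff_divide_distrib[symmetric])
  moreover have "(\<lambda>k. (rate (mass k) * ?r k) * \<bar>of_int (a k) / ?r k - of_int (b k) / ?r k\<bar>) \<longlonglongrightarrow> (sqrt 2 * g) * \<bar>s - t\<bar>"
    by (intro tendsto_intros rate_lim a b)
  ultimately have dlim: "d \<longlonglongrightarrow> sqrt 2 * g * \<bar>s - t\<bar>" by presburger
  have "e k = (rate (mass k) * ?r k) * (1 / ?r k - of_int (a k) / ?r k - of_int (b k) / ?r k)" for k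
    using r0[of k] by (simp add: e_def \<theta>_def diff_divide_distrib[symmetric])
  moreover have "(\<lambda>k. (rate (mass k) * ?r k) * (1 / ?r k - of_int (a k) / ?r k - of_int (b k) / ?r k)) \<longlonglongrightarrow> (sqrt 2 * g) * (0 - s - t)"
    by (intro tendsto_intros rate_lim a b inverse_N_lim)
  ultimately have elim: "e \<longlonglongrightarrow> sqrt 2 * g * (0 - s - t)" by presburger
  have Xlim: "filterlim X at_top sequentially" unfolding X_def \<theta>_def by (rule width_lim)
  have coth: "(\<lambda>k. 1 / tanh (X k)) \<longlonglongrightarrow> 1 / 1"
    by (intro tendsto_divide tendsto_const filterlim_compose[OF tanh_real_at_top Xlim]) simp
  have sinh_inf: "filterlim (\<lambda>k. sinh (X k)) at_infinity sequentially"
    by (intro filterlim_at_top_imp_at_infinity filterlim_compose[OF sinh_real_at_top Xlim])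
  have 1: "(\<lambda>k. cosh (d k) * (1 / tanh (X k)) - sinh (d k)) \<longlonglongrightarrow>
      cosh (sqrt 2 * g * \<bar>s - t\<bar>) * (1 / 1) - sinh (sqrt 2 * g * \<bar>s - t\<bar>)"
    by (intro tendsto_intros dlim coth)
  have 2: "(\<lambda>k. cosh (e k) / sinh (X k)) \<longlonglongrightarrow> 0"
    by (rule tendsto_divide_0[OF tendsto_cosh[OF elim] sinh_inf])
  have "(\<lambda>k. 1 / (?r k * sinh (\<theta> k)) * (cosh (d k) * (1 / tanh (X k)) - sinh (d k) - cosh (e k) / sinh (X k))) \<longlonglongrightarrow>
      1 / (sqrt 2 * g) * (cosh (sqrt 2 * g * \<bar>s - t\<bar>) * (1 / 1) - sinh (sqrt 2 * g * \<bar>s - t\<bar>) - 0)"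
    using g unfolding \<theta>_def by (intro tendsto_mult tendsto_divide tendsto_const sinh_rate_lim tendsto_diff 1 2) auto
  also have "cosh (sqrt 2 * g * \<bar>s - t\<bar>) * (1 / 1) - sinh (sqrt 2 * g * \<bar>s - t\<bar>) - 0 = exp (- sqrt 2 * g * \<bar>t - s\<bar>)"
    by (simp add: cosh_minus_sinh abs_minus_commute)
  finally have lim: "(\<lambda>k. 1 / (?r k * sinh (\<theta> k)) * (cosh (d k) * (1 / tanh (X k)) - sinh (d k) - cosh (e k) / sinh (X k))) \<longlonglongrightarrow>
      1 / (sqrt 2 * g) * exp (- sqrt 2 * g * \<bar>t - s\<bar>)" .
  \<comment> \<open>for large \<open>k\<close> the sites lie inside the lattice and are not moved by \<open>lattice_index\<close>\<close>
  have bulk: "\<forall>\<^sub>F k in sequentially. 0 \<le> int (N k div 2) + c k \<and> int (N k div 2) + c k \<le> int (N k) + 1"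
    if c: "(\<lambda>k. of_int (c k) / ?r k) \<longlonglongrightarrow> u" for c :: "nat \<Rightarrow> int" and u
  proof -
    have "(\<lambda>k. of_int (c k) / ?r k * (1 / ?r k)) \<longlonglongrightarrow> u * 0" by (intro tendsto_mult c inverse_N_lim)
    then have "(\<lambda>k. \<bar>of_int (c k) / ?r k * (1 / ?r k)\<bar>) \<longlonglongrightarrow> \<bar>u * 0\<bar>" by (rule tendsto_rabs)
    then have "\<forall>\<^sub>F k in sequentially. \<bar>of_int (c k) / ?r k * (1 / ?r k)\<bar> < 1 / 2" by (rule order_tendstoD(2)) simp
    then show ?thesis
    proof eventually_elim
      case (elim k)
      have "of_int (c k) / ?r k * (1 / ?r k) = of_int (c k) / real (N k)" by simp
      with elim have "\<bar>of_int (c k)\<bar> < real (N k) / 2" using N(1)[of k] by (simp add: abs_divide field_simps)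
      moreover have "real (N k) / 2 = real (N k div 2)" using N(2)[of k] by (simp add: real_of_nat_div)
      ultimately have "\<bar>c k\<bar> < int (N k div 2)" by linarith
      moreover have "2 * int (N k div 2) = int (N k)" using N(2)[of k] by auto
      ultimately show ?case by linarith
    qed
  qed
  have eq: "\<forall>\<^sub>F k in sequentially.
      1 / (?r k * sinh (\<theta> k)) * (cosh (d k) * (1 / tanh (X k)) - sinh (d k) - cosh (e k) / sinh (X k)) =
      lattice_covariance (mass k) (N k) (int (N k div 2) + a k) (int (N k div 2) + b k) / ?r k"
    using bulk[OF a] bulk[OF b]
  proof eventually_elim
    case (elim k)
    let ?i = "int (N k div 2) + a k" and ?j = "int (N k div 2) + b k"
    have li: "real (lattice_index (N k) ?i) = of_int ?i" "real (lattice_index (N k) ?j) = of_int ?j"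
      using elim by (simp_all add: lattice_index_def)
    have half: "2 * real (N k div 2) = real (N k)" using N(2)[of k] by (simp add: real_of_nat_div)
    have A: "\<theta> k * (real (N k + 1) - \<bar>of_int ?i - of_int ?j\<bar>) = X k - d k"
      by (simp add: X_def d_def algebra_simps)
    have B: "\<theta> k * (real (N k + 1) - of_int ?i - of_int ?j) = e k"
    proof -
      have "real (N k + 1) - of_int ?i - of_int ?j = 1 - of_int (a k) - of_int (b k)" using half by simp
      then show ?thesis by (simp only: e_def)
    qed
    have "lattice_covariance (mass k) (N k) ?i ?j = (cosh (X k - d k) - cosh (e k)) / (sinh (\<theta> k) * sinh (X k))"
      unfolding lattice_covariance_def green_def li \<theta>_def[symmetric] A B X_def[symmetric] ..
    also have "cosh (X k - d k) = cosh (d k) * cosh (X k) - sinh (d k) * sinh (X k)"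
      by (simp add: cosh_diff mult.commute)
    finally have lat: "lattice_covariance (mass k) (N k) ?i ?j =
        (cosh (d k) * cosh (X k) - sinh (d k) * sinh (X k) - cosh (e k)) / (sinh (\<theta> k) * sinh (X k))" .
    have "1 / (r * h) * (C * (c / x) - S - e / x) = (C * c - S * x - e) / (h * x) / r"
      if "r \<noteq> 0" "h \<noteq> 0" "x \<noteq> 0" for r h x C c S e :: real
      using that by (simp add: field_simps)
    moreover have "1 / tanh (X k) = cosh (X k) / sinh (X k)" by (simp add: tanh_def)
    moreover have "?r k \<noteq> 0" "sinh (\<theta> k) \<noteq> 0" "sinh (X k) \<noteq> 0" using X0[of k] r0[of k] \<theta>[of k] by auto
    ultimately show ?case unfolding lat by (simp only:)
  qed
  show ?thesis by (rule Lim_transform_eventually[OF lim eq])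
qed

lemma floor_ceiling_lim:
  "(\<lambda>k. of_int \<lfloor>t * sqrt (real (N k))\<rfloor> / sqrt (real (N k))) \<longlonglongrightarrow> t"
  "(\<lambda>k. of_int \<lceil>t * sqrt (real (N k))\<rceil> / sqrt (real (N k))) \<longlonglongrightarrow> t"
proof -
  let ?r = "\<lambda>k. sqrt (real (N k))"
  have r0: "0 < ?r k" for k using N(1)[of k] by simp
  have near: "(\<lambda>k. of_int (c k) / ?r k) \<longlonglongrightarrow> t" if c: "\<And>k. \<bar>of_int (c k) - t * ?r k\<bar> \<le> 1" for c :: "nat \<Rightarrow> int"
  proof -
    have "(\<lambda>k. of_int (c k) / ?r k - t) \<longlonglongrightarrow> 0"
    proof (rule Lim_null_comparison[OF always_eventually inverse_N_lim(2)[of 1]], rule allI)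
      fix k
      have "of_int (c k) / ?r k - t = (of_int (c k) - t * ?r k) / ?r k" using r0[of k] by (simp add: field_simps)
      then show "norm (of_int (c k) / ?r k - t) \<le> 1 / ?r k"
        using c[of k] r0[of k] by (simp add: abs_divide divide_right_mono)
    qed
    then show ?thesis by (simp add: LIM_zero_iff)
  qed
  show "(\<lambda>k. of_int \<lfloor>t * ?r k\<rfloor> / ?r k) \<longlonglongrightarrow> t" by (rule near) linarith
  show "(\<lambda>k. of_int \<lceil>t * ?r k\<rceil> / ?r k) \<longlonglongrightarrow> t" by (rule near) linarith
qed

text \<open>
  The interpolation weights \<open>p\<close> oscillate with \<open>k\<close>, so the limit cannot be taken factor by factor.
\<close>

lemma convex_combination_lim:
  fixes x y p :: "nat \<Rightarrow> real"
  assumes x: "x \<longlonglongrightarrow> l" and y: "y \<longlonglongrightarrow> l" and p: "\<And>k. 0 \<le> p k" "\<And>k. p k \<le> 1"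
  shows "(\<lambda>k. (1 - p k) * x k + p k * y k) \<longlonglongrightarrow> l"
proof -
  have "(\<lambda>k. p k * (y k - x k)) \<longlonglongrightarrow> 0"
  proof (rule Lim_null_comparison[OF always_eventually], rule allI)
    show "norm (p k * (y k - x k)) \<le> \<bar>y k - x k\<bar>" for k
      using p[of k] by (simp add: abs_mult mult_left_le_one_le)
    show "(\<lambda>k. \<bar>y k - x k\<bar>) \<longlonglongrightarrow> 0" using tendsto_rabs[OF tendsto_diff[OF y x]] by simp
  qed
  from tendsto_add[OF x this] show ?thesis by (simp add: algebra_simps)
qed

text \<open>
  The rank-one term is negligible: \<open>c\<close> is of order \<open>1 / n\<^sup>2\<close> and the response of order \<open>n\<close>, so after division by \<open>sqrt n\<close>
  it is of order \<open>1 / sqrt n\<close>.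
\<close>

lemma W_covariance_lim:
  fixes \<mu> :: "nat \<Rightarrow> (nat \<Rightarrow> real) measure" and c :: "nat \<Rightarrow> real"
  assumes c: "\<And>k. 0 \<le> c k" "\<And>k. c k \<le> 1 / total_variance (mass k) (N k)"
    and \<mu>: "\<And>k. pinned_field_law (mass k) (N k) (c k) (\<mu> k)"
  shows "(\<lambda>k. \<integral>\<phi>. W (N k) s \<phi> * W (N k) t \<phi> \<partial>\<mu> k) \<longlonglongrightarrow> 1 / (sqrt 2 * g) * exp (- sqrt 2 * g * \<bar>t - s\<bar>)"
proof -
  let ?r = "\<lambda>k. sqrt (real (N k))" and ?K = "1 / (sqrt 2 * g) * exp (- sqrt 2 * g * \<bar>t - s\<bar>)"
  have G: "centered_gaussian (\<mu> k) (\<lambda>i \<phi>. field_at (N k) \<phi> i)" for k using \<mu> by (simp add: pinned_field_law_def)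
  define E where "E k i j = (\<integral>\<phi>. field_at (N k) \<phi> i * field_at (N k) \<phi> j \<partial>\<mu> k) / ?r k" for k i j
  have E: "(\<lambda>k. E k (int (N k div 2) + a k) (int (N k div 2) + b k)) \<longlonglongrightarrow> ?K"
    if a: "(\<lambda>k. of_int (a k) / ?r k) \<longlonglongrightarrow> s" and b: "(\<lambda>k. of_int (b k) / ?r k) \<longlonglongrightarrow> t" for a b :: "nat \<Rightarrow> int"
  proof -
    define R where "R k = c k * (response (mass k) (N k) (lattice_index (N k) (int (N k div 2) + a k)) *
        response (mass k) (N k) (lattice_index (N k) (int (N k div 2) + b k))) / ?r k" for k
    have R: "R \<longlonglongrightarrow> 0"
    proof (rule Lim_null_comparison[OF always_eventually inverse_N_lim(2)[of "(1 + g\<^sup>2) / g ^ 4"]], rule allI)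
      fix k
      have n0: "0 < real (N k)" using N(1)[of k] by simp
      have "(real (N k))\<^sup>2 / (1 + (mass k)\<^sup>2 * real (N k)) \<le> total_variance (mass k) (N k)"
        using N(1)[of k] by (intro total_variance_lower mass_nz) simp
      then have tv: "(real (N k))\<^sup>2 / (1 + g\<^sup>2) \<le> total_variance (mass k) (N k)" using n0 by (simp add: mass_sq)
      have p: "0 < (real (N k))\<^sup>2 / (1 + g\<^sup>2)" using n0 by (intro divide_pos_pos add_pos_nonneg) auto
      have "c k \<le> 1 / ((real (N k))\<^sup>2 / (1 + g\<^sup>2))"
        using c(2)[of k] divide_left_mono[OF tv, of 1] p tv by (smt (verit) mult_pos_pos)
      then have ck: "c k \<le> (1 + g\<^sup>2) / (real (N k))\<^sup>2" by simp
      have resp: "\<bar>response (mass k) (N k) (lattice_index (N k) j)\<bar> \<le> real (N k) / g\<^sup>2" for j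
        using response_abs_le[OF mass_nz lattice_index(1)] by (simp add: mass_sq)
      have "\<bar>R k\<bar> \<le> ((1 + g\<^sup>2) / (real (N k))\<^sup>2) * ((real (N k) / g\<^sup>2) * (real (N k) / g\<^sup>2)) / ?r k"
        unfolding R_def abs_divide abs_mult using c(1)[of k] ck resp n0
        by (intro divide_mono mult_mono mult_nonneg_nonneg) auto
      also have "\<dots> = (1 + g\<^sup>2) / g ^ 4 / ?r k"
        using n0 by (simp add: power2_eq_square power4_eq_xxxx)
      finally show "norm (R k) \<le> (1 + g\<^sup>2) / g ^ 4 / ?r k" by simp
    qed
    have "E k (int (N k div 2) + a k) (int (N k div 2) + b k) =
        lattice_covariance (mass k) (N k) (int (N k div 2) + a k) (int (N k div 2) + b k) / ?r k - R k" for k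
      using \<mu>[of k] unfolding E_def R_def pinned_field_law_def by (simp add: diff_divide_distrib)
    then show ?thesis using tendsto_diff[OF lattice_covariance_lim[OF a b] R] by simp
  qed
  have fr: "0 \<le> frac x" "frac x \<le> 1" for x :: real using frac_lt_1[of x] by auto
  show ?thesis
    unfolding W_covariance[OF G] E_def[symmetric]
    by (intro convex_combination_lim E floor_ceiling_lim fr)
qed

lemma pinned_field_converges:
  fixes \<mu> :: "nat \<Rightarrow> (nat \<Rightarrow> real) measure" and \<Omega> :: "'w measure" and Y :: "real \<Rightarrow> 'w \<Rightarrow> real"
  assumes Y: "stationary_OU g \<Omega> Y" and F: "F = filtermap N sequentially"
    and c: "\<And>k. 0 \<le> c k" "\<And>k. c k \<le> 1 / total_variance (mass k) (N k)"
    and \<mu>: "\<And>k. pinned_field_law (mass k) (N k) (c k) (\<mu> (N k))"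
  shows "process_converges_weakly \<mu> W \<Omega> Y F"
proof (rule gaussian_process_converges_weakly[OF F])
  have YG: "centered_gaussian \<Omega> Y" using Y by (simp add: stationary_OU_def centered_gaussian_def)
  then show "centered_gaussian \<Omega> Y" .
  show "centered_gaussian (\<mu> (N k)) (W (N k))" for k
    using \<mu>[of k] by (intro centered_gaussian_W) (simp add: pinned_field_law_def)
  show "continuous_on UNIV (\<lambda>t. W (N k) t \<omega>)" for k \<omega> by (rule continuous_W)
  show "continuous_on UNIV (\<lambda>t. Y t \<omega>)" if "\<omega> \<in> space \<Omega>" for \<omega> using Y that by (simp add: stationary_OU_def)
  show "(\<integral>\<omega>. (W (N k) s \<omega> - W (N k) t \<omega>)\<^sup>2 \<partial>\<mu> (N k)) \<le> 6 * \<bar>s - t\<bar>" for k s t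
    by (rule W_increment[OF mass_nz c(1) N(1) \<mu>])
  have "(\<integral>\<omega>. Y s \<omega> * Y t \<omega> \<partial>\<Omega>) = covariance \<Omega> (Y s) (Y t)" for s t
    unfolding covariance_def centered_gaussian_mean[OF YG] by simp
  then have cov: "(\<integral>\<omega>. Y s \<omega> * Y t \<omega> \<partial>\<Omega>) = 1 / (sqrt 2 * g) * exp (- sqrt 2 * g * \<bar>t - s\<bar>)" for s t
    using Y by (simp add: stationary_OU_def)
  show "(\<lambda>k. \<integral>\<omega>. W (N k) s \<omega> * W (N k) t \<omega> \<partial>\<mu> (N k)) \<longlonglongrightarrow> (\<integral>\<omega>. Y s \<omega> * Y t \<omega> \<partial>\<Omega>)" for s t
    unfolding cov by (rule W_covariance_lim[OF c \<mu>])
qed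

end

theorem theorem5p7:
  fixes g :: real and \<Omega> :: "'w measure" and Y :: "real \<Rightarrow> 'w \<Rightarrow> real"
  assumes "g > 0" and "stationary_OU g \<Omega> Y"
  shows "process_converges_weakly (\<lambda>n. grand_canonical (g / sqrt (real n)) n) W \<Omega> Y even_sequentially
       \<and> process_converges_weakly (\<lambda>n. canonical (g / sqrt (real n)) n) W \<Omega> Y even_sequentially"
proof -
  \<comment> \<open>starts at \<open>n = 2\<close>, since at \<open>n = 0\<close> the mass \<open>g / sqrt n\<close> is 0\<close>
  let ?N = "\<lambda>k. 2 * Suc k"
  have N: "0 < ?N k" "even (?N k)" for k by simp_all
  have Nlim: "filterlim (\<lambda>k. real (?N k)) at_top sequentially"
    by (rule filterlim_at_top_mono[OF filterlim_real_sequentially]) auto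
  note mass = mass_def[OF assms(1) N Nlim]
  have m: "g / sqrt (real (?N k)) \<noteq> 0" for k using assms(1) by simp
  have tv: "0 < total_variance (g / sqrt (real (?N k))) (?N k)" for k
    by (rule total_variance_pos[OF m]) simp
  show ?thesis
  proof
    show "process_converges_weakly (\<lambda>n. grand_canonical (g / sqrt (real n)) n) W \<Omega> Y even_sequentially"
    proof (rule pinned_field_converges[OF assms(1) N Nlim assms(2) even_sequentially_eq, where c="\<lambda>_. 0"])
      show "pinned_field_law (mass g ?N k) (?N k) 0 (grand_canonical (g / sqrt (real (?N k))) (?N k))" for k
        unfolding mass by (rule pinned_field_law_grand_canonical[OF m])
      show "0 \<le> 1 / total_variance (mass g ?N k) (?N k)" for k
        unfolding mass using tv[of k] by (simp only: zero_le_divide_1_iff less_imp_le)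
    qed simp
    show "process_converges_weakly (\<lambda>n. canonical (g / sqrt (real n)) n) W \<Omega> Y even_sequentially"
    proof (rule pinned_field_converges[OF assms(1) N Nlim assms(2) even_sequentially_eq,
            where c="\<lambda>k. 1 / total_variance (mass g ?N k) (?N k)"])
      show "pinned_field_law (mass g ?N k) (?N k) (1 / total_variance (mass g ?N k) (?N k))
          (canonical (g / sqrt (real (?N k))) (?N k))" for k
        unfolding mass by (rule pinned_field_law_canonical[OF m]) simp
      show "0 \<le> 1 / total_variance (mass g ?N k) (?N k)" for k
        unfolding mass using tv[of k] by (simp only: zero_le_divide_1_iff less_imp_le)
    qed simp
  qed
qed

end
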